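(* Let $\alpha>0$ and $J_\alpha(q)=\frac12\|u_{\alpha q}-z_d\|_{\mathcal{H}}^2+\frac M2\|q\|_{\mathcal{Q}}^2$ for $q\in\mathcal{Q}$. Then: (i) There exists a unique $\overline{q}_\alpha\in\mathcal{Q}$ such that $J_\alpha(\overline{q}_\alpha)=\min_{q\in\mathcal{Q}}J_\alpha(q)$. (ii) The Gâteaux derivative of $J_\alpha$ is $J_\alpha'(q)=Mq-p_{\alpha q}$ for all $q\in\mathcal{Q}$, and the optimality condition for the minimization problem in (i) is $$M\overline{q}_\alpha-p_{\alpha\overline{q}_\alpha}=0\quad\text{in }\mathcal{Q}.$$
   Context: $\Omega\subset\mathbb{R}^n$ is a bounded domain with regular boundary $\Gamma=\Gamma_1\cup\Gamma_2$, $\Gamma_1,\Gamma_2$ disjoint with positive $(n-1)$-dimensional measure; $T>0$. Put $V=H^1(\Omega)$, $H=L^2(\Omega)$, $Q=L^2(\Gamma_2)$, $\mathcal{H}=L^2(0,T;H)$, $\mathcal{Q}=L^2(0,T;Q)$ with their usual inner products, $a(u,v)=\int_\Omega\nabla u\cdot\nabla v\,dx$ and $a_\alpha(u,v)=a(u,v)+\alpha\int_{\Gamma_1}uv\,d\gamma$. Fixed data: $g\in\mathcal{H}$, $b\in H^{1/2}(\Gamma_1)$, $v_b\in V$ with $v_b=b$ on $\Gamma_1$, $z_d\in\mathcal{H}$, and a constant $M>0$; data and domain are sufficiently smooth for the variational problems below to have unique solutions. For $q\in\mathcal{Q}$, $u_{\alpha q}$ is the unique function with $u_{\alpha q}\in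 L^2(0,T;V)$, $\dot u_{\alpha q}\in L^2(0,T;V')$, $u_{\alpha q}(0)=v_b$ and, for a.e. $t\in(0,T)$, $$\langle\dot u_{\alpha q}(t),v\rangle+a_\alpha(u_{\alpha q}(t),v)=(g(t),v)_H-(q(t),v)_Q+\alpha\int_{\Gamma_1}bv\,d\gamma\quad\forall v\in V.$$ The adjoint state $p_{\alpha q}$ is the unique function with $p_{\alpha q}\in L^2(0,T;V)$, $\dot p_{\alpha q}\in L^2(0,T;V')$, $p_{\alpha q}(T)=0$ and, for a.e. $t$, $-\langle\dot p_{\alpha q}(t),v\rangle+a_\alpha(p_{\alpha q}(t),v)=(u_{\alpha q}(t)-z_d(t),v)_H$ for all $v\in V$. Here $\langle\cdot,\cdot\rangle$ is the duality between $V'$ and $V$. When $v\in V$ or $p_{\alpha q}$ appears in an expression in $Q$ or $\mathcal{Q}$ it stands for its trace on $\Gamma_2$; $J_\alpha'(q)$ is identified with an element of $\mathcal{Q}$ by the Riesz isomorphism. *)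

theory Defs
  imports "HOL-Analysis.Analysis"
begin

section \<open>Hausdorff measure and regular domains\<close>

text \<open>The \<open>k\<close>-dimensional Hausdorff outer measure, normalised so that on \<open>k\<close>-dimensional
  Lipschitz graphs it is the usual surface measure. The empty set has to be treated separately
  because of \<open>0 ^ 0 = 1\<close> when \<open>k = 0\<close>.\<close>

definition hausdorff_outer :: "nat \<Rightarrow> 'a::metric_space set \<Rightarrow> ennreal" where
  "hausdorff_outer k A =
    (SUP \<delta>\<in>{0<..}. INF C\<in>{C :: nat \<Rightarrow> 'a set. A \<subseteq> (\<Union>i. C i) \<and>
                                 (\<forall>i. bounded (C i) \<and> diameter (C i) \<le> \<delta>)}.
       \<Sum>i. if C i = {} then 0
            else ennreal (unit_ball_vol (real k) * (diameter (C i) / 2) ^ k))"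

definition surface_measure :: "(real ^ 'n) measure" where
  "surface_measure = measure_of UNIV (sets borel) (hausdorff_outer (CARD('n) - 1))"

abbreviation surface_on :: "(real ^ 'n) set \<Rightarrow> (real ^ 'n) measure" where
  "surface_on S \<equiv> restrict_space surface_measure S"

text \<open>Near each of its boundary points \<open>\<Omega>\<close> is the strict epigraph, in some direction \<open>e\<close>, of a
  Lipschitz function of the projection onto the hyperplane orthogonal to \<open>e\<close>.\<close>

definition lipschitz_boundary :: "(real ^ 'n) set \<Rightarrow> bool" where
  "lipschitz_boundary \<Omega> \<longleftrightarrow>
    (\<forall>x\<in>frontier \<Omega>. \<exists>r>0. \<exists>e L \<phi>. norm e = 1 \<and> L-lipschitz_on UNIV \<phi> \<and>
       \<Omega> \<inter> ball x r = {y \<in> ball x r. \<phi> (y - (y \<bullet> e) *\<^sub>R e) < y \<bullet> e})"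

definition regular_domain :: "(real ^ 'n) set \<Rightarrow> bool" where
  "regular_domain \<Omega> \<longleftrightarrow>
    open \<Omega> \<and> connected \<Omega> \<and> \<Omega> \<noteq> {} \<and> bounded \<Omega> \<and> lipschitz_boundary \<Omega>"


section \<open>Square-integrable functions and the Sobolev space of order one\<close>

text \<open>All function spaces are sets of representatives carrying a seminorm; equality of elements is
  equality almost everywhere.\<close>

definition l2_space :: "'a measure \<Rightarrow> ('a \<Rightarrow> real) set" where
  "l2_space M = {f \<in> borel_measurable M. integrable M (\<lambda>x. (f x)\<^sup>2)}"

definition l2_inner :: "'a measure \<Rightarrow> ('a \<Rightarrow> real) \<Rightarrow> ('a \<Rightarrow> real) \<Rightarrow> real" where
  "l2_inner M f g = (\<integral>x. f x * g x \<partial>M)"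

definition l2_norm :: "'a measure \<Rightarrow> ('a \<Rightarrow> real) \<Rightarrow> real" where
  "l2_norm M f = sqrt (l2_inner M f f)"

text \<open>Weak derivatives are tested with compactly supported \<open>C\<^sup>1\<close> functions; testing with smooth ones
  gives the same notion, by mollification.\<close>

definition has_weak_gradient ::
  "(real ^ 'n) set \<Rightarrow> (real ^ 'n \<Rightarrow> real) \<Rightarrow> (real ^ 'n \<Rightarrow> real ^ 'n) \<Rightarrow> bool" where
  "has_weak_gradient \<Omega> f G \<longleftrightarrow>
    (\<forall>i. (\<lambda>x. G x $ i) \<in> l2_space (lebesgue_on \<Omega>)) \<and>
    (\<forall>\<phi> d\<phi> K. (\<forall>x. GDERIV \<phi> x :> d\<phi> x) \<and> continuous_on UNIV d\<phi> \<and>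
        compact K \<and> K \<subseteq> \<Omega> \<and> (\<forall>x. x \<notin> K \<longrightarrow> \<phi> x = 0) \<longrightarrow>
      (\<forall>i. (\<integral>x. f x * d\<phi> x $ i \<partial>lebesgue_on \<Omega>) = - (\<integral>x. G x $ i * \<phi> x \<partial>lebesgue_on \<Omega>)))"

definition weak_gradient ::
  "(real ^ 'n) set \<Rightarrow> (real ^ 'n \<Rightarrow> real) \<Rightarrow> real ^ 'n \<Rightarrow> real ^ 'n" where
  "weak_gradient \<Omega> f = (SOME G. has_weak_gradient \<Omega> f G)"

definition h1_space :: "(real ^ 'n) set \<Rightarrow> (real ^ 'n \<Rightarrow> real) set" where
  "h1_space \<Omega> = {f \<in> l2_space (lebesgue_on \<Omega>). \<exists>G. has_weak_gradient \<Omega> f G}"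

definition dirichlet_form ::
  "(real ^ 'n) set \<Rightarrow> (real ^ 'n \<Rightarrow> real) \<Rightarrow> (real ^ 'n \<Rightarrow> real) \<Rightarrow> real" where
  "dirichlet_form \<Omega> u v = (\<integral>x. weak_gradient \<Omega> u x \<bullet> weak_gradient \<Omega> v x \<partial>lebesgue_on \<Omega>)"

definition h1_norm :: "(real ^ 'n) set \<Rightarrow> (real ^ 'n \<Rightarrow> real) \<Rightarrow> real" where
  "h1_norm \<Omega> v = sqrt (l2_inner (lebesgue_on \<Omega>) v v + dirichlet_form \<Omega> v v)"

text \<open>The trace operator on a Lipschitz domain exists and is determined, up to surface-null sets, by
  these properties.\<close>

definition trace_operator ::
  "(real ^ 'n) set \<Rightarrow> ((real ^ 'n \<Rightarrow> real) \<Rightarrow> (real ^ 'n \<Rightarrow> real)) \<Rightarrow> bool" where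
  "trace_operator \<Omega> tr \<longleftrightarrow>
    (\<forall>v\<in>h1_space \<Omega>. tr v \<in> l2_space (surface_on (frontier \<Omega>))) \<and>
    (\<forall>u\<in>h1_space \<Omega>. \<forall>v\<in>h1_space \<Omega>. \<forall>r s.
       AE x in surface_on (frontier \<Omega>). tr (\<lambda>y. r * u y + s * v y) x = r * tr u x + s * tr v x) \<and>
    (\<exists>C. \<forall>v\<in>h1_space \<Omega>. l2_norm (surface_on (frontier \<Omega>)) (tr v) \<le> C * h1_norm \<Omega> v) \<and>
    (\<forall>v\<in>h1_space \<Omega>. continuous_on (closure \<Omega>) v \<longrightarrow>
       (AE x in surface_on (frontier \<Omega>). tr v x = v x))"

text \<open>\<open>H\<^sup>1\<^sup>/\<^sup>2(S)\<close> for \<open>S\<close> of dimension \<open>n - 1\<close>: the Gagliardo kernel has exponent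
  \<open>(n - 1) + 2 * (1/2) = n\<close>.\<close>

definition h_half_space :: "(real ^ 'n) set \<Rightarrow> (real ^ 'n \<Rightarrow> real) set" where
  "h_half_space S = {f \<in> l2_space (surface_on S).
     (\<integral>\<^sup>+x. \<integral>\<^sup>+y. ennreal ((f x - f y)\<^sup>2 / norm (x - y) ^ CARD('n)) \<partial>surface_on S \<partial>surface_on S)
       < \<infinity>}"


section \<open>Dual space and Bochner spaces in time\<close>

definition dual_space :: "('a \<Rightarrow> real) set \<Rightarrow> (('a \<Rightarrow> real) \<Rightarrow> real) \<Rightarrow> (('a \<Rightarrow> real) \<Rightarrow> real) set" where
  "dual_space X N = {l.
     (\<forall>u\<in>X. \<forall>v\<in>X. \<forall>r s. l (\<lambda>x. r * u x + s * v x) = r * l u + s * l v) \<and>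
     (\<exists>C. \<forall>v\<in>X. \<bar>l v\<bar> \<le> C * N v)}"

definition dual_norm ::
  "('a \<Rightarrow> real) set \<Rightarrow> (('a \<Rightarrow> real) \<Rightarrow> real) \<Rightarrow> (('a \<Rightarrow> real) \<Rightarrow> real) \<Rightarrow> real" where
  "dual_norm X N l = (SUP v\<in>{v\<in>X. N v \<le> 1}. \<bar>l v\<bar>)"

text \<open>\<open>bochner_l2 T X N\<close> is \<open>L\<^sup>2(0,T;X)\<close> for the space \<open>X\<close> with seminorm \<open>N\<close>; the second conjunct is
  strong measurability.\<close>

definition bochner_l2 ::
  "real \<Rightarrow> ('b \<Rightarrow> real) set \<Rightarrow> (('b \<Rightarrow> real) \<Rightarrow> real) \<Rightarrow> (real \<Rightarrow> 'b \<Rightarrow> real) set" where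
  "bochner_l2 T X N = {f.
     (\<forall>t\<in>{0<..<T}. f t \<in> X) \<and>
     (\<exists>s :: nat \<Rightarrow> real \<Rightarrow> 'b \<Rightarrow> real.
        (\<forall>k. simple_function (lebesgue_on {0<..<T}) (s k) \<and> (\<forall>t\<in>{0<..<T}. s k t \<in> X)) \<and>
        (AE t in lebesgue_on {0<..<T}. (\<lambda>k. N (\<lambda>y. s k t y - f t y)) \<longlonglongrightarrow> 0)) \<and>
     integrable (lebesgue_on {0<..<T}) (\<lambda>t. (N (f t))\<^sup>2)}"

abbreviation L2_L2 :: "real \<Rightarrow> 'a measure \<Rightarrow> (real \<Rightarrow> 'a \<Rightarrow> real) set" where
  "L2_L2 T M \<equiv> bochner_l2 T (l2_space M) (l2_norm M)"

abbreviation L2_H1 :: "real \<Rightarrow> (real ^ 'n) set \<Rightarrow> (real \<Rightarrow> real ^ 'n \<Rightarrow> real) set" where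
  "L2_H1 T \<Omega> \<equiv> bochner_l2 T (h1_space \<Omega>) (h1_norm \<Omega>)"

abbreviation L2_H1_dual :: "real \<Rightarrow> (real ^ 'n) set \<Rightarrow> (real \<Rightarrow> (real ^ 'n \<Rightarrow> real) \<Rightarrow> real) set" where
  "L2_H1_dual T \<Omega> \<equiv>
     bochner_l2 T (dual_space (h1_space \<Omega>) (h1_norm \<Omega>)) (dual_norm (h1_space \<Omega>) (h1_norm \<Omega>))"

definition L2_L2_inner ::
  "real \<Rightarrow> 'a measure \<Rightarrow> (real \<Rightarrow> 'a \<Rightarrow> real) \<Rightarrow> (real \<Rightarrow> 'a \<Rightarrow> real) \<Rightarrow> real" where
  "L2_L2_inner T M f g = (\<integral>t. l2_inner M (f t) (g t) \<partial>lebesgue_on {0<..<T})"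

definition L2_L2_norm :: "real \<Rightarrow> 'a measure \<Rightarrow> (real \<Rightarrow> 'a \<Rightarrow> real) \<Rightarrow> real" where
  "L2_L2_norm T M f = sqrt (L2_L2_inner T M f f)"

definition time_ae_eq ::
  "real \<Rightarrow> 'a measure \<Rightarrow> (real \<Rightarrow> 'a \<Rightarrow> real) \<Rightarrow> (real \<Rightarrow> 'a \<Rightarrow> real) \<Rightarrow> bool" where
  "time_ae_eq T M f g \<longleftrightarrow> (AE t in lebesgue_on {0<..<T}. AE x in M. f t x = g t x)"

text \<open>The distributional derivative on \<open>(0,T)\<close>, with values in the dual of \<open>H\<^sup>1(\<Omega>)\<close>, evaluated at
  an arbitrary \<open>v\<close>; \<open>u t\<close> acts on \<open>v\<close> through the inner product of \<open>L\<^sup>2(\<Omega>)\<close>.\<close>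

definition has_time_derivative ::
  "real \<Rightarrow> (real ^ 'n) set \<Rightarrow> (real \<Rightarrow> real ^ 'n \<Rightarrow> real) \<Rightarrow>
   (real \<Rightarrow> (real ^ 'n \<Rightarrow> real) \<Rightarrow> real) \<Rightarrow> bool" where
  "has_time_derivative T \<Omega> u du \<longleftrightarrow>
    (\<forall>v\<in>h1_space \<Omega>. \<forall>\<phi> d\<phi> K.
       (\<forall>t. (\<phi> has_real_derivative d\<phi> t) (at t)) \<and> continuous_on UNIV d\<phi> \<and>
       compact K \<and> K \<subseteq> {0<..<T} \<and> (\<forall>t. t \<notin> K \<longrightarrow> \<phi> t = 0) \<longrightarrow>
       (\<integral>t. du t v * \<phi> t \<partial>lebesgue_on {0<..<T}) =
       - (\<integral>t. l2_inner (lebesgue_on \<Omega>) (u t) v * d\<phi> t \<partial>lebesgue_on {0<..<T}))"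

text \<open>The value at a time \<open>\<tau>\<close> of a function \<open>u\<close> defined up to null sets of times is that of its
  representative in \<open>C([0,T];L\<^sup>2(\<Omega>))\<close>.\<close>

definition has_value_at ::
  "real \<Rightarrow> (real ^ 'n) set \<Rightarrow> (real \<Rightarrow> real ^ 'n \<Rightarrow> real) \<Rightarrow> real \<Rightarrow> (real ^ 'n \<Rightarrow> real) \<Rightarrow> bool" where
  "has_value_at T \<Omega> u \<tau> w \<longleftrightarrow>
    (\<exists>c. (\<forall>t\<in>{0..T}. c t \<in> l2_space (lebesgue_on \<Omega>)) \<and>
         (\<forall>s\<in>{0..T}. ((\<lambda>t. l2_norm (lebesgue_on \<Omega>) (\<lambda>x. c t x - c s x)) \<longlongrightarrow> 0)
                        (at s within {0..T})) \<and>
         time_ae_eq T (lebesgue_on \<Omega>) u c \<and>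
         (AE x in lebesgue_on \<Omega>. c \<tau> x = w x))"


section \<open>State, adjoint state and cost functional\<close>

definition robin_form ::
  "(real ^ 'n) set \<Rightarrow> (real ^ 'n) set \<Rightarrow> ((real ^ 'n \<Rightarrow> real) \<Rightarrow> (real ^ 'n \<Rightarrow> real)) \<Rightarrow> real \<Rightarrow>
   (real ^ 'n \<Rightarrow> real) \<Rightarrow> (real ^ 'n \<Rightarrow> real) \<Rightarrow> real" where
  "robin_form \<Omega> \<Gamma>1 tr \<alpha> u v =
     dirichlet_form \<Omega> u v + \<alpha> * l2_inner (surface_on \<Gamma>1) (tr u) (tr v)"

definition is_state ::
  "(real ^ 'n) set \<Rightarrow> (real ^ 'n) set \<Rightarrow> (real ^ 'n) set \<Rightarrow>
   ((real ^ 'n \<Rightarrow> real) \<Rightarrow> (real ^ 'n \<Rightarrow> real)) \<Rightarrow> real \<Rightarrow> real \<Rightarrow>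
   (real \<Rightarrow> real ^ 'n \<Rightarrow> real) \<Rightarrow> (real ^ 'n \<Rightarrow> real) \<Rightarrow> (real ^ 'n \<Rightarrow> real) \<Rightarrow>
   (real \<Rightarrow> real ^ 'n \<Rightarrow> real) \<Rightarrow> (real \<Rightarrow> real ^ 'n \<Rightarrow> real) \<Rightarrow> bool" where
  "is_state \<Omega> \<Gamma>1 \<Gamma>2 tr T \<alpha> g b v\<^sub>b q u \<longleftrightarrow>
     u \<in> L2_H1 T \<Omega> \<and> has_value_at T \<Omega> u 0 v\<^sub>b \<and>
     (\<exists>du\<in>L2_H1_dual T \<Omega>. has_time_derivative T \<Omega> u du \<and>
       (AE t in lebesgue_on {0<..<T}. \<forall>v\<in>h1_space \<Omega>.
          du t v + robin_form \<Omega> \<Gamma>1 tr \<alpha> (u t) v =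
          l2_inner (lebesgue_on \<Omega>) (g t) v - l2_inner (surface_on \<Gamma>2) (q t) (tr v)
          + \<alpha> * l2_inner (surface_on \<Gamma>1) b (tr v)))"

definition is_adjoint_state ::
  "(real ^ 'n) set \<Rightarrow> (real ^ 'n) set \<Rightarrow> ((real ^ 'n \<Rightarrow> real) \<Rightarrow> (real ^ 'n \<Rightarrow> real)) \<Rightarrow>
   real \<Rightarrow> real \<Rightarrow> (real \<Rightarrow> real ^ 'n \<Rightarrow> real) \<Rightarrow> (real \<Rightarrow> real ^ 'n \<Rightarrow> real) \<Rightarrow>
   (real \<Rightarrow> real ^ 'n \<Rightarrow> real) \<Rightarrow> bool" where
  "is_adjoint_state \<Omega> \<Gamma>1 tr T \<alpha> z\<^sub>d u p \<longleftrightarrow>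
     p \<in> L2_H1 T \<Omega> \<and> has_value_at T \<Omega> p T (\<lambda>x. 0) \<and>
     (\<exists>dp\<in>L2_H1_dual T \<Omega>. has_time_derivative T \<Omega> p dp \<and>
       (AE t in lebesgue_on {0<..<T}. \<forall>v\<in>h1_space \<Omega>.
          - dp t v + robin_form \<Omega> \<Gamma>1 tr \<alpha> (p t) v =
          l2_inner (lebesgue_on \<Omega>) (\<lambda>x. u t x - z\<^sub>d t x) v))"

definition unique_solution ::
  "real \<Rightarrow> (real ^ 'n) set \<Rightarrow> ((real \<Rightarrow> real ^ 'n \<Rightarrow> real) \<Rightarrow> bool) \<Rightarrow> bool" where
  "unique_solution T \<Omega> P \<longleftrightarrow>
     (\<exists>u. P u \<and> (\<forall>w. P w \<longrightarrow> time_ae_eq T (lebesgue_on \<Omega>) w u))"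

definition state ::
  "(real ^ 'n) set \<Rightarrow> (real ^ 'n) set \<Rightarrow> (real ^ 'n) set \<Rightarrow>
   ((real ^ 'n \<Rightarrow> real) \<Rightarrow> (real ^ 'n \<Rightarrow> real)) \<Rightarrow> real \<Rightarrow> real \<Rightarrow>
   (real \<Rightarrow> real ^ 'n \<Rightarrow> real) \<Rightarrow> (real ^ 'n \<Rightarrow> real) \<Rightarrow> (real ^ 'n \<Rightarrow> real) \<Rightarrow>
   (real \<Rightarrow> real ^ 'n \<Rightarrow> real) \<Rightarrow> real \<Rightarrow> real ^ 'n \<Rightarrow> real" where
  "state \<Omega> \<Gamma>1 \<Gamma>2 tr T \<alpha> g b v\<^sub>b q = (SOME u. is_state \<Omega> \<Gamma>1 \<Gamma>2 tr T \<alpha> g b v\<^sub>b q u)"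

definition adjoint_state ::
  "(real ^ 'n) set \<Rightarrow> (real ^ 'n) set \<Rightarrow> (real ^ 'n) set \<Rightarrow>
   ((real ^ 'n \<Rightarrow> real) \<Rightarrow> (real ^ 'n \<Rightarrow> real)) \<Rightarrow> real \<Rightarrow> real \<Rightarrow>
   (real \<Rightarrow> real ^ 'n \<Rightarrow> real) \<Rightarrow> (real ^ 'n \<Rightarrow> real) \<Rightarrow> (real ^ 'n \<Rightarrow> real) \<Rightarrow>
   (real \<Rightarrow> real ^ 'n \<Rightarrow> real) \<Rightarrow> (real \<Rightarrow> real ^ 'n \<Rightarrow> real) \<Rightarrow> real \<Rightarrow> real ^ 'n \<Rightarrow> real" where
  "adjoint_state \<Omega> \<Gamma>1 \<Gamma>2 tr T \<alpha> g b v\<^sub>b z\<^sub>d q =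
     (SOME p. is_adjoint_state \<Omega> \<Gamma>1 tr T \<alpha> z\<^sub>d (state \<Omega> \<Gamma>1 \<Gamma>2 tr T \<alpha> g b v\<^sub>b q) p)"

definition cost ::
  "(real ^ 'n) set \<Rightarrow> (real ^ 'n) set \<Rightarrow> (real ^ 'n) set \<Rightarrow>
   ((real ^ 'n \<Rightarrow> real) \<Rightarrow> (real ^ 'n \<Rightarrow> real)) \<Rightarrow> real \<Rightarrow> real \<Rightarrow>
   (real \<Rightarrow> real ^ 'n \<Rightarrow> real) \<Rightarrow> (real ^ 'n \<Rightarrow> real) \<Rightarrow> (real ^ 'n \<Rightarrow> real) \<Rightarrow>
   (real \<Rightarrow> real ^ 'n \<Rightarrow> real) \<Rightarrow> real \<Rightarrow> (real \<Rightarrow> real ^ 'n \<Rightarrow> real) \<Rightarrow> real" where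
  "cost \<Omega> \<Gamma>1 \<Gamma>2 tr T \<alpha> g b v\<^sub>b z\<^sub>d M q =
     1 / 2 * (L2_L2_norm T (lebesgue_on \<Omega>)
                (\<lambda>t x. state \<Omega> \<Gamma>1 \<Gamma>2 tr T \<alpha> g b v\<^sub>b q t x - z\<^sub>d t x))\<^sup>2
     + M / 2 * (L2_L2_norm T (surface_on \<Gamma>2) q)\<^sup>2"

text \<open>\<open>G\<close> is the Riesz representative in \<open>L\<^sup>2(0,T;L\<^sup>2(M))\<close> of the Gateaux derivative of \<open>J\<close> at \<open>q\<close>.\<close>

definition has_gateaux_gradient ::
  "real \<Rightarrow> 'a measure \<Rightarrow> ((real \<Rightarrow> 'a \<Rightarrow> real) \<Rightarrow> real) \<Rightarrow>
   (real \<Rightarrow> 'a \<Rightarrow> real) \<Rightarrow> (real \<Rightarrow> 'a \<Rightarrow> real) \<Rightarrow> bool" where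
  "has_gateaux_gradient T M J q G \<longleftrightarrow> G \<in> L2_L2 T M \<and>
     (\<forall>h\<in>L2_L2 T M.
        ((\<lambda>s. (J (\<lambda>t x. q t x + s * h t x) - J q) / s) \<longlongrightarrow> L2_L2_inner T M G h) (at 0))"

end

theory Submission
  imports Defs
begin

text \<open>The cost is a quadratic functional, and all assertions follow from its exact expansion
  \<open>J (q + h) = J q + (M q - p, h) + 1/2 |w|\<^sup>2 + M/2 |h|\<^sup>2\<close>, where \<open>p\<close> is the trace of the adjoint state at
  \<open>q\<close> and \<open>w\<close>, the difference of the states at \<open>q + h\<close> and \<open>q\<close>, is linear in \<open>h\<close>. Its linear term is
  computed by testing the equation of \<open>w\<close> with the adjoint state and the adjoint equation with \<open>w\<close>,
  which requires integration by parts in time for functions whose derivatives only have values in the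
  dual space. No energy estimate is needed: the last term makes minimizing sequences Cauchy, and the
  tangent at the limit of such a sequence shows that the limit is a minimizer.\<close>

text \<open>Integration by parts is the obstacle: \<open>du t\<close> and \<open>dp t\<close> are
  known only as distributional derivatives tested with a fixed v, whereas here the test functions
  p(t) and w(t) move with t. Averaging \<open>du\<close> over a window of length h while the
  argument p(r) is frozen turns it into a difference quotient of (u, p(r)). A backward window for
  \<open>du\<close> and a forward one for \<open>dp\<close> give (u(r) - u(r-h), p(r)) / h and
  (u(r), p(r+h) - p(r)) / h, whose integrals cancel after a shift by h. This avoids mollification
  with values in the dual space and density theorems for smooth functions. Spaces consist of
  representatives, and states, adjoint states and weak gradients are chosen by \<open>SOME\<close>.
  Linearity therefore holds only almost everywhere and has to come from uniqueness: for states this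
  is the solvability hypothesis, for gradients the fundamental lemma of the calculus of variations.
  A Bochner space carries no joint measurability in time and space, so measurability in t is
  obtained from simple or continuous functions and the completeness of Lebesgue measure.\<close>

lemma (in complete_measure) borel_measurable_AE_LIMSEQ:
  fixes f :: "nat \<Rightarrow> 'a \<Rightarrow> real"
  assumes f: "\<And>k. f k \<in> borel_measurable M"
    and lim: "AE x in M. (\<lambda>k. f k x) \<longlonglongrightarrow> g x"
  shows "g \<in> borel_measurable M"
proof (rule borel_measurableI)
  fix S :: "real set" assume S: "open S"
  let ?l = "\<lambda>x. lim (\<lambda>k. f k x)"
  have l: "?l \<in> borel_measurable M"
    using f by measurable
  have "AE x in M. x \<in> ?l -` S \<inter> space M \<longleftrightarrow> x \<in> g -` S \<inter> space M"
    using lim by eventually_elim (auto simp: limI)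
  then show "g -` S \<inter> space M \<in> sets M"
    \<comment> \<open>Completeness enters here: the preimages under g and under the measurable limit
      differ inside a null set, on which g is arbitrary.\<close>
    by (rule in_sets_AE) (use l S in \<open>auto intro: measurable_sets\<close>)
qed

section \<open>The time interval as a complete finite measure space\<close>

lemma complete_measure_lebesgue_on:
  assumes "S \<in> sets lebesgue"
  shows "complete_measure (lebesgue_on S)"
proof
  fix A B assume "B \<subseteq> A" "A \<in> null_sets (lebesgue_on S)"
  with assms show "B \<in> sets (lebesgue_on S)"
    by (auto simp: null_sets_restrict_space sets_restrict_space_iff
        intro: completion.complete2 null_setsD2)
qed

lemma complete_measure_time: "complete_measure (lebesgue_on {0<..<T::real})"
  by (intro complete_measure_lebesgue_on) auto

lemma finite_measure_time: "finite_measure (lebesgue_on {0<..<T::real})"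
  by (intro finite_measure_lebesgue_on) auto

lemmas borel_measurable_time_AE_LIMSEQ =
  complete_measure.borel_measurable_AE_LIMSEQ[OF complete_measure_time]

lemma integrable_of_abs_le:
  fixes f g :: "'a \<Rightarrow> real"
  assumes "integrable M g" "f \<in> borel_measurable M" "AE x in M. \<bar>f x\<bar> \<le> g x"
  shows "integrable M f"
  using assms by (intro Bochner_Integration.integrable_bound[OF assms(1,2)]) (auto elim: eventually_mono)

text \<open>The weights \<open>2 ^ n\<close> replace Minkowski's inequality for infinite sums in the proofs of
  completeness.\<close>

lemma AE_summable_of_fast_decay:
  fixes a :: "nat \<Rightarrow> 'a \<Rightarrow> real"
  assumes int: "\<And>n. integrable M (\<lambda>x. (a n x)\<^sup>2)"
    and nonneg: "\<And>n x. x \<in> space M \<Longrightarrow> 0 \<le> a n x"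
    and le: "\<And>n. (\<integral>x. (a n x)\<^sup>2 \<partial>M) \<le> (1/4) ^ n"
  shows "AE x in M. summable (\<lambda>n. a n x)"
proof -
  have nn: "(\<integral>\<^sup>+x. ennreal (2 ^ n * (a n x)\<^sup>2) \<partial>M) \<le> ennreal ((1/2) ^ n)" for n
  proof -
    have "(\<integral>\<^sup>+x. ennreal (2 ^ n * (a n x)\<^sup>2) \<partial>M) = ennreal (\<integral>x. 2 ^ n * (a n x)\<^sup>2 \<partial>M)"
      using int by (intro nn_integral_eq_integral) auto
    also have "(\<integral>x. 2 ^ n * (a n x)\<^sup>2 \<partial>M) \<le> 2 ^ n * (1/4) ^ n"
      using le[of n] by simp
    also have "2 ^ n * (1/4) ^ n = ((1/2) ^ n :: real)"
      by (simp flip: power_mult_distrib)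
    finally show ?thesis by (simp add: ennreal_leI)
  qed
  have [measurable]: "(\<lambda>x. (a n x)\<^sup>2) \<in> borel_measurable M" for n
    using int by auto
  have "(\<integral>\<^sup>+x. (\<Sum>n. ennreal (2 ^ n * (a n x)\<^sup>2)) \<partial>M) = (\<Sum>n. \<integral>\<^sup>+x. ennreal (2 ^ n * (a n x)\<^sup>2) \<partial>M)"
    by (rule nn_integral_suminf) measurable
  also have "\<dots> \<le> (\<Sum>n. ennreal ((1/2) ^ n))"
    by (intro suminf_le nn) auto
  also have "\<dots> = ennreal (\<Sum>n. (1/2) ^ n)"
    by (intro suminf_ennreal2 summable_geometric) auto
  also have "\<dots> < \<infinity>"
    by (simp only: infinity_ennreal_def ennreal_less_top)
  finally have "AE x in M. (\<Sum>n. ennreal (2 ^ n * (a n x)\<^sup>2)) \<noteq> \<infinity>"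
    by (intro nn_integral_PInf_AE) auto
  then show ?thesis
  proof (rule AE_mp, intro AE_I2 impI)
    fix x assume x: "x \<in> space M" and fin: "(\<Sum>n. ennreal (2 ^ n * (a n x)\<^sup>2)) \<noteq> \<infinity>"
    have "summable (\<lambda>n. 2 ^ n * (a n x)\<^sup>2)"
      using fin by (intro summable_suminf_not_top) auto
    moreover have "summable (\<lambda>n. (1/2::real) ^ n)"
      by (rule summable_geometric) simp
    ultimately have "summable (\<lambda>n. 2 ^ n * (a n x)\<^sup>2 + (1/2) ^ n)"
      by (rule summable_add)
    moreover have "norm (a n x) \<le> 2 ^ n * (a n x)\<^sup>2 + (1/2) ^ n" for n
    proof -
      let ?r = "2 ^ n :: real"
      have r: "?r > 0" "(1/2) ^ n = 1 / ?r"
        by (auto simp: power_one_over)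
      \<comment> \<open>Dividing by r = 2^n gives a \<le> r a^2 + 1/r. The extra summand r a, which
        is nonnegative, leaves a cross term with coefficient one.\<close>
      have "0 \<le> (?r * a n x - 1)\<^sup>2 + ?r * a n x"
        using nonneg[OF x, of n] by simp
      also have "\<dots> = ?r * (?r * (a n x)\<^sup>2 + 1 / ?r - a n x)"
        using r(1) by (simp add: field_simps power2_eq_square)
      finally show ?thesis
        using r nonneg[OF x, of n] by (simp add: zero_le_mult_iff)
    qed
    ultimately show "summable (\<lambda>n. a n x)"
      by (rule summable_comparison_test'[where N=0])
  qed
qed

text \<open>Fatou's lemma for the squares. The bound is asked for eventually because f(j) will be
  the difference of the j-th and the k-th term of a Cauchy sequence, which is small only for j \<ge>
  k.\<close>

lemma square_integral_le_of_AE_LIMSEQ: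
  fixes f :: "nat \<Rightarrow> 'a \<Rightarrow> real"
  assumes g: "g \<in> borel_measurable M" and int: "\<And>j. integrable M (\<lambda>x. (f j x)\<^sup>2)"
    and lim: "AE x in M. (\<lambda>j. f j x) \<longlonglongrightarrow> g x"
    and le: "\<forall>\<^sub>F j in sequentially. (\<integral>x. (f j x)\<^sup>2 \<partial>M) \<le> c"
  shows "integrable M (\<lambda>x. (g x)\<^sup>2)" and "(\<integral>x. (g x)\<^sup>2 \<partial>M) \<le> c"
proof -
  have "(\<integral>\<^sup>+x. ennreal ((g x)\<^sup>2) \<partial>M) = (\<integral>\<^sup>+x. liminf (\<lambda>j. ennreal ((f j x)\<^sup>2)) \<partial>M)"
  proof (rule nn_integral_cong_AE, use lim in eventually_elim)
    case (elim x)
    then have "(\<lambda>j. ennreal ((f j x)\<^sup>2)) \<longlonglongrightarrow> ennreal ((g x)\<^sup>2)"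
      by (intro tendsto_intros)
    then show ?case
      by (intro lim_imp_Liminf[symmetric]) auto
  qed
  also have "\<dots> \<le> liminf (\<lambda>j. \<integral>\<^sup>+x. ennreal ((f j x)\<^sup>2) \<partial>M)"
    by (intro nn_integral_liminf measurable_compose[OF borel_measurable_integrable[OF int] measurable_ennreal])
  also have "\<dots> \<le> liminf (\<lambda>j::nat. ennreal c)"
  proof (rule Liminf_mono, use le in eventually_elim)
    case (elim j)
    then show ?case
      by (subst nn_integral_eq_integral[OF int]) (auto intro: ennreal_leI)
  qed
  also have "\<dots> = ennreal c"
    by (simp add: Liminf_const)
  finally have fatou: "(\<integral>\<^sup>+x. ennreal ((g x)\<^sup>2) \<partial>M) \<le> ennreal c" .
  show int_g: "integrable M (\<lambda>x. (g x)\<^sup>2)"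
    by (rule integrableI_nonneg) (use g fatou in \<open>auto intro: le_less_trans\<close>)
  \<comment> \<open>Nonnegativity of c is read off from one index at which the bound holds; it
    allows \<open>ennreal\<close> to be cancelled.\<close>
  obtain j where "(\<integral>x. (f j x)\<^sup>2 \<partial>M) \<le> c"
    using le by (auto simp: eventually_sequentially)
  then have "0 \<le> c"
    by (rule order_trans[rotated]) simp
  then show "(\<integral>x. (g x)\<^sup>2 \<partial>M) \<le> c"
    using fatou nn_integral_eq_integral[OF int_g] by simp
qed

lemma LIMSEQ_null_le:
  fixes a b :: "nat \<Rightarrow> real"
  assumes "\<And>k. norm (a k) \<le> b k" "b \<longlonglongrightarrow> 0"
  shows "a \<longlonglongrightarrow> 0"
  using assms by (intro Lim_null_comparison[OF _ assms(2)]) simp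

section \<open>Seminormed function spaces\<close>

text \<open>Points of the underlying type are arbitrary, so a dual space fits as well: its elements
  are functions whose points are again functions. \<open>N\<close> is only a seminorm, since
  elements are representatives.\<close>

locale seminormed =
  fixes X :: "('b \<Rightarrow> real) set" and N :: "('b \<Rightarrow> real) \<Rightarrow> real"
  assumes zero_mem: "(\<lambda>x. 0) \<in> X"
    and lin_mem: "\<And>u v r s. u \<in> X \<Longrightarrow> v \<in> X \<Longrightarrow> (\<lambda>x. r * u x + s * v x) \<in> X"
    and nonneg: "\<And>v. v \<in> X \<Longrightarrow> 0 \<le> N v"
    and triangle: "\<And>u v. u \<in> X \<Longrightarrow> v \<in> X \<Longrightarrow> N (\<lambda>x. u x + v x) \<le> N u + N v"
    and scale: "\<And>v r. v \<in> X \<Longrightarrow> N (\<lambda>x. r * v x) = \<bar>r\<bar> * N v"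
begin

lemma add_mem: "u \<in> X \<Longrightarrow> v \<in> X \<Longrightarrow> (\<lambda>x. u x + v x) \<in> X"
  using lin_mem[of u v 1 1] by simp

lemma diff_mem: "u \<in> X \<Longrightarrow> v \<in> X \<Longrightarrow> (\<lambda>x. u x - v x) \<in> X"
  using lin_mem[of u v 1 "-1"] by simp

lemma scale_mem: "u \<in> X \<Longrightarrow> (\<lambda>x. r * u x) \<in> X"
  using lin_mem[of u u r 0] by simp

lemma norm_zero: "N (\<lambda>x. 0) = 0"
  using scale[OF zero_mem, of 0] by simp

lemma triangle_diff: "u \<in> X \<Longrightarrow> v \<in> X \<Longrightarrow> N (\<lambda>x. u x - v x) \<le> N u + N v"
  using triangle[of u "\<lambda>x. -1 * v x"] scale[of v "-1"] scale_mem[of v "-1"] by simp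

lemma norm_minus_commute: "u \<in> X \<Longrightarrow> v \<in> X \<Longrightarrow> N (\<lambda>x. u x - v x) = N (\<lambda>x. v x - u x)"
  using scale[of "\<lambda>x. u x - v x" "-1"] diff_mem[of u v] by simp

lemma triangle3:
  assumes "u \<in> X" "v \<in> X" "w \<in> X"
  shows "N (\<lambda>x. u x - w x) \<le> N (\<lambda>x. u x - v x) + N (\<lambda>x. v x - w x)"
  using triangle[OF diff_mem[OF assms(1,2)] diff_mem[OF assms(2,3)]] by simp

lemma abs_norm_diff:
  assumes u: "u \<in> X" and v: "v \<in> X"
  shows "\<bar>N u - N v\<bar> \<le> N (\<lambda>x. u x - v x)"
proof -
  have "N u \<le> N (\<lambda>x. u x - v x) + N v"
    using triangle[OF diff_mem[OF u v] v] by simp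
  moreover have "N v \<le> N (\<lambda>x. u x - v x) + N u"
    using triangle[OF diff_mem[OF v u] u] norm_minus_commute[OF u v] by simp
  ultimately show ?thesis by linarith
qed

lemma norm_LIMSEQ:
  assumes a: "\<And>k. a k \<in> X" and l: "l \<in> X" and lim: "(\<lambda>k. N (\<lambda>x. a k x - l x)) \<longlonglongrightarrow> 0"
  shows "(\<lambda>k. N (a k)) \<longlonglongrightarrow> N l"
proof (rule LIM_zero_cancel, rule LIMSEQ_null_le[OF _ lim])
  show "norm (N (a k) - N l) \<le> N (\<lambda>x. a k x - l x)" for k
    using abs_norm_diff[OF a l] by (simp only: real_norm_def)
qed

lemma norm_diff_LIMSEQ:
  assumes a: "\<And>k. a k \<in> X" and l: "l \<in> X" and b: "b \<in> X"
    and lim: "(\<lambda>k. N (\<lambda>x. a k x - l x)) \<longlonglongrightarrow> 0"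
  shows "(\<lambda>k. N (\<lambda>x. a k x - b x)) \<longlonglongrightarrow> N (\<lambda>x. l x - b x)"
  by (rule norm_LIMSEQ[OF diff_mem[OF a b] diff_mem[OF l b]]) (use lim in simp)

lemma norm_lin_le:
  assumes u: "u \<in> X" and v: "v \<in> X"
  shows "N (\<lambda>x. r * u x + s * v x) \<le> \<bar>r\<bar> * N u + \<bar>s\<bar> * N v"
  using triangle[OF scale_mem[OF u] scale_mem[OF v], of r s] by (simp only: scale[OF u] scale[OF v])

end

locale semi_inner =
  fixes X :: "('b \<Rightarrow> real) set" and B :: "('b \<Rightarrow> real) \<Rightarrow> ('b \<Rightarrow> real) \<Rightarrow> real"
  assumes zero_in: "(\<lambda>x. 0) \<in> X"
    and lin_in: "\<And>u v r s. u \<in> X \<Longrightarrow> v \<in> X \<Longrightarrow> (\<lambda>x. r * u x + s * v x) \<in> X"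
    and sym: "\<And>u v. u \<in> X \<Longrightarrow> v \<in> X \<Longrightarrow> B u v = B v u"
    and lin_left: "\<And>u v w r s. u \<in> X \<Longrightarrow> v \<in> X \<Longrightarrow> w \<in> X \<Longrightarrow>
      B (\<lambda>x. r * u x + s * v x) w = r * B u w + s * B v w"
    and pos: "\<And>v. v \<in> X \<Longrightarrow> 0 \<le> B v v"
begin

lemma lin_right:
  assumes u: "u \<in> X" and v: "v \<in> X" and w: "w \<in> X"
  shows "B w (\<lambda>x. r * u x + s * v x) = r * B w u + s * B w v"
  using lin_left[OF u v w, of r s] by (simp only: sym[OF w u] sym[OF w v] sym[OF w lin_in[OF u v]])

lemma quad:
  assumes "u \<in> X" "v \<in> X"
  shows "B (\<lambda>x. r * u x + s * v x) (\<lambda>x. r * u x + s * v x) =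
    r\<^sup>2 * B u u + 2 * r * s * B u v + s\<^sup>2 * B v v"
  using assms lin_in[OF assms, of r s] sym[OF assms]
  by (simp add: lin_left lin_right power2_eq_square algebra_simps)

lemma cauchy_schwarz:
  assumes "u \<in> X" "v \<in> X"
  shows "\<bar>B u v\<bar> \<le> sqrt (B u u) * sqrt (B v v)"
proof -
  have ge: "0 \<le> r\<^sup>2 * B u u + 2 * r * s * B u v + s\<^sup>2 * B v v" for r s
    using quad[OF assms, of r s] pos[OF lin_in[OF assms, of r s]] by simp
  have "(B u v)\<^sup>2 \<le> B u u * B v v"
  proof (cases "B v v = 0")
    case True
    have "B u v = 0"
    proof (rule ccontr)
      assume ne: "B u v \<noteq> 0"
      \<comment> \<open>The form may be degenerate. If \<open>B v v = 0\<close>, the quadratic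
        expression is affine in s, and the chosen s makes it equal to -1.\<close>
      have "0 \<le> B u u + 2 * (- (B u u + 1) / (2 * B u v)) * B u v"
        using ge[of 1 "- (B u u + 1) / (2 * B u v)"] True by simp
      also have "\<dots> = -1"
        using ne by (simp add: field_simps)
      finally show False by simp
    qed
    then show ?thesis using True by simp
  next
    case False
    then have v: "B v v > 0" using pos[OF assms(2)] by simp
    \<comment> \<open>These weights are the minimizing ratio of r and s, scaled by
      \<open>B v v\<close> to avoid a division.\<close>
    have "0 \<le> (B v v) * (B u u * B v v - (B u v)\<^sup>2)"
      using ge[of "B v v" "- B u v"] by (simp add: power2_eq_square algebra_simps)
    with v show ?thesis by (simp add: zero_le_mult_iff)
  qed
  then show ?thesis
    by (metis real_sqrt_abs real_sqrt_le_iff real_sqrt_mult)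
qed

sublocale seminormed X "\<lambda>v. sqrt (B v v)"
proof
  fix u v :: "'b \<Rightarrow> real" and r :: real
  assume u: "u \<in> X"
  show "0 \<le> sqrt (B u u)"
    using pos[OF u] by simp
  show "sqrt (B (\<lambda>x. r * u x) (\<lambda>x. r * u x)) = \<bar>r\<bar> * sqrt (B u u)"
    using quad[OF u u, of r 0] by (simp add: real_sqrt_mult)
  assume v: "v \<in> X"
  have "B (\<lambda>x. u x + v x) (\<lambda>x. u x + v x) = B u u + 2 * B u v + B v v"
    using quad[OF u v, of 1 1] by simp
  also have "\<dots> \<le> (sqrt (B u u) + sqrt (B v v))\<^sup>2"
    using cauchy_schwarz[OF u v] pos[OF u] pos[OF v] by (simp add: power2_sum)
  finally show "sqrt (B (\<lambda>x. u x + v x) (\<lambda>x. u x + v x)) \<le> sqrt (B u u) + sqrt (B v v)"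
    using pos[OF u] pos[OF v] by (intro real_le_lsqrt) auto
qed (auto intro: zero_in lin_in)

end

section \<open>Square-integrable functions\<close>

lemma l2_space_measurable: "f \<in> l2_space M \<Longrightarrow> f \<in> borel_measurable M"
  by (simp add: l2_space_def)

lemma l2_space_prod_integrable:
  assumes "f \<in> l2_space M" "g \<in> l2_space M"
  shows "integrable M (\<lambda>x. f x * g x)"
proof (rule integrable_of_abs_le)
  show "integrable M (\<lambda>x. (f x)\<^sup>2 + (g x)\<^sup>2)"
    using assms by (auto simp: l2_space_def)
  show "(\<lambda>x. f x * g x) \<in> borel_measurable M"
    using assms by (auto simp: l2_space_def)
  have "\<bar>f x * g x\<bar> \<le> (f x)\<^sup>2 + (g x)\<^sup>2" for x
  proof -
    have "2 * \<bar>f x * g x\<bar> \<le> (f x)\<^sup>2 + (g x)\<^sup>2"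
      using sum_squares_bound[of "\<bar>f x\<bar>" "\<bar>g x\<bar>"] by (simp add: abs_mult)
    then show ?thesis
      using abs_ge_zero[of "f x * g x"] by linarith
  qed
  then show "AE x in M. \<bar>f x * g x\<bar> \<le> (f x)\<^sup>2 + (g x)\<^sup>2"
    by simp
qed

lemma l2_space_lin:
  assumes "f \<in> l2_space M" "g \<in> l2_space M"
  shows "(\<lambda>x. r * f x + s * g x) \<in> l2_space M"
proof -
  have "integrable M (\<lambda>x. r\<^sup>2 * (f x)\<^sup>2 + 2 * r * s * (f x * g x) + s\<^sup>2 * (g x)\<^sup>2)"
    using assms l2_space_prod_integrable[OF assms] by (auto simp: l2_space_def)
  moreover have "(\<lambda>x. (r * f x + s * g x)\<^sup>2) =
      (\<lambda>x. r\<^sup>2 * (f x)\<^sup>2 + 2 * r * s * (f x * g x) + s\<^sup>2 * (g x)\<^sup>2)"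
    by (auto simp: power2_eq_square algebra_simps)
  ultimately show ?thesis
    using assms by (auto simp: l2_space_def)
qed

interpretation l2: semi_inner "l2_space M" "l2_inner M" for M
proof
  fix u v w :: "'a \<Rightarrow> real" and r s :: real
  show "(\<lambda>x. 0) \<in> l2_space M"
    by (simp add: l2_space_def)
  show "0 \<le> l2_inner M v v"
    by (simp add: l2_inner_def)
  show "l2_inner M u v = l2_inner M v u"
    by (simp add: l2_inner_def mult.commute)
  assume u: "u \<in> l2_space M" and v: "v \<in> l2_space M"
  then show "(\<lambda>x. r * u x + s * v x) \<in> l2_space M"
    by (rule l2_space_lin)
  assume w: "w \<in> l2_space M"
  have "l2_inner M (\<lambda>x. r * u x + s * v x) w = (\<integral>x. r * (u x * w x) + s * (v x * w x) \<partial>M)"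
    unfolding l2_inner_def by (rule arg_cong[where f="integral\<^sup>L M"]) (auto simp: algebra_simps)
  then show "l2_inner M (\<lambda>x. r * u x + s * v x) w = r * l2_inner M u w + s * l2_inner M v w"
    using u v w by (simp add: l2_inner_def l2_space_prod_integrable)
qed

lemma l2_norm_eq: "l2_norm M = (\<lambda>v. sqrt (l2_inner M v v))"
  by (simp add: l2_norm_def fun_eq_iff)

interpretation l2n: seminormed "l2_space M" "l2_norm M" for M
  unfolding l2_norm_eq by unfold_locales

lemma l2_norm_sq: "(l2_norm M f)\<^sup>2 = (\<integral>x. (f x)\<^sup>2 \<partial>M)"
  by (simp add: l2_norm_def l2_inner_def power2_eq_square)

lemma l2_norm_eq_0D:
  assumes "f \<in> l2_space M" "l2_norm M f = 0"
  shows "AE x in M. f x = 0"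
  using assms integral_nonneg_eq_0_iff_AE[of M "\<lambda>x. (f x)\<^sup>2"] l2_norm_sq[of M f]
  by (auto simp: l2_space_def)

lemma l2_inner_cong_AE:
  assumes "f \<in> borel_measurable M" "f' \<in> borel_measurable M" "g \<in> borel_measurable M"
    "g' \<in> borel_measurable M" "AE x in M. f x = f' x" "AE x in M. g x = g' x"
  shows "l2_inner M f g = l2_inner M f' g'"
  unfolding l2_inner_def using assms(1-4)
  by (intro integral_cong_AE) (use assms(5,6) in auto)

section \<open>Completeness of L^2\<close>

definition seminorm_complete :: "('b \<Rightarrow> real) set \<Rightarrow> (('b \<Rightarrow> real) \<Rightarrow> real) \<Rightarrow> bool" where
  "seminorm_complete X N \<longleftrightarrow>
     (\<forall>f::nat \<Rightarrow> 'b \<Rightarrow> real. (\<forall>n. f n \<in> X) \<longrightarrow>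
        (\<forall>e>0. \<exists>M. \<forall>m\<ge>M. \<forall>n\<ge>M. N (\<lambda>x. f m x - f n x) < e) \<longrightarrow>
        (\<exists>l\<in>X. (\<lambda>n. N (\<lambda>x. f n x - l x)) \<longlonglongrightarrow> 0))"

text \<open>The estimate covers all later n, not just the next term of the subsequence, because the
  distance to the limit is found by letting n tend to infinity. The function d is left abstract to
  serve both for a seminorm and for the integral of its square.\<close>

lemma Cauchy_subsequence_rate:
  fixes d :: "nat \<Rightarrow> nat \<Rightarrow> real" and c :: "nat \<Rightarrow> real"
  assumes cau: "\<And>e. e > 0 \<Longrightarrow> \<exists>M. \<forall>m\<ge>M. \<forall>n\<ge>M. d m n < e" and c: "\<And>k. c k > 0"
  obtains \<sigma> :: "nat \<Rightarrow> nat" where "strict_mono \<sigma>" "\<And>k n. n \<ge> \<sigma> k \<Longrightarrow> d n (\<sigma> k) \<le> c k"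
proof -
  have "\<exists>M. \<forall>m\<ge>M. \<forall>n\<ge>M. d m n < c k" for k
    by (rule cau[OF c])
  then obtain M where M: "\<And>k m n. m \<ge> M k \<Longrightarrow> n \<ge> M k \<Longrightarrow> d m n < c k"
    by metis
  \<comment> \<open>The successor of the previous value makes the sequence strictly increasing, the
    threshold \<open>M (Suc k)\<close> enforces the rate.\<close>
  define \<sigma> where "\<sigma> = rec_nat (M 0) (\<lambda>k s. max (Suc s) (M (Suc k)))"
  have S: "\<sigma> (Suc k) = max (Suc (\<sigma> k)) (M (Suc k))" for k
    by (simp add: \<sigma>_def)
  have mono: "strict_mono \<sigma>"
    by (rule strict_mono_Suc_iff[THEN iffD2]) (auto simp: S)
  have ge: "\<sigma> k \<ge> M k" for k
    by (cases k) (auto simp: \<sigma>_def)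
  show ?thesis
    by (rule that[OF mono]) (use M ge in \<open>meson less_imp_le order_trans\<close>)
qed

lemma (in seminormed) Cauchy_subseq_limit:
  assumes f: "\<And>n. f n \<in> X" and l: "l \<in> X"
    and cau: "\<And>e. e > 0 \<Longrightarrow> \<exists>M. \<forall>m\<ge>M. \<forall>n\<ge>M. N (\<lambda>x. f m x - f n x) < e"
    and \<sigma>: "strict_mono \<sigma>" and lim: "(\<lambda>k. N (\<lambda>x. f (\<sigma> k) x - l x)) \<longlonglongrightarrow> 0"
  shows "(\<lambda>n. N (\<lambda>x. f n x - l x)) \<longlonglongrightarrow> 0"
proof (rule LIMSEQ_I)
  fix e :: real assume "e > 0"
  then have e2: "e / 2 > 0" by simp
  obtain M where M: "\<And>m n. m \<ge> M \<Longrightarrow> n \<ge> M \<Longrightarrow> N (\<lambda>x. f m x - f n x) < e / 2"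
    using cau[OF e2] by auto
  obtain K where K: "\<And>k. k \<ge> K \<Longrightarrow> norm (N (\<lambda>x. f (\<sigma> k) x - l x) - 0) < e / 2"
    using LIMSEQ_D[OF lim e2] by auto
  define k where "k = max K M"
  have "\<sigma> k \<ge> M"
    using strict_mono_imp_increasing[OF \<sigma>, of k] by (simp add: k_def)
  have "norm (N (\<lambda>x. f n x - l x) - 0) < e" if "n \<ge> M" for n
    using M[OF that \<open>\<sigma> k \<ge> M\<close>] K[of k] triangle3[OF f[of n] f[of "\<sigma> k"] l]
      nonneg[OF diff_mem[OF f[of n] l]] by (simp add: k_def)
  then show "\<exists>M. \<forall>n\<ge>M. norm (N (\<lambda>x. f n x - l x) - 0) < e"
    by blast
qed

text \<open>Riesz-Fischer: along a subsequence with rate (1/2)^k the increments are absolutely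
  summable almost everywhere, and Fatou's lemma turns the pointwise limit into a limit in norm with
  the same rate.\<close>

lemma l2_space_complete: "seminorm_complete (l2_space M) (l2_norm M)"
  unfolding seminorm_complete_def
proof (intro allI impI)
  fix f :: "nat \<Rightarrow> 'a \<Rightarrow> real"
  assume "\<forall>n. f n \<in> l2_space M"
    and "\<forall>e>0. \<exists>K. \<forall>m\<ge>K. \<forall>n\<ge>K. l2_norm M (\<lambda>x. f m x - f n x) < e"
  then have f: "\<And>n. f n \<in> l2_space M"
    and cau: "\<And>e. e > 0 \<Longrightarrow> \<exists>K. \<forall>m\<ge>K. \<forall>n\<ge>K. l2_norm M (\<lambda>x. f m x - f n x) < e"
    by blast+
  obtain \<sigma> where \<sigma>: "strict_mono \<sigma>"
    and fast: "\<And>k n. n \<ge> \<sigma> k \<Longrightarrow> l2_norm M (\<lambda>x. f n x - f (\<sigma> k) x) \<le> (1/2) ^ k"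
    by (rule Cauchy_subsequence_rate[OF cau, of "\<lambda>k. (1/2) ^ k"]) auto
  note [measurable] = l2_space_measurable[OF f]
  have d: "(\<lambda>x. f n x - f m x) \<in> l2_space M" for n m
    by (intro l2n.diff_mem f)
  have sq: "(\<integral>x. (f n x - f (\<sigma> k) x)\<^sup>2 \<partial>M) \<le> (1/4) ^ k" if "n \<ge> \<sigma> k" for n k
  proof -
    have "(l2_norm M (\<lambda>x. f n x - f (\<sigma> k) x))\<^sup>2 \<le> ((1/2) ^ k)\<^sup>2"
      using fast[OF that] l2n.nonneg[OF d] by (intro power_mono) auto
    also have "((1/2) ^ k)\<^sup>2 = (1/4 :: real) ^ k"
      by (simp add: power2_eq_square flip: power_mult_distrib)
    finally show ?thesis by (simp add: l2_norm_sq)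
  qed
  have "AE x in M. summable (\<lambda>k. \<bar>f (\<sigma> (Suc k)) x - f (\<sigma> k) x\<bar>)"
  proof (rule AE_summable_of_fast_decay)
    show "integrable M (\<lambda>x. \<bar>f (\<sigma> (Suc k)) x - f (\<sigma> k) x\<bar>\<^sup>2)" for k
      using d by (simp add: l2_space_def)
    show "(\<integral>x. \<bar>f (\<sigma> (Suc k)) x - f (\<sigma> k) x\<bar>\<^sup>2 \<partial>M) \<le> (1/4) ^ k" for k
      using sq[of k "\<sigma> (Suc k)"] \<sigma> by (simp add: strict_mono_less_eq)
  qed auto
  then have lim: "AE x in M. (\<lambda>k. f (\<sigma> k) x) \<longlonglongrightarrow> lim (\<lambda>k. f (\<sigma> k) x)"
  proof eventually_elim
    case (elim x)
    then have "summable (\<lambda>k. f (\<sigma> (Suc k)) x - f (\<sigma> k) x)"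
      by (rule summable_rabs_cancel)
    then have "convergent (\<lambda>k. \<Sum>i<k. f (\<sigma> (Suc i)) x - f (\<sigma> i) x)"
      by (simp add: summable_iff_convergent)
    then have "convergent (\<lambda>k. f (\<sigma> k) x - f (\<sigma> 0) x)"
      by (simp only: sum_lessThan_telescope[of "\<lambda>k. f (\<sigma> k) x"])
    then have "convergent (\<lambda>k. (f (\<sigma> k) x - f (\<sigma> 0) x) + f (\<sigma> 0) x)"
      by (intro convergent_add convergent_const)
    then show ?case by (simp add: convergent_LIMSEQ_iff)
  qed
  \<comment> \<open>\<open>lim\<close> is defined everywhere and measurable as a function of x,
    although convergence holds only almost everywhere.\<close>
  define l where "l x = lim (\<lambda>k. f (\<sigma> k) x)" for x
  have [measurable]: "l \<in> borel_measurable M"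
    unfolding l_def by measurable
  have fatou: "integrable M (\<lambda>x. (l x - f (\<sigma> k) x)\<^sup>2)" "(\<integral>x. (l x - f (\<sigma> k) x)\<^sup>2 \<partial>M) \<le> (1/4) ^ k" for k
  proof -
    have di: "integrable M (\<lambda>x. (f (\<sigma> j) x - f (\<sigma> k) x)\<^sup>2)" for j
      using d by (simp add: l2_space_def)
    have m: "(\<lambda>x. l x - f (\<sigma> k) x) \<in> borel_measurable M"
      by measurable
    have "AE x in M. (\<lambda>j. f (\<sigma> j) x - f (\<sigma> k) x) \<longlonglongrightarrow> l x - f (\<sigma> k) x"
      using lim unfolding l_def by eventually_elim (intro tendsto_intros)
    moreover have "\<forall>\<^sub>F j in sequentially. (\<integral>x. (f (\<sigma> j) x - f (\<sigma> k) x)\<^sup>2 \<partial>M) \<le> (1/4) ^ k"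
      using eventually_ge_at_top[of k] by eventually_elim (use \<sigma> in \<open>auto intro!: sq simp: strict_mono_less_eq\<close>)
    ultimately show "integrable M (\<lambda>x. (l x - f (\<sigma> k) x)\<^sup>2)" "(\<integral>x. (l x - f (\<sigma> k) x)\<^sup>2 \<partial>M) \<le> (1/4) ^ k"
      by (rule square_integral_le_of_AE_LIMSEQ[OF m di])+
  qed
  have "(\<lambda>x. l x - f (\<sigma> 0) x) \<in> l2_space M"
    using fatou(1)[of 0] by (simp add: l2_space_def)
  from l2n.add_mem[OF this f[of "\<sigma> 0"]] have l: "l \<in> l2_space M"
    by simp
  have norm_le: "l2_norm M (\<lambda>x. f (\<sigma> k) x - l x) \<le> (1/2) ^ k" for k
  proof -
    have "(l2_norm M (\<lambda>x. l x - f (\<sigma> k) x))\<^sup>2 \<le> ((1/2) ^ k)\<^sup>2"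
      using fatou(2)[of k] by (simp add: l2_norm_sq power2_eq_square[of "_ ^ _"] flip: power_mult_distrib)
    then have "l2_norm M (\<lambda>x. l x - f (\<sigma> k) x) \<le> (1/2) ^ k"
      by (rule power2_le_imp_le) simp
    then show ?thesis
      using l2n.norm_minus_commute[OF l f] by simp
  qed
  have "(\<lambda>k. l2_norm M (\<lambda>x. f (\<sigma> k) x - l x)) \<longlonglongrightarrow> 0"
  proof (rule tendsto_sandwich[OF _ _ tendsto_const LIMSEQ_realpow_zero])
    show "\<forall>\<^sub>F k in sequentially. 0 \<le> l2_norm M (\<lambda>x. f (\<sigma> k) x - l x)"
      using l2n.nonneg[OF l2n.diff_mem[OF f l]] by simp
    show "\<forall>\<^sub>F k in sequentially. l2_norm M (\<lambda>x. f (\<sigma> k) x - l x) \<le> (1/2) ^ k"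
      using norm_le by simp
  qed auto
  from l2n.Cauchy_subseq_limit[OF f l cau \<sigma> this] l
  show "\<exists>l\<in>l2_space M. (\<lambda>n. l2_norm M (\<lambda>x. f n x - l x)) \<longlonglongrightarrow> 0"
    by blast
qed

section \<open>Bochner spaces in time\<close>

lemma bochner_l2I:
  assumes "\<And>t. t \<in> {0<..<T} \<Longrightarrow> f t \<in> X"
    and "\<And>k. simple_function (lebesgue_on {0<..<T}) (s k)"
    and "\<And>k t. t \<in> {0<..<T} \<Longrightarrow> s k t \<in> X"
    and "AE t in lebesgue_on {0<..<T}. (\<lambda>k. N (\<lambda>y. s k t y - f t y)) \<longlonglongrightarrow> 0"
    and "integrable (lebesgue_on {0<..<T}) (\<lambda>t. (N (f t))\<^sup>2)"
  shows "f \<in> bochner_l2 T X N"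
  using assms unfolding bochner_l2_def by blast

lemma bochner_l2D:
  assumes "f \<in> bochner_l2 T X N"
  shows "\<And>t. t \<in> {0<..<T} \<Longrightarrow> f t \<in> X"
    and "integrable (lebesgue_on {0<..<T}) (\<lambda>t. (N (f t))\<^sup>2)"
  using assms unfolding bochner_l2_def by blast+

lemma bochner_l2E:
  assumes "f \<in> bochner_l2 T X N"
  obtains s where "\<And>k. simple_function (lebesgue_on {0<..<T}) (s k)"
    and "\<And>k t. t \<in> {0<..<T} \<Longrightarrow> s k t \<in> X"
    and "AE t in lebesgue_on {0<..<T}. (\<lambda>k. N (\<lambda>y. s k t y - f t y)) \<longlonglongrightarrow> 0"
  using assms unfolding bochner_l2_def by blast

text \<open>A simple function has finitely many values with measurable fibres, so every function of
  it is simple again. This is how norms and pairings become measurable in t without a sigma-algebra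
  on the function space.\<close>

lemma simple_function_compose_measurable:
  fixes h :: "'b \<Rightarrow> real"
  assumes "simple_function M s"
  shows "(\<lambda>t. h (s t)) \<in> borel_measurable M"
  using borel_measurable_simple_function[OF simple_function_compose1[OF assms, of h]] .

lemma abs_mult_le_half_squares:
  fixes a b :: real
  shows "\<bar>a * b\<bar> \<le> (a\<^sup>2 + b\<^sup>2) / 2"
proof -
  have "2 * \<bar>a * b\<bar> \<le> a\<^sup>2 + b\<^sup>2"
    using sum_squares_bound[of "\<bar>a\<bar>" "\<bar>b\<bar>"] by (simp add: abs_mult)
  then show ?thesis
    by (simp only: pos_le_divide_eq[OF zero_less_numeral] mult.commute[of _ 2])
qed

text \<open>Constants are square integrable because (0,T) has finite measure. A fixed test function
  can thus enter the pairing lemmas as a function of time.\<close>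

lemma bochner_l2_const:
  assumes "seminormed X N" "v \<in> X"
  shows "(\<lambda>t. v) \<in> bochner_l2 T X N"
proof (rule bochner_l2I[where s="\<lambda>k t. v"])
  interpret seminormed X N by fact
  interpret finite_measure "lebesgue_on {0<..<T}" by (rule finite_measure_time)
  show "AE t in lebesgue_on {0<..<T}. (\<lambda>k::nat. N (\<lambda>y. v y - v y)) \<longlonglongrightarrow> 0"
    by (simp add: norm_zero)
  show "integrable (lebesgue_on {0<..<T}) (\<lambda>t. (N v)\<^sup>2)"
    by simp
qed (use assms in auto)

text \<open>Covers the inner products as well as the duality between \<open>V'\<close> and \<open>V\<close>.\<close>

lemma bochner_l2_pairing_integrable:
  assumes X: "seminormed X N" and Y: "seminormed Y N'"
    and f: "f \<in> bochner_l2 T X N" and g: "g \<in> bochner_l2 T Y N'"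
    and diff1: "\<And>a a' b. a \<in> X \<Longrightarrow> a' \<in> X \<Longrightarrow> b \<in> Y \<Longrightarrow> \<beta> (\<lambda>y. a y - a' y) b = \<beta> a b - \<beta> a' b"
    and diff2: "\<And>a b b'. a \<in> X \<Longrightarrow> b \<in> Y \<Longrightarrow> b' \<in> Y \<Longrightarrow> \<beta> a (\<lambda>y. b y - b' y) = \<beta> a b - \<beta> a b'"
    and bound: "\<And>a b. a \<in> X \<Longrightarrow> b \<in> Y \<Longrightarrow> \<bar>\<beta> a b\<bar> \<le> N a * N' b"
  shows "integrable (lebesgue_on {0<..<T}) (\<lambda>t. \<beta> (f t) (g t))"
proof (rule integrable_of_abs_le)
  interpret X: seminormed X N by fact
  interpret Y: seminormed Y N' by fact
  let ?L = "lebesgue_on {0<..<T}"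
  obtain s where s: "\<And>k. simple_function ?L (s k)" "\<And>k t. t \<in> {0<..<T} \<Longrightarrow> s k t \<in> X"
    "AE t in ?L. (\<lambda>k. N (\<lambda>y. s k t y - f t y)) \<longlonglongrightarrow> 0"
    using f by (rule bochner_l2E) (rule that)
  obtain r where r: "\<And>k. simple_function ?L (r k)" "\<And>k t. t \<in> {0<..<T} \<Longrightarrow> r k t \<in> Y"
    "AE t in ?L. (\<lambda>k. N' (\<lambda>y. r k t y - g t y)) \<longlonglongrightarrow> 0"
    using g by (rule bochner_l2E) (rule that)
  show "(\<lambda>t. \<beta> (f t) (g t)) \<in> borel_measurable ?L"
  proof (rule borel_measurable_time_AE_LIMSEQ)
    show "(\<lambda>t. \<beta> (s k t) (r k t)) \<in> borel_measurable ?L" for k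
      using borel_measurable_simple_function[OF simple_function_compose2[OF s(1) r(1), of \<beta>]] .
    show "AE t in ?L. (\<lambda>k. \<beta> (s k t) (r k t)) \<longlonglongrightarrow> \<beta> (f t) (g t)"
      using s(3) r(3) AE_space
    proof eventually_elim
      case (elim t)
      then have t: "t \<in> {0<..<T}" by simp
      note f = bochner_l2D(1)[OF f t] and g = bochner_l2D(1)[OF g t]
        and s = s(2)[OF t] and r = r(2)[OF t]
      let ?a = "\<lambda>k. N (\<lambda>y. s k t y - f t y)" and ?b = "\<lambda>k. N' (\<lambda>y. r k t y - g t y)"
      \<comment> \<open>The simple functions carry no uniform bound, so \<open>N' (r k t)\<close> is
        estimated by \<open>N' (g t)\<close> plus the distance, which tends to zero.\<close>
      have "norm (\<beta> (s k t) (r k t) - \<beta> (f t) (g t)) \<le> ?a k * (?b k + N' (g t)) + N (f t) * ?b k" for k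
      proof -
        have "\<beta> (s k t) (r k t) - \<beta> (f t) (g t) =
            \<beta> (\<lambda>y. s k t y - f t y) (r k t) + \<beta> (f t) (\<lambda>y. r k t y - g t y)"
          by (simp only: diff1[OF s f r] diff2[OF f r g])
        moreover have "\<bar>\<beta> (\<lambda>y. s k t y - f t y) (r k t)\<bar> \<le> ?a k * N' (r k t)"
          by (rule bound[OF X.diff_mem[OF s f] r])
        moreover have "\<bar>\<beta> (f t) (\<lambda>y. r k t y - g t y)\<bar> \<le> N (f t) * ?b k"
          by (rule bound[OF f Y.diff_mem[OF r g]])
        moreover have "?a k * N' (r k t) \<le> ?a k * (?b k + N' (g t))"
          using Y.abs_norm_diff[OF r g, of k] X.nonneg[OF X.diff_mem[OF s f]]
          by (intro mult_left_mono) auto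
        ultimately show ?thesis by simp
      qed
      moreover have "(\<lambda>k. ?a k * (?b k + N' (g t)) + N (f t) * ?b k) \<longlonglongrightarrow> 0 * (0 + N' (g t)) + N (f t) * 0"
        using elim by (intro tendsto_intros)
      ultimately have "(\<lambda>k. \<beta> (s k t) (r k t) - \<beta> (f t) (g t)) \<longlonglongrightarrow> 0"
        by - (rule LIMSEQ_null_le[where b="\<lambda>k. ?a k * (?b k + N' (g t)) + N (f t) * ?b k"], auto)
      then show ?case by (rule LIM_zero_cancel)
    qed
  qed
  show "integrable ?L (\<lambda>t. ((N (f t))\<^sup>2 + (N' (g t))\<^sup>2) / 2)"
    using bochner_l2D(2)[OF f] bochner_l2D(2)[OF g] by auto
  show "AE t in ?L. \<bar>\<beta> (f t) (g t)\<bar> \<le> ((N (f t))\<^sup>2 + (N' (g t))\<^sup>2) / 2"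
  proof (rule AE_I2)
    fix t assume "t \<in> space ?L"
    then have t: "t \<in> {0<..<T}" by simp
    have "\<bar>\<beta> (f t) (g t)\<bar> \<le> N (f t) * N' (g t)"
      by (rule bound[OF bochner_l2D(1)[OF f t] bochner_l2D(1)[OF g t]])
    also have "\<dots> \<le> ((N (f t))\<^sup>2 + (N' (g t))\<^sup>2) / 2"
      using abs_mult_le_half_squares[of "N (f t)" "N' (g t)"] by linarith
    finally show "\<bar>\<beta> (f t) (g t)\<bar> \<le> ((N (f t))\<^sup>2 + (N' (g t))\<^sup>2) / 2" .
  qed
qed

text \<open>Any \<Phi> maps simple functions to simple functions, and the estimate on differences
  carries the convergence over. That estimate stands in for linearity, because traces are linear
  only up to surface-null sets.\<close>

lemma bochner_l2_map:
  assumes X: "seminormed X N" and Y: "seminormed Y N'"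
    and f: "f \<in> bochner_l2 T X N"
    and mem: "\<And>v. v \<in> X \<Longrightarrow> \<Phi> v \<in> Y"
    and diff: "\<And>u v. u \<in> X \<Longrightarrow> v \<in> X \<Longrightarrow> N' (\<lambda>y. \<Phi> u y - \<Phi> v y) \<le> C * N (\<lambda>y. u y - v y)"
    and bound: "\<And>v. v \<in> X \<Longrightarrow> N' (\<Phi> v) \<le> C * N v"
  shows "(\<lambda>t. \<Phi> (f t)) \<in> bochner_l2 T Y N'"
proof -
  interpret X: seminormed X N by fact
  interpret Y: seminormed Y N' by fact
  let ?L = "lebesgue_on {0<..<T}"
  obtain s where s: "\<And>k. simple_function ?L (s k)" "\<And>k t. t \<in> {0<..<T} \<Longrightarrow> s k t \<in> X"
    "AE t in ?L. (\<lambda>k. N (\<lambda>y. s k t y - f t y)) \<longlonglongrightarrow> 0"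
    using f by (rule bochner_l2E) (rule that)
  have lim: "AE t in ?L. (\<lambda>k. N' (\<lambda>y. \<Phi> (s k t) y - \<Phi> (f t) y)) \<longlonglongrightarrow> 0"
    using s(3) AE_space
  proof eventually_elim
    case (elim t)
    then have t: "t \<in> {0<..<T}" by simp
    note f = bochner_l2D(1)[OF f t] and s = s(2)[OF t]
    have "(\<lambda>k. C * N (\<lambda>y. s k t y - f t y)) \<longlonglongrightarrow> C * 0"
      using elim by (intro tendsto_intros)
    moreover have "norm (N' (\<lambda>y. \<Phi> (s k t) y - \<Phi> (f t) y)) \<le> C * N (\<lambda>y. s k t y - f t y)" for k
      using diff[OF s f] Y.nonneg[OF Y.diff_mem[OF mem[OF s] mem[OF f]]]
      by (simp only: real_norm_def abs_of_nonneg)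
    ultimately show ?case
      by - (rule LIMSEQ_null_le[where b="\<lambda>k. C * N (\<lambda>y. s k t y - f t y)"], auto)
  qed
  show ?thesis
  proof (rule bochner_l2I[where s="\<lambda>k t. \<Phi> (s k t)"])
    show "integrable ?L (\<lambda>t. (N' (\<Phi> (f t)))\<^sup>2)"
    proof (rule integrable_of_abs_le)
      show "integrable ?L (\<lambda>t. C\<^sup>2 * (N (f t))\<^sup>2)"
        using bochner_l2D(2)[OF f] by auto
      have "(\<lambda>t. N' (\<Phi> (f t))) \<in> borel_measurable ?L"
      proof (rule borel_measurable_time_AE_LIMSEQ)
        show "(\<lambda>t. N' (\<Phi> (s k t))) \<in> borel_measurable ?L" for k
          by (rule simple_function_compose_measurable[OF s(1)])
        show "AE t in ?L. (\<lambda>k. N' (\<Phi> (s k t))) \<longlonglongrightarrow> N' (\<Phi> (f t))"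
          using lim AE_space
        proof eventually_elim
          case (elim t)
          then have t: "t \<in> {0<..<T}" by simp
          show ?case
            by (rule Y.norm_LIMSEQ[OF mem[OF s(2)[OF t]] mem[OF bochner_l2D(1)[OF f t]] elim(1)])
        qed
      qed
      then show "(\<lambda>t. (N' (\<Phi> (f t)))\<^sup>2) \<in> borel_measurable ?L"
        by simp
      show "AE t in ?L. \<bar>(N' (\<Phi> (f t)))\<^sup>2\<bar> \<le> C\<^sup>2 * (N (f t))\<^sup>2"
      proof (rule AE_I2)
        fix t assume "t \<in> space ?L"
        then have v: "f t \<in> X" using bochner_l2D(1)[OF f] by simp
        have "(N' (\<Phi> (f t)))\<^sup>2 \<le> (C * N (f t))\<^sup>2"
          by (rule power_mono[OF bound[OF v] Y.nonneg[OF mem[OF v]]])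
        then show "\<bar>(N' (\<Phi> (f t)))\<^sup>2\<bar> \<le> C\<^sup>2 * (N (f t))\<^sup>2"
          by (simp add: power_mult_distrib)
      qed
    qed
    show "simple_function ?L (\<lambda>t. \<Phi> (s k t))" for k
      by (rule simple_function_compose1[OF s(1)])
  qed (use lim s(2) bochner_l2D(1)[OF f] mem in auto)
qed

context seminormed
begin

lemma bochner_l2_lin:
  assumes f: "f \<in> bochner_l2 T X N" and g: "g \<in> bochner_l2 T X N"
  shows "(\<lambda>t y. a * f t y + b * g t y) \<in> bochner_l2 T X N"
proof -
  let ?L = "lebesgue_on {0<..<T}"
  obtain s where s: "\<And>k. simple_function ?L (s k)" "\<And>k t. t \<in> {0<..<T} \<Longrightarrow> s k t \<in> X"
    "AE t in ?L. (\<lambda>k. N (\<lambda>y. s k t y - f t y)) \<longlonglongrightarrow> 0"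
    using f by (rule bochner_l2E) (rule that)
  obtain r where r: "\<And>k. simple_function ?L (r k)" "\<And>k t. t \<in> {0<..<T} \<Longrightarrow> r k t \<in> X"
    "AE t in ?L. (\<lambda>k. N (\<lambda>y. r k t y - g t y)) \<longlonglongrightarrow> 0"
    using g by (rule bochner_l2E) (rule that)
  let ?w = "\<lambda>t y. a * f t y + b * g t y" and ?q = "\<lambda>k t y. a * s k t y + b * r k t y"
  have w: "?w t \<in> X" if "t \<in> {0<..<T}" for t
    by (rule lin_mem[OF bochner_l2D(1)[OF f that] bochner_l2D(1)[OF g that]])
  have q: "?q k t \<in> X" if "t \<in> {0<..<T}" for t k
    by (rule lin_mem[OF s(2)[OF that] r(2)[OF that]])
  have sq: "simple_function ?L (?q k)" for k
    using simple_function_compose2[OF s(1) r(1), of "\<lambda>u v y. a * u y + b * v y" k k] by simp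
  have lim: "AE t in ?L. (\<lambda>k. N (\<lambda>y. ?q k t y - ?w t y)) \<longlonglongrightarrow> 0"
    using s(3) r(3) AE_space
  proof eventually_elim
    case (elim t)
    then have t: "t \<in> {0<..<T}" by simp
    let ?a = "\<lambda>k. N (\<lambda>y. s k t y - f t y)" and ?b = "\<lambda>k. N (\<lambda>y. r k t y - g t y)"
    have "norm (N (\<lambda>y. ?q k t y - ?w t y)) \<le> \<bar>a\<bar> * ?a k + \<bar>b\<bar> * ?b k" for k
    proof -
      have "(\<lambda>y. ?q k t y - ?w t y) = (\<lambda>y. a * (s k t y - f t y) + b * (r k t y - g t y))"
        by (simp add: algebra_simps)
      then show ?thesis
        using norm_lin_le[OF diff_mem[OF s(2)[OF t] bochner_l2D(1)[OF f t]]
            diff_mem[OF r(2)[OF t] bochner_l2D(1)[OF g t]], of a k b k]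
          nonneg[OF diff_mem[OF q[OF t] w[OF t]], of k] by simp
    qed
    moreover have "(\<lambda>k. \<bar>a\<bar> * ?a k + \<bar>b\<bar> * ?b k) \<longlonglongrightarrow> \<bar>a\<bar> * 0 + \<bar>b\<bar> * 0"
      using elim by (intro tendsto_intros)
    ultimately show ?case
      by - (rule LIMSEQ_null_le[where b="\<lambda>k. \<bar>a\<bar> * ?a k + \<bar>b\<bar> * ?b k"], auto)
  qed
  show ?thesis
  proof (rule bochner_l2I[OF w sq q lim])
    show "integrable ?L (\<lambda>t. (N (?w t))\<^sup>2)"
    proof (rule integrable_of_abs_le)
      show "integrable ?L (\<lambda>t. 2 * a\<^sup>2 * (N (f t))\<^sup>2 + 2 * b\<^sup>2 * (N (g t))\<^sup>2)"
        using bochner_l2D(2)[OF f] bochner_l2D(2)[OF g] by auto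
      have "(\<lambda>t. N (?w t)) \<in> borel_measurable ?L"
      proof (rule borel_measurable_time_AE_LIMSEQ)
        show "(\<lambda>t. N (?q k t)) \<in> borel_measurable ?L" for k
          by (rule simple_function_compose_measurable[OF sq])
        show "AE t in ?L. (\<lambda>k. N (?q k t)) \<longlonglongrightarrow> N (?w t)"
          using lim AE_space
        proof eventually_elim
          case (elim t)
          then have t: "t \<in> {0<..<T}" by simp
          show ?case
            by (rule norm_LIMSEQ[OF q[OF t] w[OF t] elim(1)])
        qed
      qed
      then show "(\<lambda>t. (N (?w t))\<^sup>2) \<in> borel_measurable ?L"
        by simp
      show "AE t in ?L. \<bar>(N (?w t))\<^sup>2\<bar> \<le> 2 * a\<^sup>2 * (N (f t))\<^sup>2 + 2 * b\<^sup>2 * (N (g t))\<^sup>2"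
      proof (rule AE_I2)
        fix t assume "t \<in> space ?L"
        then have t: "t \<in> {0<..<T}" by simp
        have "(N (?w t))\<^sup>2 \<le> (\<bar>a\<bar> * N (f t) + \<bar>b\<bar> * N (g t))\<^sup>2"
          by (rule power_mono[OF norm_lin_le[OF bochner_l2D(1)[OF f t] bochner_l2D(1)[OF g t]] nonneg[OF w[OF t]]])
        also have "\<dots> \<le> 2 * (\<bar>a\<bar> * N (f t))\<^sup>2 + 2 * (\<bar>b\<bar> * N (g t))\<^sup>2"
          using sum_squares_bound[of "\<bar>a\<bar> * N (f t)" "\<bar>b\<bar> * N (g t)"] by (simp add: power2_sum)
        finally show "\<bar>(N (?w t))\<^sup>2\<bar> \<le> 2 * a\<^sup>2 * (N (f t))\<^sup>2 + 2 * b\<^sup>2 * (N (g t))\<^sup>2"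
          by (simp add: power_mult_distrib)
      qed
    qed
  qed
qed

lemma bochner_l2_diff:
  "f \<in> bochner_l2 T X N \<Longrightarrow> g \<in> bochner_l2 T X N \<Longrightarrow> (\<lambda>t y. f t y - g t y) \<in> bochner_l2 T X N"
  using bochner_l2_lin[of f T g 1 "-1"] by simp

section \<open>Simple approximation and completeness in Bochner spaces\<close>

lemma bochner_l2_norm_measurable:
  assumes f: "f \<in> bochner_l2 T X N"
  shows "(\<lambda>t. N (f t)) \<in> borel_measurable (lebesgue_on {0<..<T})"
proof -
  have "(\<lambda>t. sqrt ((N (f t))\<^sup>2)) \<in> borel_measurable (lebesgue_on {0<..<T})"
    by (rule measurable_compose[OF borel_measurable_integrable[OF bochner_l2D(2)[OF f]]])
      (intro borel_measurable_continuous_onI continuous_intros)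
  then show ?thesis
    by (rule measurable_cong[THEN iffD1, rotated]) (simp add: nonneg bochner_l2D(1)[OF f])
qed

text \<open>Strong measurability gives simple functions converging pointwise, but no control of
  their norms. Replacing them by zero where they exceed twice the norm of f keeps them simple and
  supplies a dominating function.\<close>

lemma bochner_l2_simple_approx:
  assumes f: "f \<in> bochner_l2 T X N" and e: "e > 0"
  obtains s where "simple_function (lebesgue_on {0<..<T}) s" "s \<in> bochner_l2 T X N"
    "(\<integral>t. (N (\<lambda>y. s t y - f t y))\<^sup>2 \<partial>lebesgue_on {0<..<T}) < e"
proof -
  let ?L = "lebesgue_on {0<..<T}"
  obtain s where s: "\<And>k. simple_function ?L (s k)" "\<And>k t. t \<in> {0<..<T} \<Longrightarrow> s k t \<in> X"
    "AE t in ?L. (\<lambda>k. N (\<lambda>y. s k t y - f t y)) \<longlonglongrightarrow> 0"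
    using f by (rule bochner_l2E) (rule that)
  have fm: "(\<lambda>t. N (f t)) \<in> borel_measurable ?L"
    by (rule bochner_l2_norm_measurable[OF f])
  have fX: "f t \<in> X" if "t \<in> {0<..<T}" for t
    by (rule bochner_l2D(1)[OF f that])
  \<comment> \<open>The factor 2 leaves room: where \<open>N (f t)\<close> is positive, convergence
    forces the condition to hold eventually, so the cut-off disappears in the limit.\<close>
  define r where "r k t = (if N (s k t) \<le> 2 * N (f t) then s k t else (\<lambda>y. 0))" for k t
  have sr: "simple_function ?L (r k)" for k
    unfolding r_def
  proof (rule simple_function_If)
    have [measurable]: "(\<lambda>t. N (s k t)) \<in> borel_measurable ?L"
      by (rule simple_function_compose_measurable[OF s(1)])
    note [measurable] = fm
    show "{t \<in> space ?L. N (s k t) \<le> 2 * N (f t)} \<in> sets ?L"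
      by measurable
  qed (auto intro: s)
  have rX: "r k t \<in> X" if "t \<in> {0<..<T}" for k t
    using s(2)[OF that] zero_mem by (simp add: r_def)
  have rle: "N (r k t) \<le> 2 * N (f t)" if "t \<in> {0<..<T}" for k t
    using nonneg[OF fX[OF that]] by (simp add: r_def norm_zero)
  have lim: "AE t in ?L. (\<lambda>k. N (\<lambda>y. r k t y - f t y)) \<longlonglongrightarrow> 0"
    using s(3) AE_space
  proof eventually_elim
    case (elim t)
    then have t: "t \<in> {0<..<T}" by simp
    let ?a = "\<lambda>k. N (\<lambda>y. s k t y - f t y)"
    have "\<forall>\<^sub>F k in sequentially. norm (N (\<lambda>y. r k t y - f t y)) \<le> ?a k"
    proof (cases "N (f t) = 0")
      case True
      have "norm (N (\<lambda>y. r k t y - f t y)) \<le> ?a k" for k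
      proof (cases "N (s k t) \<le> 2 * N (f t)")
        case True
        then show ?thesis
          using nonneg[OF diff_mem[OF s(2)[OF t] fX[OF t]], of k] by (simp add: r_def)
      next
        case False
        \<comment> \<open>If \<open>N (f t) = 0\<close>, the cut-off may stay active for all k, but
          then zero is itself at distance zero from \<open>f t\<close>.\<close>
        have "N (\<lambda>y. 0 - f t y) = N (f t)"
          using scale[OF fX[OF t], of "-1"] by simp
        then show ?thesis
          using False True nonneg[OF diff_mem[OF s(2)[OF t] fX[OF t]], of k] by (simp add: r_def)
      qed
      then show ?thesis by simp
    next
      case False
      then have pos: "N (f t) > 0" using nonneg[OF fX[OF t]] by simp
      have "\<forall>\<^sub>F k in sequentially. ?a k < N (f t)"
        using elim(1) pos by (rule order_tendstoD(2))
      then show ?thesis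
      proof eventually_elim
        case (elim k)
        then have "N (s k t) \<le> 2 * N (f t)"
          using abs_norm_diff[OF s(2)[OF t] fX[OF t], of k] by linarith
        then show ?case
          using nonneg[OF diff_mem[OF s(2)[OF t] fX[OF t]], of k] by (simp add: r_def)
      qed
    qed
    then show ?case
      by (rule Lim_null_comparison) (rule elim(1))
  qed
  have rB: "r k \<in> bochner_l2 T X N" for k
  proof (rule bochner_l2I[where s="\<lambda>_. r k"])
    show "AE t in ?L. (\<lambda>ka::nat. N (\<lambda>y. r k t y - r k t y)) \<longlonglongrightarrow> 0"
      by (simp add: norm_zero)
    show "integrable ?L (\<lambda>t. (N (r k t))\<^sup>2)"
    proof (rule integrable_of_abs_le)
      show "integrable ?L (\<lambda>t. 4 * (N (f t))\<^sup>2)"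
        using bochner_l2D(2)[OF f] by auto
      show "(\<lambda>t. (N (r k t))\<^sup>2) \<in> borel_measurable ?L"
        by (rule simple_function_compose_measurable[OF sr])
      show "AE t in ?L. \<bar>(N (r k t))\<^sup>2\<bar> \<le> 4 * (N (f t))\<^sup>2"
      proof (rule AE_I2)
        fix t assume "t \<in> space ?L"
        then have t: "t \<in> {0<..<T}" by simp
        show "\<bar>(N (r k t))\<^sup>2\<bar> \<le> 4 * (N (f t))\<^sup>2"
          using power_mono[OF rle[OF t, of k] nonneg[OF rX[OF t]], of 2] by (simp add: power_mult_distrib)
      qed
    qed
  qed (auto intro: rX sr)
  note rf = bochner_l2_diff[OF rB f]
  have "(\<lambda>k. \<integral>t. (N (\<lambda>y. r k t y - f t y))\<^sup>2 \<partial>?L) \<longlonglongrightarrow> (\<integral>t. 0 \<partial>?L)"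
  \<comment> \<open>The 9 is (2 + 1)^2: the truncated function has at most twice the norm of f, and
    subtracting f adds one more.\<close>
  proof (rule integral_dominated_convergence[where w="\<lambda>t. 9 * (N (f t))\<^sup>2"])
    show "integrable ?L (\<lambda>t. 9 * (N (f t))\<^sup>2)"
      using bochner_l2D(2)[OF f] by auto
    show "(\<lambda>t. (N (\<lambda>y. r k t y - f t y))\<^sup>2) \<in> borel_measurable ?L" for k
      using bochner_l2D(2)[OF rf] by blast
    show "AE t in ?L. (\<lambda>k. (N (\<lambda>y. r k t y - f t y))\<^sup>2) \<longlonglongrightarrow> 0"
      using lim
    proof eventually_elim
      case (elim t)
      from tendsto_power[OF this, of 2] show ?case by simp
    qed
    show "AE t in ?L. norm ((N (\<lambda>y. r k t y - f t y))\<^sup>2) \<le> 9 * (N (f t))\<^sup>2" for k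
    proof (rule AE_I2)
      fix t assume "t \<in> space ?L"
      then have t: "t \<in> {0<..<T}" by simp
      have "N (\<lambda>y. r k t y - f t y) \<le> 3 * N (f t)"
        using triangle_diff[OF rX[OF t] fX[OF t], of k] rle[OF t, of k] by linarith
      then show "norm ((N (\<lambda>y. r k t y - f t y))\<^sup>2) \<le> 9 * (N (f t))\<^sup>2"
        using power_mono[OF _ nonneg[OF diff_mem[OF rX[OF t] fX[OF t]]], of k "3 * N (f t)" 2]
        by (simp add: power_mult_distrib)
    qed
  qed auto
  then have "\<forall>\<^sub>F k in sequentially. (\<integral>t. (N (\<lambda>y. r k t y - f t y))\<^sup>2 \<partial>?L) < e"
    by (rule order_tendstoD) (simp add: e)
  then obtain k where "(\<integral>t. (N (\<lambda>y. r k t y - f t y))\<^sup>2 \<partial>?L) < e"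
    by (auto simp: eventually_sequentially)
  then show ?thesis
    by (intro that[of "r k"] sr rB)
qed

text \<open>The Riesz-Fischer argument with values in X, and one additional burden: the limit has to
  be strongly measurable. To this end each term of the fast subsequence is accompanied by a simple
  function so close to it that both have the same pointwise limit. Minimizing sequences only call
  for a limit along a subsequence.\<close>

lemma bochner_l2_Cauchy_limit:
  assumes complete: "seminorm_complete X N"
    and q: "\<And>n. q n \<in> bochner_l2 T X N"
    and cau: "\<And>e. e > 0 \<Longrightarrow>
      \<exists>K. \<forall>m\<ge>K. \<forall>n\<ge>K. (\<integral>t. (N (\<lambda>y. q m t y - q n t y))\<^sup>2 \<partial>lebesgue_on {0<..<T}) < e"
  obtains \<sigma> l where "strict_mono (\<sigma> :: nat \<Rightarrow> nat)" "l \<in> bochner_l2 T X N"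
    "(\<lambda>k. \<integral>t. (N (\<lambda>y. q (\<sigma> k) t y - l t y))\<^sup>2 \<partial>lebesgue_on {0<..<T}) \<longlonglongrightarrow> 0"
proof -
  let ?L = "lebesgue_on {0<..<T}"
  obtain \<sigma> where \<sigma>: "strict_mono \<sigma>" and fast: "\<And>k n. n \<ge> \<sigma> k \<Longrightarrow>
      (\<integral>t. (N (\<lambda>y. q n t y - q (\<sigma> k) t y))\<^sup>2 \<partial>?L) \<le> (1/4) ^ k"
    by (rule Cauchy_subsequence_rate[OF cau, of "\<lambda>k. (1/4) ^ k"]) auto
  have "\<forall>k. \<exists>s. simple_function ?L s \<and> s \<in> bochner_l2 T X N \<and>
      (\<integral>t. (N (\<lambda>y. s t y - q (\<sigma> k) t y))\<^sup>2 \<partial>?L) < (1/4) ^ k"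
  proof
    fix k
    show "\<exists>s. simple_function ?L s \<and> s \<in> bochner_l2 T X N \<and>
        (\<integral>t. (N (\<lambda>y. s t y - q (\<sigma> k) t y))\<^sup>2 \<partial>?L) < (1/4) ^ k"
      by (rule bochner_l2_simple_approx[OF q[of "\<sigma> k"], of "(1/4) ^ k"]) auto
  qed
  from choice[OF this] obtain s where s_all: "\<forall>k. simple_function ?L (s k) \<and> s k \<in> bochner_l2 T X N \<and>
      (\<integral>t. (N (\<lambda>y. s k t y - q (\<sigma> k) t y))\<^sup>2 \<partial>?L) < (1/4) ^ k"
    by (rule exE)
  then have s: "\<And>k. simple_function ?L (s k)" "\<And>k. s k \<in> bochner_l2 T X N"
    "\<And>k. (\<integral>t. (N (\<lambda>y. s k t y - q (\<sigma> k) t y))\<^sup>2 \<partial>?L) < (1/4) ^ k"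
    by blast+
  have qX: "q n t \<in> X" if "t \<in> {0<..<T}" for n t
    by (rule bochner_l2D(1)[OF q that])
  have sX: "s n t \<in> X" if "t \<in> {0<..<T}" for n t
    by (rule bochner_l2D(1)[OF s(2) that])
  have sum1: "AE t in ?L. summable (\<lambda>k. N (\<lambda>y. q (\<sigma> (Suc k)) t y - q (\<sigma> k) t y))"
  proof (rule AE_summable_of_fast_decay)
    show "integrable ?L (\<lambda>t. (N (\<lambda>y. q (\<sigma> (Suc k)) t y - q (\<sigma> k) t y))\<^sup>2)" for k
      by (rule bochner_l2D(2)[OF bochner_l2_diff[OF q q]])
    show "0 \<le> N (\<lambda>y. q (\<sigma> (Suc k)) t y - q (\<sigma> k) t y)" if "t \<in> space ?L" for k t
      using that by (intro nonneg diff_mem qX) auto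
    show "(\<integral>t. (N (\<lambda>y. q (\<sigma> (Suc k)) t y - q (\<sigma> k) t y))\<^sup>2 \<partial>?L) \<le> (1/4) ^ k" for k
      using \<sigma> by (intro fast) (simp add: strict_mono_less_eq)
  qed
  have sum2: "AE t in ?L. summable (\<lambda>k. N (\<lambda>y. s k t y - q (\<sigma> k) t y))"
  proof (rule AE_summable_of_fast_decay)
    show "integrable ?L (\<lambda>t. (N (\<lambda>y. s k t y - q (\<sigma> k) t y))\<^sup>2)" for k
      by (rule bochner_l2D(2)[OF bochner_l2_diff[OF s(2) q]])
    show "0 \<le> N (\<lambda>y. s k t y - q (\<sigma> k) t y)" if "t \<in> space ?L" for k t
      using that by (intro nonneg diff_mem qX sX) auto
    show "(\<integral>t. (N (\<lambda>y. s k t y - q (\<sigma> k) t y))\<^sup>2 \<partial>?L) \<le> (1/4) ^ k" for k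
      using s(3) by (rule less_imp_le)
  qed
  let ?P = "\<lambda>t l. l \<in> X \<and> (\<lambda>k. N (\<lambda>y. q (\<sigma> k) t y - l y)) \<longlonglongrightarrow> 0"
  \<comment> \<open>The default zero keeps l in X at times without a limit; these lie in a null set
    by the summability of the increments.\<close>
  define l where "l t = (if \<exists>l. ?P t l then SOME l. ?P t l else (\<lambda>y. 0))" for t
  have lP: "?P t (l t)" if "\<exists>l. ?P t l" for t
    using someI_ex[OF that] that by (simp add: l_def)
  have lX: "l t \<in> X" for t
    using lP[of t] zero_mem by (cases "\<exists>l. ?P t l") (auto simp: l_def)
  have lim: "AE t in ?L. (\<lambda>k. N (\<lambda>y. q (\<sigma> k) t y - l t y)) \<longlonglongrightarrow> 0"
    using sum1 AE_space
  proof eventually_elim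
    case (elim t)
    then have t: "t \<in> {0<..<T}" by simp
    let ?a = "\<lambda>k. N (\<lambda>y. q (\<sigma> (Suc k)) t y - q (\<sigma> k) t y)"
    have bound: "N (\<lambda>y. q (\<sigma> n) t y - q (\<sigma> m) t y) \<le> (\<Sum>k=m..<n. ?a k)" if "m \<le> n" for m n
      using that
    proof (induction n rule: dec_induct)
      case base
      show ?case by (simp add: norm_zero)
    next
      case (step n)
      have "N (\<lambda>y. q (\<sigma> (Suc n)) t y - q (\<sigma> m) t y) \<le>
          ?a n + N (\<lambda>y. q (\<sigma> n) t y - q (\<sigma> m) t y)"
        by (intro triangle3 qX t)
      with step show ?case by simp
    qed
    have "\<exists>K. \<forall>m\<ge>K. \<forall>n\<ge>K. N (\<lambda>y. q (\<sigma> m) t y - q (\<sigma> n) t y) < e" if "e > 0" for e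
    proof -
      obtain K where K: "\<And>m n. m \<ge> K \<Longrightarrow> norm (\<Sum>k=m..<n. ?a k) < e"
        using elim(1) \<open>e > 0\<close> unfolding summable_Cauchy by blast
      have *: "N (\<lambda>y. q (\<sigma> n) t y - q (\<sigma> m) t y) < e" if "m \<ge> K" "m \<le> n" for m n
        using bound[OF that(2)] K[OF that(1), of n] by simp
      have "N (\<lambda>y. q (\<sigma> m) t y - q (\<sigma> n) t y) < e" if "m \<ge> K" "n \<ge> K" for m n
        using *[of m n] *[of n m] that norm_minus_commute[OF qX[OF t, of "\<sigma> m"] qX[OF t, of "\<sigma> n"]]
        by (cases "m \<le> n") auto
      then show ?thesis by blast
    qed
    moreover have "\<forall>n. q (\<sigma> n) t \<in> X"
      using qX[OF t] by blast
    ultimately have "\<exists>l. ?P t l"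
      using complete[unfolded seminorm_complete_def, rule_format, of "\<lambda>n. q (\<sigma> n) t"] by blast
    from lP[OF this] show ?case by blast
  qed
  have lims: "AE t in ?L. (\<lambda>k. N (\<lambda>y. s k t y - l t y)) \<longlonglongrightarrow> 0"
    using lim sum2 AE_space
  proof eventually_elim
    case (elim t)
    then have t: "t \<in> {0<..<T}" by simp
    have "(\<lambda>k. N (\<lambda>y. s k t y - q (\<sigma> k) t y) + N (\<lambda>y. q (\<sigma> k) t y - l t y)) \<longlonglongrightarrow> 0 + 0"
      by (rule tendsto_add[OF summable_LIMSEQ_zero[OF elim(2)] elim(1)])
    moreover have "norm (N (\<lambda>y. s k t y - l t y)) \<le>
        N (\<lambda>y. s k t y - q (\<sigma> k) t y) + N (\<lambda>y. q (\<sigma> k) t y - l t y)" for k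
    proof -
      have "0 \<le> N (\<lambda>y. s k t y - l t y)"
        by (intro nonneg diff_mem sX lX t)
      moreover have "N (\<lambda>y. s k t y - l t y) \<le>
          N (\<lambda>y. s k t y - q (\<sigma> k) t y) + N (\<lambda>y. q (\<sigma> k) t y - l t y)"
        by (intro triangle3 sX qX lX t)
      ultimately show ?thesis by simp
    qed
    ultimately show ?case
      by - (rule LIMSEQ_null_le[where b="\<lambda>k. N (\<lambda>y. s k t y - q (\<sigma> k) t y) + N (\<lambda>y. q (\<sigma> k) t y - l t y)"], auto)
  qed
  have sq: "integrable ?L (\<lambda>t. (N (\<lambda>y. l t y - q (\<sigma> k) t y))\<^sup>2)"
    "(\<integral>t. (N (\<lambda>y. l t y - q (\<sigma> k) t y))\<^sup>2 \<partial>?L) \<le> (1/4) ^ k" for k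
  proof -
    have m: "(\<lambda>t. N (\<lambda>y. l t y - q (\<sigma> k) t y)) \<in> borel_measurable ?L"
    proof (rule borel_measurable_time_AE_LIMSEQ)
      show "(\<lambda>t. N (\<lambda>y. s j t y - q (\<sigma> k) t y)) \<in> borel_measurable ?L" for j
        by (rule bochner_l2_norm_measurable[OF bochner_l2_diff[OF s(2) q]])
      show "AE t in ?L. (\<lambda>j. N (\<lambda>y. s j t y - q (\<sigma> k) t y)) \<longlonglongrightarrow> N (\<lambda>y. l t y - q (\<sigma> k) t y)"
        using lims AE_space by eventually_elim (intro norm_diff_LIMSEQ sX lX qX; simp)
    qed
    have "AE t in ?L. (\<lambda>j. N (\<lambda>y. q (\<sigma> j) t y - q (\<sigma> k) t y)) \<longlonglongrightarrow> N (\<lambda>y. l t y - q (\<sigma> k) t y)"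
      using lim AE_space by eventually_elim (intro norm_diff_LIMSEQ lX qX; simp)
    moreover have "\<forall>\<^sub>F j in sequentially. (\<integral>t. (N (\<lambda>y. q (\<sigma> j) t y - q (\<sigma> k) t y))\<^sup>2 \<partial>?L) \<le> (1/4) ^ k"
      using eventually_ge_at_top[of k] by eventually_elim (rule fast, use \<sigma> in \<open>simp add: strict_mono_less_eq\<close>)
    ultimately show "integrable ?L (\<lambda>t. (N (\<lambda>y. l t y - q (\<sigma> k) t y))\<^sup>2)"
      "(\<integral>t. (N (\<lambda>y. l t y - q (\<sigma> k) t y))\<^sup>2 \<partial>?L) \<le> (1/4) ^ k"
      by (rule square_integral_le_of_AE_LIMSEQ[OF m bochner_l2D(2)[OF bochner_l2_diff[OF q q]]])+
  qed
  \<comment> \<open>Fatou's lemma yields square integrability of the distance between l and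
    \<open>q (\<sigma> 0)\<close>, so this difference is placed in the space before l
    itself.\<close>
  have diffB: "(\<lambda>t y. l t y - q (\<sigma> 0) t y) \<in> bochner_l2 T X N"
  proof (rule bochner_l2E[OF q[of "\<sigma> 0"]])
    fix r assume r: "\<And>k. simple_function ?L (r k)" "\<And>k t. t \<in> {0<..<T} \<Longrightarrow> r k t \<in> X"
      "AE t in ?L. (\<lambda>k. N (\<lambda>y. r k t y - q (\<sigma> 0) t y)) \<longlonglongrightarrow> 0"
    show ?thesis
    proof (rule bochner_l2I[where s="\<lambda>k t y. s k t y - r k t y"])
      show "simple_function ?L (\<lambda>t y. s k t y - r k t y)" for k
        using simple_function_compose2[OF s(1) r(1), of "\<lambda>u v y. u y - v y" k k] by simp
      show "AE t in ?L. (\<lambda>k. N (\<lambda>y. s k t y - r k t y - (l t y - q (\<sigma> 0) t y))) \<longlonglongrightarrow> 0"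
        using r(3) lims AE_space
      proof eventually_elim
        case (elim t)
        then have t: "t \<in> {0<..<T}" by simp
        let ?g = "\<lambda>k. N (\<lambda>y. s k t y - l t y) + N (\<lambda>y. r k t y - q (\<sigma> 0) t y)"
        have "?g \<longlonglongrightarrow> 0 + 0"
          by (rule tendsto_add[OF elim(2,1)])
        moreover have "norm (N (\<lambda>y. s k t y - r k t y - (l t y - q (\<sigma> 0) t y))) \<le> ?g k" for k
        proof -
          have "(\<lambda>y. s k t y - r k t y - (l t y - q (\<sigma> 0) t y)) = (\<lambda>y. (s k t y - l t y) - (r k t y - q (\<sigma> 0) t y))"
            by (simp add: algebra_simps)
          moreover have "0 \<le> N (\<lambda>y. (s k t y - l t y) - (r k t y - q (\<sigma> 0) t y))"
            by (intro nonneg diff_mem r qX sX lX t)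
          moreover have "N (\<lambda>y. (s k t y - l t y) - (r k t y - q (\<sigma> 0) t y)) \<le> ?g k"
            by (intro triangle_diff diff_mem r qX sX lX t)
          ultimately show ?thesis
            by (simp only: real_norm_def abs_of_nonneg)
        qed
        ultimately show ?case
          by - (rule LIMSEQ_null_le[where b="?g"], auto)
      qed
      show "integrable ?L (\<lambda>t. (N (\<lambda>y. l t y - q (\<sigma> 0) t y))\<^sup>2)"
        by (rule sq(1))
    qed (auto intro!: diff_mem qX lX r(2) sX)
  qed
  have l: "l \<in> bochner_l2 T X N"
    using bochner_l2_lin[OF diffB q[of "\<sigma> 0"], of 1 1] by simp
  have "(\<integral>t. (N (\<lambda>y. q (\<sigma> k) t y - l t y))\<^sup>2 \<partial>?L) = (\<integral>t. (N (\<lambda>y. l t y - q (\<sigma> k) t y))\<^sup>2 \<partial>?L)" for k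
    by (rule Bochner_Integration.integral_cong) (simp_all add: norm_minus_commute[OF lX qX])
  then have "(\<integral>t. (N (\<lambda>y. q (\<sigma> k) t y - l t y))\<^sup>2 \<partial>?L) \<le> (1/4) ^ k" for k
    using sq(2)[of k] by simp
  then have "(\<lambda>k. \<integral>t. (N (\<lambda>y. q (\<sigma> k) t y - l t y))\<^sup>2 \<partial>?L) \<longlonglongrightarrow> 0"
    by (intro LIMSEQ_null_le[OF _ LIMSEQ_realpow_zero[of "1/4"]]) auto
  with \<sigma> l show ?thesis by (rule that)
qed

end

section \<open>Continuously differentiable cut-offs\<close>

text \<open>Squaring removes the kink of the positive part: at 0 the difference quotient is bounded
  by the absolute value of h.\<close>

lemma DERIV_max_0_power2: "((\<lambda>x::real. (max 0 x)\<^sup>2) has_real_derivative 2 * max 0 x) (at x)"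
proof -
  consider "x > 0" | "x < 0" | "x = 0" by linarith
  then show ?thesis
  proof cases
    case 1
    have "((\<lambda>x::real. x\<^sup>2) has_real_derivative 2 * max 0 x) (at x)"
      using 1 by (auto intro!: derivative_eq_intros)
    then show ?thesis
      by (rule has_field_derivative_transform_within_open[of _ _ _ "{0<..}"]) (use 1 in auto)
  next
    case 2
    have "((\<lambda>x::real. 0) has_real_derivative 2 * max 0 x) (at x)"
      using 2 by auto
    then show ?thesis
      by (rule has_field_derivative_transform_within_open[of _ _ _ "{..<0}"]) (use 2 in auto)
  next
    case 3
    have "((\<lambda>h::real. (max 0 h)\<^sup>2 / h) \<longlongrightarrow> 0) (at 0)"
    proof (rule Lim_null_comparison[where g="\<lambda>h. \<bar>h\<bar>"])
      have "norm ((max 0 h)\<^sup>2 / h) \<le> \<bar>h\<bar>" for h :: real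
        by (cases "h > 0") (auto simp: power2_eq_square)
      then show "\<forall>\<^sub>F h in at 0. norm ((max 0 h)\<^sup>2 / h) \<le> \<bar>h\<bar>" for h :: real
        by simp
      show "((\<lambda>h::real. \<bar>h\<bar>) \<longlongrightarrow> 0) (at 0)"
        by (rule tendsto_rabs_zero) (rule tendsto_ident_at)
    qed
    then show ?thesis
      using 3 by (simp add: DERIV_def)
  qed
qed

text \<open>A transition from 0 to 1 on [0,1]. Test functions are required to be C^1 only, so an
  algebraic formula can replace the usual exp(-1/x). The denominator is positive because x and 1 - x
  are never both \<le> 0.\<close>

definition smooth_step :: "real \<Rightarrow> real" where
  "smooth_step x = (max 0 x)\<^sup>2 / ((max 0 x)\<^sup>2 + (max 0 (1 - x))\<^sup>2)"

text \<open>The quotient rule after cancellation, left as a sum of nonnegative terms so that its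
  sign is evident.\<close>

definition smooth_step_deriv :: "real \<Rightarrow> real" where
  "smooth_step_deriv x = (2 * max 0 x * (max 0 (1 - x))\<^sup>2 + (max 0 x)\<^sup>2 * (2 * max 0 (1 - x))) /
     ((max 0 x)\<^sup>2 + (max 0 (1 - x))\<^sup>2)\<^sup>2"

lemma smooth_step_denom_pos: "(max 0 x)\<^sup>2 + (max 0 (1 - x))\<^sup>2 > (0::real)"
proof (cases "x > 0")
  case True
  then show ?thesis by (intro add_pos_nonneg) auto
next
  case False
  then show ?thesis by (intro add_nonneg_pos) auto
qed

lemma DERIV_smooth_step: "(smooth_step has_real_derivative smooth_step_deriv x) (at x)"
proof -
  have c: "((\<lambda>x::real. (max 0 (1 - x))\<^sup>2) has_real_derivative - (2 * max 0 (1 - x))) (at x)"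
  proof -
    have "((\<lambda>x::real. 1 - x) has_real_derivative -1) (at x)"
      by (auto intro!: derivative_eq_intros)
    from DERIV_chain2[OF DERIV_max_0_power2 this] show ?thesis by simp
  qed
  show ?thesis
    unfolding smooth_step_def[abs_def] smooth_step_deriv_def
    by (rule DERIV_cong[OF DERIV_divide[OF DERIV_max_0_power2 DERIV_add[OF DERIV_max_0_power2 c]]])
      (use smooth_step_denom_pos[of x] in \<open>auto simp: power2_eq_square algebra_simps\<close>)
qed

lemma continuous_on_smooth_step_deriv: "continuous_on S smooth_step_deriv"
  unfolding smooth_step_deriv_def[abs_def]
  by (intro continuous_intros) (use smooth_step_denom_pos in \<open>auto simp: less_imp_neq[symmetric]\<close>)

lemma smooth_step_simps: "x \<le> 0 \<Longrightarrow> smooth_step x = 0" "x \<ge> 1 \<Longrightarrow> smooth_step x = 1"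
  "x \<le> 0 \<Longrightarrow> smooth_step_deriv x = 0" "x \<ge> 1 \<Longrightarrow> smooth_step_deriv x = 0"
  by (auto simp: smooth_step_def smooth_step_deriv_def max_def)

lemma smooth_step_bounds: "0 \<le> smooth_step x" "smooth_step x \<le> 1" "0 \<le> smooth_step_deriv x"
  using smooth_step_denom_pos[of x] by (auto simp: smooth_step_def smooth_step_deriv_def)

lemma continuous_on_smooth_step: "continuous_on S smooth_step"
  using DERIV_smooth_step by (meson DERIV_continuous_on has_field_derivative_at_within)

section \<open>The fundamental theorem of calculus for weak derivatives in time\<close>

text \<open>Passes from the Lebesgue integral over the open interval to the gauge integral over the
  closed one, for which the fundamental theorem and translations are at hand.\<close>

lemma time_integral_continuous:
  fixes f :: "real \<Rightarrow> real"
  assumes "continuous_on {0..T} f"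
  shows "integrable (lebesgue_on {0<..<T}) f"
    and "(\<integral>t. f t \<partial>lebesgue_on {0<..<T}) = integral {0..T} f"
proof -
  have "set_integrable lebesgue {0..T} f"
    using continuous_imp_integrable_real[OF assms] by (simp add: integrable_restrict_space set_integrable_def)
  then have "set_integrable lebesgue {0<..<T} f"
    by (rule set_integrable_subset) auto
  then show int: "integrable (lebesgue_on {0<..<T}) f"
    by (simp add: integrable_restrict_space set_integrable_def)
  have "(\<integral>t. f t \<partial>lebesgue_on {0<..<T}) = integral {0<..<T} f"
    using int by (rule lebesgue_integral_eq_integral) auto
  then show "(\<integral>t. f t \<partial>lebesgue_on {0<..<T}) = integral {0..T} f"
    using integral_open_interval[of 0 T f] by simp
qed

text \<open>The derivative of a rescaled step is a nonnegative kernel living on [a, a + 1/(k+1)],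
  with mass one as soon as this interval fits below T. Continuity of f at a does the rest.\<close>

lemma smooth_step_approximate_identity:
  fixes f :: "real \<Rightarrow> real"
  assumes f: "continuous_on {0..T} f" and a: "0 < a" "a < T"
  shows "(\<lambda>k. \<integral>t. f t * (real (Suc k) * smooth_step_deriv (real (Suc k) * (t - a))) \<partial>lebesgue_on {0<..<T})
    \<longlonglongrightarrow> f a"
proof (rule LIMSEQ_I)
  fix e :: real assume "e > 0"
  let ?L = "lebesgue_on {0<..<T}"
  obtain d where d: "d > 0" "\<And>t. t \<in> {0..T} \<Longrightarrow> dist t a < d \<Longrightarrow> dist (f t) (f a) < e / 2"
    using f a \<open>e > 0\<close> unfolding continuous_on_iff
    by (metis atLeastAtMost_iff half_gt_zero less_eq_real_def)
  \<comment> \<open>Below d, the kernel sees only times at which f is close to f(a); below T - a,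
    the step has reached 1 before T and the kernel has full mass.\<close>
  obtain K :: nat where K: "1 / real (Suc K) < min d (T - a)"
    using d a by (metis diff_gt_0_iff_gt min_less_iff_conj nat_approx_posE zero_less_Suc)
  have "norm ((\<integral>t. f t * (real (Suc k) * smooth_step_deriv (real (Suc k) * (t - a))) \<partial>?L) - f a) < e"
    if "k \<ge> K" for k
  proof -
    let ?n = "real (Suc k)"
    let ?\<eta> = "\<lambda>t. ?n * smooth_step_deriv (?n * (t - a))"
    have "1 / ?n \<le> 1 / real (Suc K)"
      using that by (simp add: field_simps)
    with K have n: "1 / ?n < d" "1 / ?n < T - a"
      by linarith+
    then have nT: "?n * (T - a) \<ge> 1" 
      by (simp add: field_simps)
    have c\<eta>: "continuous_on {0..T} ?\<eta>"
      by (intro continuous_intros continuous_on_compose2[OF continuous_on_smooth_step_deriv[of UNIV]]) auto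
    have D: "((\<lambda>t. smooth_step (?n * (t - a))) has_vector_derivative ?\<eta> t) (at t within {0..T})" for t
    proof -
      have "((\<lambda>t. smooth_step (?n * (t - a))) has_real_derivative smooth_step_deriv (?n * (t - a)) * ?n) (at t)"
        by (rule DERIV_chain2[OF DERIV_smooth_step]) (auto intro!: derivative_eq_intros)
      then show ?thesis
        by (simp add: has_real_derivative_iff_has_vector_derivative mult.commute has_vector_derivative_at_within)
    qed
    have "(?\<eta> has_integral smooth_step (?n * (T - a)) - smooth_step (?n * (0 - a))) {0..T}"
      by (rule fundamental_theorem_of_calculus) (use a D in auto)
    moreover have "smooth_step (?n * (T - a)) = 1"
      by (rule smooth_step_simps(2)[OF nT])
    moreover have "smooth_step (?n * (0 - a)) = 0"
      using a by (intro smooth_step_simps(1)) (simp add: mult_nonneg_nonpos)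
    ultimately have "(?\<eta> has_integral (1 - 0)) {0..T}"
      by (simp only:)
    then have "integral {0..T} ?\<eta> = 1"
      by (simp only: integral_unique diff_zero)
    then have one: "(\<integral>t. ?\<eta> t \<partial>?L) = 1"
      using time_integral_continuous(2)[OF c\<eta>] by simp
    have int\<eta>: "integrable ?L ?\<eta>"
      by (rule time_integral_continuous(1)[OF c\<eta>])
    have int: "integrable ?L (\<lambda>t. f t * ?\<eta> t)"
      by (intro time_integral_continuous(1) continuous_on_mult f c\<eta>)
    have "(\<integral>t. f t * ?\<eta> t \<partial>?L) - f a = (\<integral>t. f t * ?\<eta> t \<partial>?L) - (\<integral>t. f a * ?\<eta> t \<partial>?L)"
      using one by simp
    also have "\<dots> = (\<integral>t. f t * ?\<eta> t - f a * ?\<eta> t \<partial>?L)"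
      using int int\<eta> by (intro Bochner_Integration.integral_diff[symmetric]) auto
    finally have "norm ((\<integral>t. f t * ?\<eta> t \<partial>?L) - f a) = norm (\<integral>t. f t * ?\<eta> t - f a * ?\<eta> t \<partial>?L)"
      by simp
    also have "\<dots> \<le> (\<integral>t. norm (f t * ?\<eta> t - f a * ?\<eta> t) \<partial>?L)"
      by (rule integral_norm_bound)
    also have "\<dots> \<le> (\<integral>t. e / 2 * ?\<eta> t \<partial>?L)"
    proof (rule integral_mono)
      show "integrable ?L (\<lambda>t. norm (f t * ?\<eta> t - f a * ?\<eta> t))"
        using int int\<eta> by auto
      show "integrable ?L (\<lambda>t. e / 2 * ?\<eta> t)"
        using int\<eta> by auto
      fix t assume "t \<in> space ?L"
      then have t: "t \<in> {0..T}" by simp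
      have \<eta>0: "?\<eta> t \<ge> 0"
        using smooth_step_bounds(3) by simp
      have "\<bar>f t - f a\<bar> * ?\<eta> t \<le> e / 2 * ?\<eta> t"
      proof (cases "\<bar>t - a\<bar> < d")
        case True
        then have "\<bar>f t - f a\<bar> \<le> e / 2"
          using d(2)[OF t] by (simp add: dist_real_def)
        then show ?thesis
          using \<eta>0 by (rule mult_right_mono)
      next
        case False
        have "?n * (t - a) \<le> 0 \<or> ?n * (t - a) \<ge> 1"
        proof (cases "t \<le> a")
          case True
          then show ?thesis by (simp add: mult_nonneg_nonpos)
        next
          case ta: False
          with False n have "1 / ?n \<le> t - a" by linarith
          then show ?thesis by (simp add: field_simps)
        qed
        then have "?\<eta> t = 0"
          using smooth_step_simps(3,4) by auto
        then show ?thesis by simp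
      qed
      moreover have "norm (f t * ?\<eta> t - f a * ?\<eta> t) = \<bar>f t - f a\<bar> * ?\<eta> t"
        using abs_mult[of "f t - f a" "?\<eta> t"] abs_of_nonneg[OF \<eta>0]
        by (simp only: left_diff_distrib[symmetric] real_norm_def)
      ultimately show "norm (f t * ?\<eta> t - f a * ?\<eta> t) \<le> e / 2 * ?\<eta> t"
        by simp
    qed
    also have "\<dots> = e / 2"
      using one by simp
    also have "\<dots> < e"
      using \<open>e > 0\<close> by simp
    finally show ?thesis .
  qed
  then show "\<exists>K. \<forall>k\<ge>K. norm ((\<integral>t. f t * (real (Suc k) * smooth_step_deriv (real (Suc k) * (t - a))) \<partial>?L) - f a) < e"
    by blast
qed

lemma smooth_step_scaled_LIMSEQ:
  "(\<lambda>k. smooth_step (real (Suc k) * x)) \<longlonglongrightarrow> indicator {0<..} x"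
proof (cases "x \<le> 0")
  case True
  then have "smooth_step (real (Suc k) * x) = 0" for k
    by (intro smooth_step_simps) (simp add: mult_nonneg_nonpos)
  then show ?thesis
    using True by simp
next
  case False
  then have x: "x > 0" by simp
  obtain K :: nat where K: "1 / real (Suc K) < x"
    using x by (metis nat_approx_posE)
  have "smooth_step (real (Suc k) * x) = 1" if "k \<ge> K" for k
  proof (rule smooth_step_simps)
    have "1 / real (Suc k) \<le> 1 / real (Suc K)"
      using that by (simp add: field_simps)
    with K have "1 / real (Suc k) \<le> x" by linarith
    then show "1 \<le> real (Suc k) * x"
      by (simp add: field_simps)
  qed
  then have "\<forall>\<^sub>F k in sequentially. smooth_step (real (Suc k) * x) = 1"
    by (auto simp: eventually_sequentially)
  then show ?thesis
    using x by (simp add: tendsto_eventually)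
qed

text \<open>The scalar content of \<open>has_time_derivative\<close> for one fixed test function v,
  with f for the inner product and g for the duality pairing.\<close>

definition weak_time_derivative :: "real \<Rightarrow> (real \<Rightarrow> real) \<Rightarrow> (real \<Rightarrow> real) \<Rightarrow> bool" where
  "weak_time_derivative T f g \<longleftrightarrow>
    (\<forall>\<phi> d\<phi> K. (\<forall>t. (\<phi> has_real_derivative d\<phi> t) (at t)) \<and> continuous_on UNIV d\<phi> \<and>
       compact K \<and> K \<subseteq> {0<..<T} \<and> (\<forall>t. t \<notin> K \<longrightarrow> \<phi> t = 0) \<longrightarrow>
       (\<integral>t. g t * \<phi> t \<partial>lebesgue_on {0<..<T}) = - (\<integral>t. f t * d\<phi> t \<partial>lebesgue_on {0<..<T}))"

text \<open>Test with the difference of a step rising just after s and one rising just after t. The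
  derivatives concentrate at s and t on one side of the weak identity, while the functions tend to
  an indicator on the other. Interior s and t keep the supports compact in (0,T).\<close>

lemma weak_time_derivative_FTC_interior:
  fixes f g :: "real \<Rightarrow> real"
  assumes f: "continuous_on {0..T} f" and g: "integrable (lebesgue_on {0<..<T}) g"
    and weak: "weak_time_derivative T f g"
    and st: "0 < s" "s < t" "t < T"
  shows "f t - f s = (\<integral>r. indicator {s<..<t} r * g r \<partial>lebesgue_on {0<..<T})"
proof -
  let ?L = "lebesgue_on {0<..<T}"
  let ?\<phi> = "\<lambda>k r. smooth_step (real (Suc k) * (r - s)) - smooth_step (real (Suc k) * (r - t))"
  let ?\<eta> = "\<lambda>a k r. real (Suc k) * smooth_step_deriv (real (Suc k) * (r - a))"
  have [measurable]: "smooth_step \<in> borel_measurable borel"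
    by (intro borel_measurable_continuous_onI continuous_on_smooth_step)
  have [measurable]: "(\<lambda>x. x) \<in> borel_measurable ?L"
    using id_borel_measurable_lebesgue_on[of "{0<..<T}"] by (simp add: id_def)
  have cont\<eta>: "continuous_on S (?\<eta> a k)" for a k S
    by (intro continuous_intros continuous_on_compose2[OF continuous_on_smooth_step_deriv[of UNIV]]) auto
  have \<eta>int: "integrable ?L (\<lambda>r. f r * ?\<eta> a k r)" for a k
    by (intro time_integral_continuous(1) continuous_on_mult f cont\<eta>)
  \<comment> \<open>The second step reaches 1 at t + 1/(k+1), which has to happen before T for the
    difference to have compact support.\<close>
  obtain K :: nat where K: "1 / real (Suc K) < T - t"
    using st by (metis diff_gt_0_iff_gt nat_approx_posE)
  have eq: "(\<integral>r. g r * ?\<phi> k r \<partial>?L) =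
      (\<integral>r. f r * ?\<eta> t k r \<partial>?L) - (\<integral>r. f r * ?\<eta> s k r \<partial>?L)" if "k \<ge> K" for k
  proof -
    let ?n = "real (Suc k)"
    have "1 / ?n \<le> 1 / real (Suc K)"
      using that by (simp add: field_simps)
    with K have n: "t + 1 / ?n < T"
      by linarith
    have D: "((?\<phi> k) has_real_derivative ?\<eta> s k r - ?\<eta> t k r) (at r)" for r
    proof (rule DERIV_diff)
      have "((\<lambda>r. smooth_step (?n * (r - a))) has_real_derivative smooth_step_deriv (?n * (r - a)) * ?n) (at r)" for a
        by (rule DERIV_chain2[OF DERIV_smooth_step]) (auto intro!: derivative_eq_intros)
      then show "((\<lambda>r. smooth_step (?n * (r - s))) has_real_derivative ?\<eta> s k r) (at r)"
        "((\<lambda>r. smooth_step (?n * (r - t))) has_real_derivative ?\<eta> t k r) (at r)"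
        by (simp_all only: mult.commute)
    qed
    have vanish: "?\<phi> k r = 0" if "r \<notin> {s..t + 1 / ?n}" for r
    proof (cases "r < s")
      case True
      then have "?n * (r - s) \<le> 0" "?n * (r - t) \<le> 0"
        using st by (auto intro!: mult_nonneg_nonpos)
      then show ?thesis by (simp only: smooth_step_simps)
    next
      case False
      with that have "1 / ?n \<le> r - t" by auto
      then have *: "1 \<le> ?n * (r - t)" by (simp add: field_simps)
      also have "\<dots> \<le> ?n * (r - s)"
        using st by (intro mult_left_mono) auto
      finally show ?thesis using * by (simp only: smooth_step_simps)
    qed
    have "(\<integral>r. g r * ?\<phi> k r \<partial>?L) = - (\<integral>r. f r * (?\<eta> s k r - ?\<eta> t k r) \<partial>?L)"
    proof (rule weak[unfolded weak_time_derivative_def, rule_format, of "?\<phi> k" "\<lambda>r. ?\<eta> s k r - ?\<eta> t k r" "{s..t + 1 / ?n}"],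
        intro conjI allI impI)
      show "{s..t + 1 / ?n} \<subseteq> {0<..<T}"
        using st(1) n by (auto simp del: of_nat_Suc)
    qed (fact D continuous_on_diff[OF cont\<eta> cont\<eta>] compact_Icc vanish)+
    also have "(\<lambda>r. f r * (?\<eta> s k r - ?\<eta> t k r)) = (\<lambda>r. f r * ?\<eta> s k r - f r * ?\<eta> t k r)"
      by (simp only: right_diff_distrib)
    also have "- (\<integral>r. f r * ?\<eta> s k r - f r * ?\<eta> t k r \<partial>?L) =
        (\<integral>r. f r * ?\<eta> t k r \<partial>?L) - (\<integral>r. f r * ?\<eta> s k r \<partial>?L)"
      by (simp only: Bochner_Integration.integral_diff[OF \<eta>int \<eta>int] minus_diff_eq)
    finally show ?thesis .
  qed
  have "(\<lambda>k. (\<integral>r. f r * ?\<eta> t k r \<partial>?L) - (\<integral>r. f r * ?\<eta> s k r \<partial>?L)) \<longlonglongrightarrow> f t - f s"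
    using st by (intro tendsto_diff smooth_step_approximate_identity[OF f]) auto
  moreover have "\<forall>\<^sub>F k in sequentially. (\<integral>r. f r * ?\<eta> t k r \<partial>?L) - (\<integral>r. f r * ?\<eta> s k r \<partial>?L) =
      (\<integral>r. g r * ?\<phi> k r \<partial>?L)"
    using eventually_ge_at_top[of K] by eventually_elim (simp only: eq)
  ultimately have "(\<lambda>k. \<integral>r. g r * ?\<phi> k r \<partial>?L) \<longlonglongrightarrow> f t - f s"
    by (rule Lim_transform_eventually)
  moreover have "(\<lambda>k. \<integral>r. g r * ?\<phi> k r \<partial>?L) \<longlonglongrightarrow>
      (\<integral>r. g r * (indicator {0<..} (r - s) - indicator {0<..} (r - t)) \<partial>?L)"
  proof (rule integral_dominated_convergence[where w="\<lambda>r. \<bar>g r\<bar>"])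
    note [measurable] = borel_measurable_integrable[OF g]
    show "(\<lambda>r. g r * (indicator {0<..} (r - s) - indicator {0<..} (r - t))) \<in> borel_measurable ?L"
      by measurable
    show "(\<lambda>r. g r * ?\<phi> k r) \<in> borel_measurable ?L" for k
      by measurable
    show "integrable ?L (\<lambda>r. \<bar>g r\<bar>)"
      using g by simp
    show "AE r in ?L. (\<lambda>k. g r * ?\<phi> k r) \<longlonglongrightarrow> g r * (indicator {0<..} (r - s) - indicator {0<..} (r - t))"
      by (intro AE_I2 tendsto_intros smooth_step_scaled_LIMSEQ)
    show "AE r in ?L. norm (g r * ?\<phi> k r) \<le> \<bar>g r\<bar>" for k
    proof (rule AE_I2)
      fix r
      have "\<bar>?\<phi> k r\<bar> \<le> 1"
        using smooth_step_bounds[of "real (Suc k) * (r - s)"] smooth_step_bounds[of "real (Suc k) * (r - t)"]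
        by linarith
      then show "norm (g r * ?\<phi> k r) \<le> \<bar>g r\<bar>"
        by (simp only: real_norm_def abs_mult mult_left_le[OF _ abs_ge_zero])
    qed
  qed
  ultimately have "f t - f s = (\<integral>r. g r * (indicator {0<..} (r - s) - indicator {0<..} (r - t)) \<partial>?L)"
    by (rule LIMSEQ_unique)
  also have "\<dots> = (\<integral>r. indicator {s<..<t} r * g r \<partial>?L)"
  proof (rule integral_cong_AE)
    note [measurable] = borel_measurable_integrable[OF g]
    show "(\<lambda>r. g r * (indicator {0<..} (r - s) - indicator {0<..} (r - t))) \<in> borel_measurable ?L"
      "(\<lambda>r. indicator {s<..<t} r * g r) \<in> borel_measurable ?L"
      by measurable
    \<comment> \<open>The steps converge to the indicator of the half-open interval containing t, so
      the integrands differ at most at t.\<close>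
    have "{t} \<in> null_sets ?L"
      using st by (auto simp: null_sets_restrict_space)
    then have "AE r in ?L. r \<noteq> t"
      by (rule AE_I'[of "{t}"]) auto
    then show "AE r in ?L. g r * (indicator {0<..} (r - s) - indicator {0<..} (r - t)) = indicator {s<..<t} r * g r"
      by eventually_elim (use st in \<open>auto simp: indicator_def\<close>)
  qed
  finally show ?thesis .
qed

text \<open>Continuity of f on the closed interval lets s and t move to the endpoints. The endpoint
  cases serve averaging windows that are cut off at 0 or T.\<close>

lemma weak_time_derivative_FTC:
  fixes f g :: "real \<Rightarrow> real"
  assumes f: "continuous_on {0..T} f" and g: "integrable (lebesgue_on {0<..<T}) g"
    and weak: "weak_time_derivative T f g"
    and st: "0 \<le> s" "s < t" "t \<le> T"
  shows "f t - f s = (\<integral>r. indicator {s<..<t} r * g r \<partial>lebesgue_on {0<..<T})"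
proof -
  let ?L = "lebesgue_on {0<..<T}"
  \<comment> \<open>With k + 3 the shift is at most a third of t - s, so the shrunken interval is
    nonempty for every k.\<close>
  define d where "d k = (t - s) / real (k + 3)" for k :: nat
  have d: "0 < d k" "s + d k < t - d k" for k
  proof -
    show "0 < d k" using st by (simp add: d_def)
    have "d k * 3 \<le> d k * real (k + 3)"
      using \<open>0 < d k\<close> by (intro mult_left_mono) auto
    also have "\<dots> = t - s" by (simp add: d_def)
    finally show "s + d k < t - d k" using \<open>0 < d k\<close> by linarith
  qed
  have d0: "d \<longlonglongrightarrow> 0"
  proof -
    have "(\<lambda>k. (t - s) / real k) \<longlonglongrightarrow> 0"
      by (rule lim_const_over_n)
    from LIMSEQ_ignore_initial_segment[OF this, of 3] show ?thesis
      by (simp only: d_def[abs_def])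
  qed
  have lims: "(\<lambda>k. s + d k) \<longlonglongrightarrow> s" "(\<lambda>k. t - d k) \<longlonglongrightarrow> t"
    using tendsto_add[OF tendsto_const d0, of s] tendsto_diff[OF tendsto_const d0, of t] by simp_all
  have mem: "s + d k \<in> {0..T}" "t - d k \<in> {0..T}" for k
    using d[of k] st by auto
  have "(\<lambda>k. f (t - d k) - f (s + d k)) \<longlonglongrightarrow> f t - f s"
    by (intro tendsto_diff continuous_on_tendsto_compose[OF f] lims) (use mem st in auto)
  moreover have "f (t - d k) - f (s + d k) = (\<integral>r. indicator {s + d k<..<t - d k} r * g r \<partial>?L)" for k
    by (rule weak_time_derivative_FTC_interior[OF f g weak]) (use d[of k] st in auto)
  ultimately have "(\<lambda>k. \<integral>r. indicator {s + d k<..<t - d k} r * g r \<partial>?L) \<longlonglongrightarrow> f t - f s"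
    by simp
  moreover have "(\<lambda>k. \<integral>r. indicator {s + d k<..<t - d k} r * g r \<partial>?L) \<longlonglongrightarrow>
      (\<integral>r. indicator {s<..<t} r * g r \<partial>?L)"
  proof (rule integral_dominated_convergence[where w="\<lambda>r. \<bar>g r\<bar>"])
    note [measurable] = borel_measurable_integrable[OF g]
    have [measurable]: "(\<lambda>x. x) \<in> borel_measurable ?L"
      using id_borel_measurable_lebesgue_on[of "{0<..<T}"] by (simp add: id_def)
    show "(\<lambda>r. indicator {s<..<t} r * g r) \<in> borel_measurable ?L"
      "(\<lambda>r. indicator {s + d k<..<t - d k} r * g r) \<in> borel_measurable ?L" for k
      by measurable
    show "integrable ?L (\<lambda>r. \<bar>g r\<bar>)"
      using g by simp
    show "AE r in ?L. (\<lambda>k. indicator {s + d k<..<t - d k} r * g r) \<longlonglongrightarrow> indicator {s<..<t} r * g r"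
    proof (rule AE_I2, cases)
      fix r assume r: "s < r \<and> r < t"
      have "\<forall>\<^sub>F k in sequentially. s + d k < r" "\<forall>\<^sub>F k in sequentially. r < t - d k"
        using order_tendstoD(2)[OF lims(1)] order_tendstoD(1)[OF lims(2)] r by auto
      then have "\<forall>\<^sub>F k in sequentially. indicator {s + d k<..<t - d k} r * g r = indicator {s<..<t} r * g r"
        by eventually_elim (use r in \<open>simp add: indicator_def\<close>)
      then show "(\<lambda>k. indicator {s + d k<..<t - d k} r * g r) \<longlonglongrightarrow> indicator {s<..<t} r * g r"
        by (rule tendsto_eventually)
    next
      fix r assume r: "\<not> (s < r \<and> r < t)"
      have eq: "indicator {s + d k<..<t - d k} r * g r = indicator {s<..<t} r * g r" for k
        using r d(1)[of k] by (auto simp: indicator_def)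
      show "(\<lambda>k. indicator {s + d k<..<t - d k} r * g r) \<longlonglongrightarrow> indicator {s<..<t} r * g r"
        unfolding eq by (rule tendsto_const)
    qed
    show "AE r in ?L. norm (indicator {s + d k<..<t - d k} r * g r) \<le> \<bar>g r\<bar>" for k
      by (intro AE_I2) (auto simp: indicator_def)
  qed
  ultimately show ?thesis
    by (rule LIMSEQ_unique)
qed

section \<open>One-sided averages in time\<close>

text \<open>The Boolean selects the side: \<open>True\<close> looks back from r,
  \<open>False\<close> looks ahead. Both occur, the first for the derivative of the state difference
  and the second for that of the adjoint state.\<close>

definition time_window :: "bool \<Rightarrow> real \<Rightarrow> real \<Rightarrow> real set" where
  "time_window b h r = (if b then {r - h<..<r} else {r<..<r + h})"

text \<open>Near the ends of (0,T) the window is truncated but the divisor remains h. Without this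
  renormalization, averaging never increases the L^1 norm.\<close>

definition time_avg :: "real \<Rightarrow> bool \<Rightarrow> real \<Rightarrow> (real \<Rightarrow> real) \<Rightarrow> real \<Rightarrow> real" where
  "time_avg T b h f r = (\<integral>t. indicator (time_window b h r) t / h * f t \<partial>lebesgue_on {0<..<T})"

text \<open>Exchanging the two times reverses the side, so under Fubini's theorem backward averages
  become weights given by forward windows, and conversely.\<close>

lemma time_window_swap: "t \<in> time_window b h r \<longleftrightarrow> r \<in> time_window (\<not> b) h t"
  by (auto simp: time_window_def)

lemma time_ident_measurable: "(\<lambda>x. x) \<in> borel_measurable (lebesgue_on {0<..<T::real})"
  using id_borel_measurable_lebesgue_on[of "{0<..<T}"] by (simp add: id_def)

lemma time_window_measurable [measurable]:
  "(\<lambda>t. indicator (time_window b h r) t :: real) \<in> borel_measurable (lebesgue_on {0<..<T})"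
proof -
  note [measurable] = time_ident_measurable[of T]
  show ?thesis unfolding time_window_def by (cases b) (simp_all, measurable)
qed

lemma time_kernel_integrable:
  assumes "integrable (lebesgue_on {0<..<T}) f"
  shows "integrable (lebesgue_on {0<..<T}) (\<lambda>t. indicator (time_window b h r) t / h * f t)"
proof (rule integrable_of_abs_le)
  show "integrable (lebesgue_on {0<..<T}) (\<lambda>t. \<bar>1 / h\<bar> * \<bar>f t\<bar>)"
    using assms by auto
  note [measurable] = borel_measurable_integrable[OF assms]
  show "(\<lambda>t. indicator (time_window b h r) t / h * f t) \<in> borel_measurable (lebesgue_on {0<..<T})"
    by measurable
  show "AE t in lebesgue_on {0<..<T}. \<bar>indicator (time_window b h r) t / h * f t\<bar> \<le> \<bar>1 / h\<bar> * \<bar>f t\<bar>"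
    by (intro AE_I2) (auto simp: indicator_def abs_mult)
qed

lemma time_kernel_integral_le_1:
  assumes h: "h > 0"
  shows "(\<integral>t. indicator (time_window b h r) t / h \<partial>lebesgue_on {0<..<T}) \<le> 1"
proof -
  let ?W = "time_window b h r"
  have W: "?W \<in> lmeasurable" "measure lebesgue ?W = h"
    using h by (auto simp: time_window_def)
  have "(\<integral>t. indicator ?W t / h \<partial>lebesgue_on {0<..<T}) =
      (\<integral>t. indicator ?W t \<partial>lebesgue_on {0<..<T}) / h"
    by simp
  also have "(\<integral>t. indicator ?W t \<partial>lebesgue_on {0<..<T}) = measure (lebesgue_on {0<..<T}) (?W \<inter> {0<..<T})"
    by simp
  also have "\<dots> = measure lebesgue (?W \<inter> {0<..<T})"
    by (intro measure_restrict_space) auto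
  also have "\<dots> \<le> measure lebesgue ?W"
    using W by (intro measure_mono_fmeasurable) auto
  finally show ?thesis
    using W h by (simp add: divide_le_eq)
qed

lemma time_kernel_integral_nonneg:
  "h > 0 \<Longrightarrow> 0 \<le> (\<integral>t. indicator (time_window b h r) t / h \<partial>lebesgue_on {0<..<T})"
  by (intro integral_nonneg_AE AE_I2) (simp add: indicator_def)

text \<open>The hypothesis of Fubini's theorem for averages. Integrating out r first leaves f(t)
  times the mass of a reversed window, which is at most one.\<close>

lemma time_kernel_pair_integrable:
  fixes f :: "real \<Rightarrow> real"
  assumes f: "integrable (lebesgue_on {0<..<T}) f" and h: "h > 0"
  shows "integrable (lebesgue_on {0<..<T} \<Otimes>\<^sub>M lebesgue_on {0<..<T})
    (\<lambda>(t, r). indicator (time_window b h r) t / h * f t)"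
proof -
  let ?L = "lebesgue_on {0<..<T}"
  interpret finite_measure ?L by (rule finite_measure_time)
  interpret P: pair_sigma_finite ?L ?L ..
  note [measurable] = borel_measurable_integrable[OF f] time_ident_measurable[of T]
  have swap: "indicator (time_window b h r) t = (indicator (time_window (\<not> b) h t) r :: real)" for r t
    using time_window_swap[of t b h r] by (simp add: indicator_def)
  have one: "integrable ?L (\<lambda>r. indicator (time_window (\<not> b) h t) r / h)" for t
    using time_kernel_integrable[of T "\<lambda>_. 1" "\<not> b" h t] by simp
  show ?thesis
  proof (rule P.Fubini_integrable)
    \<comment> \<open>Written through r - t or t - r, the kernel is a measurable function of the
      pair.\<close>
    have "(\<lambda>(t, r). (if b then indicator {0<..<h} (r - t) else indicator {0<..<h} (t - r)) / h * f t)
        \<in> borel_measurable (?L \<Otimes>\<^sub>M ?L)"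
      by measurable
    also have "(\<lambda>(t, r). (if b then indicator {0<..<h} (r - t) else indicator {0<..<h} (t - r)) / h * f t) =
        (\<lambda>(t, r). indicator (time_window b h r) t / h * f t)"
      by (auto simp: time_window_def indicator_def fun_eq_iff)
    finally show "(\<lambda>(t, r). indicator (time_window b h r) t / h * f t) \<in> borel_measurable (?L \<Otimes>\<^sub>M ?L)" .
    have eq: "(\<integral>r. norm (case (t, r) of (t, r) \<Rightarrow> indicator (time_window b h r) t / h * f t) \<partial>?L) =
        (\<integral>r. indicator (time_window (\<not> b) h t) r / h \<partial>?L) * \<bar>f t\<bar>" for t
    proof -
      have "(\<integral>r. norm (case (t, r) of (t, r) \<Rightarrow> indicator (time_window b h r) t / h * f t) \<partial>?L) =
          (\<integral>r. indicator (time_window (\<not> b) h t) r / h * \<bar>f t\<bar> \<partial>?L)"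
        using h by (intro Bochner_Integration.integral_cong) (auto simp: swap abs_mult)
      then show ?thesis by simp
    qed
    show "integrable ?L (\<lambda>t. \<integral>r. norm (case (t, r) of (t, r) \<Rightarrow> indicator (time_window b h r) t / h * f t) \<partial>?L)"
      unfolding eq
    proof (rule integrable_of_abs_le)
      show "integrable ?L (\<lambda>t. \<bar>f t\<bar>)" using f by simp
      have "(\<lambda>t. \<integral>r. (if b then indicator {0<..<h} (r - t) else indicator {0<..<h} (t - r)) / h \<partial>?L) \<in> borel_measurable ?L"
        by measurable
      have *: "(\<integral>r. indicator (time_window (\<not> b) h t) r / h \<partial>?L) =
          (\<integral>r. (if b then indicator {0<..<h} (r - t) else indicator {0<..<h} (t - r)) / h \<partial>?L)" for t
        by (intro Bochner_Integration.integral_cong) (auto simp: time_window_def indicator_def)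
      show "(\<lambda>t. (\<integral>r. indicator (time_window (\<not> b) h t) r / h \<partial>?L) * \<bar>f t\<bar>) \<in> borel_measurable ?L"
        unfolding * by (intro borel_measurable_times borel_measurable_abs borel_measurable_integrable[OF f]) fact
      show "AE t in ?L. \<bar>(\<integral>r. indicator (time_window (\<not> b) h t) r / h \<partial>?L) * \<bar>f t\<bar>\<bar> \<le> \<bar>f t\<bar>"
      proof (rule AE_I2)
        fix t
        let ?c = "\<integral>r. indicator (time_window (\<not> b) h t) r / h \<partial>?L"
        have "?c * \<bar>f t\<bar> \<le> 1 * \<bar>f t\<bar>"
          by (rule mult_right_mono[OF time_kernel_integral_le_1[OF h]]) simp
        moreover have "0 \<le> ?c"
          by (rule time_kernel_integral_nonneg[OF h])
        ultimately show "\<bar>?c * \<bar>f t\<bar>\<bar> \<le> \<bar>f t\<bar>"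
          by (simp only: abs_of_nonneg[OF mult_nonneg_nonneg[OF _ abs_ge_zero]] mult_1)
      qed
    qed
    show "AE t in ?L. integrable ?L (\<lambda>r. case (t, r) of (t, r) \<Rightarrow> indicator (time_window b h r) t / h * f t)"
    proof (rule AE_I2)
      fix t
      have "integrable ?L (\<lambda>r. indicator (time_window (\<not> b) h t) r / h * f t)"
        by (rule integrable_mult_left[OF one])
      then show "integrable ?L (\<lambda>r. case (t, r) of (t, r) \<Rightarrow> indicator (time_window b h r) t / h * f t)"
        by (simp add: swap)
    qed
  qed
qed

lemma time_avg_integrable:
  assumes f: "integrable (lebesgue_on {0<..<T}) f" and h: "h > 0"
  shows "integrable (lebesgue_on {0<..<T}) (time_avg T b h f)"
proof -
  interpret finite_measure "lebesgue_on {0<..<T}" by (rule finite_measure_time)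
  interpret P: pair_sigma_finite "lebesgue_on {0<..<T}" "lebesgue_on {0<..<T}" ..
  show ?thesis
    unfolding time_avg_def[abs_def] by (rule P.integrable_snd[OF time_kernel_pair_integrable[OF f h]])
qed

text \<open>By Fubini's theorem each f(t) is weighted with the mass that a reversed window has
  inside (0,T), hence with at most one.\<close>

lemma time_avg_integral_le:
  assumes f: "integrable (lebesgue_on {0<..<T}) f" and h: "h > 0"
    and nonneg: "\<And>t. 0 \<le> f t"
  shows "(\<integral>r. time_avg T b h f r \<partial>lebesgue_on {0<..<T}) \<le> (\<integral>t. f t \<partial>lebesgue_on {0<..<T})"
proof -
  let ?L = "lebesgue_on {0<..<T}"
  interpret finite_measure "lebesgue_on {0<..<T}" by (rule finite_measure_time)
  interpret P: pair_sigma_finite "lebesgue_on {0<..<T}" "lebesgue_on {0<..<T}" ..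
  note pair = time_kernel_pair_integrable[OF f h, of b]
  have swap: "indicator (time_window b h r) t = (indicator (time_window (\<not> b) h t) r :: real)" for r t
    using time_window_swap[of t b h r] by (simp add: indicator_def)
  have "(\<integral>r. time_avg T b h f r \<partial>?L) = (\<integral>t. (\<integral>r. indicator (time_window b h r) t / h * f t \<partial>?L) \<partial>?L)"
    unfolding time_avg_def by (rule P.Fubini_integral[OF pair])
  also have "\<dots> \<le> (\<integral>t. f t \<partial>?L)"
  proof (rule integral_mono)
    show "integrable ?L (\<lambda>t. \<integral>r. indicator (time_window b h r) t / h * f t \<partial>?L)"
      by (rule P.integrable_fst[OF pair])
    show "integrable ?L f" by (rule f)
    show "(\<integral>r. indicator (time_window b h r) t / h * f t \<partial>?L) \<le> f t" for t
    proof -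
      have "(\<integral>r. indicator (time_window b h r) t / h * f t \<partial>?L) =
          (\<integral>r. indicator (time_window (\<not> b) h t) r / h \<partial>?L) * f t"
        by (simp add: swap)
      also have "\<dots> \<le> 1 * f t"
        by (rule mult_right_mono[OF time_kernel_integral_le_1[OF h] nonneg])
      finally show ?thesis by simp
    qed
  qed
  finally show ?thesis .
qed

lemma time_avg_lin:
  assumes "integrable (lebesgue_on {0<..<T}) f" "integrable (lebesgue_on {0<..<T}) g"
  shows "time_avg T b h (\<lambda>t. c * f t + d * g t) r = c * time_avg T b h f r + d * time_avg T b h g r"
proof -
  let ?L = "lebesgue_on {0<..<T}" and ?k = "\<lambda>t. indicator (time_window b h r) t / h"
  have "(\<lambda>t. ?k t * (c * f t + d * g t)) = (\<lambda>t. c * (?k t * f t) + d * (?k t * g t))"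
    by (simp add: algebra_simps)
  moreover have "(\<integral>t. c * (?k t * f t) + d * (?k t * g t) \<partial>?L) =
      (\<integral>t. c * (?k t * f t) \<partial>?L) + (\<integral>t. d * (?k t * g t) \<partial>?L)"
    by (intro Bochner_Integration.integral_add integrable_mult_right time_kernel_integrable assms)
  ultimately show ?thesis
    unfolding time_avg_def by (simp only: integral_mult_right_zero)
qed

lemma time_avg_mono:
  assumes "integrable (lebesgue_on {0<..<T}) f" "integrable (lebesgue_on {0<..<T}) g" "h > 0"
    "AE t in lebesgue_on {0<..<T}. f t \<le> g t"
  shows "time_avg T b h f r \<le> time_avg T b h g r"
  unfolding time_avg_def
proof (rule integral_mono_AE[OF time_kernel_integrable[OF assms(1)] time_kernel_integrable[OF assms(2)]])
  show "AE t in lebesgue_on {0<..<T}. indicator (time_window b h r) t / h * f t \<le>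
      indicator (time_window b h r) t / h * g t"
    using assms(4) by eventually_elim (intro mult_left_mono, use assms(3) in \<open>simp_all add: indicator_def\<close>)
qed

lemma abs_time_avg_le:
  assumes f: "integrable (lebesgue_on {0<..<T}) f" and h: "h > 0"
  shows "\<bar>time_avg T b h f r\<bar> \<le> time_avg T b h (\<lambda>t. \<bar>f t\<bar>) r"
proof -
  have "time_avg T b h f r \<le> time_avg T b h (\<lambda>t. \<bar>f t\<bar>) r"
    using f h by (intro time_avg_mono) auto
  \<comment> \<open>The redundant zero term brings -f into the shape of
    \<open>time_avg_lin\<close>.\<close>
  moreover have "time_avg T b h (\<lambda>t. -1 * f t + 0 * f t) r \<le> time_avg T b h (\<lambda>t. \<bar>f t\<bar>) r"
    using f h by (intro time_avg_mono) auto
  ultimately show ?thesis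
    using time_avg_lin[OF f f, of b h "-1" 0 r] by linarith
qed

lemma time_avg_const_le:
  assumes "h > 0" "c \<ge> 0"
  shows "time_avg T b h (\<lambda>t. c) r \<le> c"
proof -
  have "time_avg T b h (\<lambda>t. c) r = (\<integral>t. indicator (time_window b h r) t / h \<partial>lebesgue_on {0<..<T}) * c"
    unfolding time_avg_def by simp
  also have "\<dots> \<le> 1 * c"
    by (rule mult_right_mono[OF time_kernel_integral_le_1[OF assms(1)] assms(2)])
  finally show ?thesis by simp
qed

text \<open>Convergence in L^1 takes the place of Lebesgue's pointwise differentiation theorem: it
  passes to limits by approximation, without a maximal inequality, and it suffices under an integral
  over r.\<close>

definition avg_converges :: "real \<Rightarrow> bool \<Rightarrow> (nat \<Rightarrow> real) \<Rightarrow> (real \<Rightarrow> real) \<Rightarrow> bool" where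
  "avg_converges T b h f \<longleftrightarrow>
     (\<lambda>n. \<integral>r. \<bar>time_avg T b (h n) f r - f r\<bar> \<partial>lebesgue_on {0<..<T}) \<longlonglongrightarrow> 0"

lemma avg_diff_integrable:
  assumes "integrable (lebesgue_on {0<..<T}) f" "h > 0"
  shows "integrable (lebesgue_on {0<..<T}) (\<lambda>r. \<bar>time_avg T b h f r - f r\<bar>)"
  using time_avg_integrable[OF assms, of b] assms(1) by (intro integrable_abs Bochner_Integration.integrable_diff)

text \<open>Averaging is an L^1 contraction, so exchanging f for g costs at most twice their
  distance, uniformly in n.\<close>

lemma avg_converges_approx:
  assumes f: "integrable (lebesgue_on {0<..<T}) f" and h: "\<And>n. h n > 0"
    and approx: "\<And>e. e > 0 \<Longrightarrow> \<exists>g. integrable (lebesgue_on {0<..<T}) g \<and> avg_converges T b h g \<and>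
      (\<integral>t. \<bar>f t - g t\<bar> \<partial>lebesgue_on {0<..<T}) < e"
  shows "avg_converges T b h f"
  unfolding avg_converges_def
proof (rule LIMSEQ_I)
  let ?L = "lebesgue_on {0<..<T}"
  fix e :: real assume "e > 0"
  then obtain g where g: "integrable ?L g" "avg_converges T b h g" "(\<integral>t. \<bar>f t - g t\<bar> \<partial>?L) < e / 3"
    using approx[of "e / 3"] by auto
  obtain K where K: "\<And>n. n \<ge> K \<Longrightarrow> norm ((\<integral>r. \<bar>time_avg T b (h n) g r - g r\<bar> \<partial>?L) - 0) < e / 3"
    using LIMSEQ_D[OF g(2)[unfolded avg_converges_def], of "e / 3"] \<open>e > 0\<close> by auto
  have "norm ((\<integral>r. \<bar>time_avg T b (h n) f r - f r\<bar> \<partial>?L) - 0) < e" if "n \<ge> K" for n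
  proof -
    let ?d = "\<lambda>t. \<bar>f t - g t\<bar>"
    have d: "integrable ?L ?d"
      using f g by auto
    have "(\<integral>r. \<bar>time_avg T b (h n) f r - f r\<bar> \<partial>?L) \<le>
        (\<integral>r. time_avg T b (h n) ?d r + \<bar>time_avg T b (h n) g r - g r\<bar> + ?d r \<partial>?L)"
    proof (rule integral_mono)
      show "integrable ?L (\<lambda>r. time_avg T b (h n) ?d r + \<bar>time_avg T b (h n) g r - g r\<bar> + ?d r)"
        by (intro Bochner_Integration.integrable_add time_avg_integrable d h avg_diff_integrable g)
      fix r
      have "time_avg T b (h n) f r - time_avg T b (h n) g r = time_avg T b (h n) (\<lambda>t. 1 * f t + -1 * g t) r"
        by (simp only: time_avg_lin[OF f g(1)])
      then have "\<bar>time_avg T b (h n) f r - time_avg T b (h n) g r\<bar> \<le> time_avg T b (h n) ?d r"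
        using abs_time_avg_le[of T "\<lambda>t. 1 * f t + -1 * g t" "h n" b r] f g(1) h[of n] by simp
      then show "\<bar>time_avg T b (h n) f r - f r\<bar> \<le>
          time_avg T b (h n) ?d r + \<bar>time_avg T b (h n) g r - g r\<bar> + ?d r"
        by linarith
    qed (intro avg_diff_integrable f h)
    also have "\<dots> = (\<integral>r. time_avg T b (h n) ?d r \<partial>?L) + (\<integral>r. \<bar>time_avg T b (h n) g r - g r\<bar> \<partial>?L) + (\<integral>r. ?d r \<partial>?L)"
      using time_avg_integrable[OF d h[of n], of b] avg_diff_integrable[OF g(1) h[of n], of b] d by simp
    also have "\<dots> < e / 3 + e / 3 + e / 3"
    proof (intro add_strict_mono)
      show "(\<integral>r. time_avg T b (h n) ?d r \<partial>?L) < e / 3"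
        using time_avg_integral_le[OF d h[of n], of b] g(3) by simp
      show "(\<integral>r. \<bar>time_avg T b (h n) g r - g r\<bar> \<partial>?L) < e / 3"
        using K[OF that] by simp
    qed (rule g(3))
    finally show ?thesis by simp
  qed
  then show "\<exists>K. \<forall>n\<ge>K. norm ((\<integral>r. \<bar>time_avg T b (h n) f r - f r\<bar> \<partial>?L) - 0) < e"
    by blast
qed

text \<open>Inside an open set the averages of its indicator are eventually \<open>1\<close>; since averaging does not
  increase the total mass, the mass that leaks out of the set tends to zero.\<close>

lemma avg_converges_indicator_open:
  assumes h: "\<And>n. h n > 0" "h \<longlonglongrightarrow> 0" and U: "open U" "U \<subseteq> {0<..<T}"
  shows "avg_converges T b h (indicator U)"
  unfolding avg_converges_def
proof -
  let ?L = "lebesgue_on {0<..<T}" and ?u = "indicator U :: real \<Rightarrow> real"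
  interpret finite_measure ?L by (rule finite_measure_time)
  have UL: "U \<in> sets ?L"
    using U by (auto simp: sets_restrict_space_iff)
  have int: "integrable ?L ?u"
    using UL by (intro integrable_real_indicator) (auto simp: less_top[symmetric] emeasure_finite)
  let ?a = "\<lambda>n. time_avg T b (h n) ?u"
  have a: "integrable ?L (?a n)" for n
    by (rule time_avg_integrable[OF int h(1)])
  have a01: "0 \<le> ?a n r" "?a n r \<le> 1" for n r
  proof -
    show "0 \<le> ?a n r"
      unfolding time_avg_def using h(1)[of n] by (intro integral_nonneg_AE AE_I2) (simp add: indicator_def)
    have "?a n r \<le> time_avg T b (h n) (\<lambda>t. 1) r"
      using int h by (intro time_avg_mono) (auto simp: indicator_def)
    also have "\<dots> \<le> 1"
      by (rule time_avg_const_le) (use h in auto)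
    finally show "?a n r \<le> 1" .
  qed
  have ev: "(\<lambda>n. ?u r * ?a n r) \<longlonglongrightarrow> ?u r" for r
  proof (cases "r \<in> U")
    case True
    obtain d where d: "d > 0" "ball r d \<subseteq> U"
      using U True by (meson openE)
    have "\<forall>\<^sub>F n in sequentially. h n < d"
      using h(2) d(1) by (rule order_tendstoD(2))
    then have "\<forall>\<^sub>F n in sequentially. ?u r * ?a n r = ?u r"
    proof eventually_elim
      case (elim n)
      have sub: "time_window b (h n) r \<subseteq> U"
      proof -
        have "time_window b (h n) r \<subseteq> ball r d"
          using elim by (auto simp: time_window_def dist_real_def split: if_splits)
        with d show ?thesis by blast
      qed
      have W: "time_window b (h n) r \<in> lmeasurable" "measure lebesgue (time_window b (h n) r) = h n"
        using h(1)[of n] by (auto simp: time_window_def)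
      have "?a n r = (\<integral>t. indicator (time_window b (h n) r) t / h n \<partial>?L)"
        unfolding time_avg_def using sub by (intro Bochner_Integration.integral_cong) (auto simp: indicator_def)
      also have "\<dots> = measure ?L (time_window b (h n) r \<inter> {0<..<T}) / h n"
        by simp
      also have "time_window b (h n) r \<inter> {0<..<T} = time_window b (h n) r"
        using sub U by auto
      also have "measure ?L (time_window b (h n) r) = h n"
        using sub U W by (subst measure_restrict_space) auto
      finally show ?case
        using h(1)[of n] by simp
    qed
    then show ?thesis
      by (rule tendsto_eventually)
  qed simp
  have prod: "integrable ?L (\<lambda>r. ?u r * ?a n r)" for n
    using integrable_mult_indicator[OF UL a] by simp
  have lim: "(\<lambda>n. \<integral>r. ?u r * ?a n r \<partial>?L) \<longlonglongrightarrow> (\<integral>r. ?u r \<partial>?L)"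
  proof (rule integral_dominated_convergence[where w="?u"])
    show "AE r in ?L. norm (?u r * ?a n r) \<le> ?u r" for n
      using a01 by (intro AE_I2) (auto simp: indicator_def)
  qed (use int prod ev in auto)
  have le: "norm (\<integral>r. \<bar>?a n r - ?u r\<bar> \<partial>?L) \<le> 2 * ((\<integral>r. ?u r \<partial>?L) - (\<integral>r. ?u r * ?a n r \<partial>?L))" for n
  proof -
    \<comment> \<open>For values in [0,1] the distance to an indicator is polynomial in the two.
      Since the average has no more mass than U, the total error is at most twice the mass missing
      inside U.\<close>
    have "(\<integral>r. \<bar>?a n r - ?u r\<bar> \<partial>?L) = (\<integral>r. ?u r + ?a n r - 2 * (?u r * ?a n r) \<partial>?L)"
      using a01 by (intro Bochner_Integration.integral_cong) (auto simp: indicator_def)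
    also have "\<dots> = (\<integral>r. ?u r \<partial>?L) + (\<integral>r. ?a n r \<partial>?L) - 2 * (\<integral>r. ?u r * ?a n r \<partial>?L)"
      using int a prod by simp
    finally have "(\<integral>r. \<bar>?a n r - ?u r\<bar> \<partial>?L) \<le> 2 * ((\<integral>r. ?u r \<partial>?L) - (\<integral>r. ?u r * ?a n r \<partial>?L))"
      using time_avg_integral_le[OF int h(1)[of n], of b] by simp
    moreover have "0 \<le> (\<integral>r. \<bar>?a n r - ?u r\<bar> \<partial>?L)"
      by (intro integral_nonneg_AE AE_I2) simp
    ultimately show ?thesis by simp
  qed
  have "(\<lambda>n. 2 * ((\<integral>r. ?u r \<partial>?L) - (\<integral>r. ?u r * ?a n r \<partial>?L))) \<longlonglongrightarrow> 2 * ((\<integral>r. ?u r \<partial>?L) - (\<integral>r. ?u r \<partial>?L))"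
    by (intro tendsto_intros lim)
  then have "(\<lambda>n. 2 * ((\<integral>r. ?u r \<partial>?L) - (\<integral>r. ?u r * ?a n r \<partial>?L))) \<longlonglongrightarrow> 0"
    by simp
  then show "(\<lambda>n. \<integral>r. \<bar>?a n r - ?u r\<bar> \<partial>?L) \<longlonglongrightarrow> 0"
    by (rule LIMSEQ_null_le[OF le])
qed

lemma avg_converges_lin:
  assumes f: "integrable (lebesgue_on {0<..<T}) f" and g: "integrable (lebesgue_on {0<..<T}) g"
    and h: "\<And>n. h n > 0" and cf: "avg_converges T b h f" and cg: "avg_converges T b h g"
  shows "avg_converges T b h (\<lambda>t. c * f t + d * g t)"
  unfolding avg_converges_def
proof (rule LIMSEQ_null_le)
  let ?L = "lebesgue_on {0<..<T}"
  let ?F = "\<lambda>n r. \<bar>time_avg T b (h n) f r - f r\<bar>" and ?G = "\<lambda>n r. \<bar>time_avg T b (h n) g r - g r\<bar>"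
  have F: "integrable ?L (?F n)" and G: "integrable ?L (?G n)" for n
    by (intro avg_diff_integrable f g h)+
  have "(\<lambda>n. \<bar>c\<bar> * (\<integral>r. ?F n r \<partial>?L) + \<bar>d\<bar> * (\<integral>r. ?G n r \<partial>?L)) \<longlonglongrightarrow> \<bar>c\<bar> * 0 + \<bar>d\<bar> * 0"
    using cf cg unfolding avg_converges_def by (intro tendsto_intros)
  then show "(\<lambda>n. \<bar>c\<bar> * (\<integral>r. ?F n r \<partial>?L) + \<bar>d\<bar> * (\<integral>r. ?G n r \<partial>?L)) \<longlonglongrightarrow> 0"
    by simp
  fix n
  let ?k = "\<lambda>t. c * f t + d * g t"
  have k: "integrable ?L ?k" using f g by auto
  have "norm (\<integral>r. \<bar>time_avg T b (h n) ?k r - ?k r\<bar> \<partial>?L) = (\<integral>r. \<bar>time_avg T b (h n) ?k r - ?k r\<bar> \<partial>?L)"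
    by (simp add: integral_nonneg_AE)
  also have "\<dots> \<le> (\<integral>r. \<bar>c\<bar> * ?F n r + \<bar>d\<bar> * ?G n r \<partial>?L)"
  proof (rule integral_mono)
    show "integrable ?L (\<lambda>r. \<bar>c\<bar> * ?F n r + \<bar>d\<bar> * ?G n r)"
      using F G by auto
    fix r
    have "time_avg T b (h n) ?k r - ?k r = c * (time_avg T b (h n) f r - f r) + d * (time_avg T b (h n) g r - g r)"
      by (simp only: time_avg_lin[OF f g]) (simp add: algebra_simps)
    also have "\<bar>\<dots>\<bar> \<le> \<bar>c\<bar> * ?F n r + \<bar>d\<bar> * ?G n r"
      by (rule order_trans[OF abs_triangle_ineq]) (simp only: abs_mult order_refl)
    finally show "\<bar>time_avg T b (h n) ?k r - ?k r\<bar> \<le> \<bar>c\<bar> * ?F n r + \<bar>d\<bar> * ?G n r" .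
  qed (intro avg_diff_integrable k h)
  also have "\<dots> = \<bar>c\<bar> * (\<integral>r. ?F n r \<partial>?L) + \<bar>d\<bar> * (\<integral>r. ?G n r \<partial>?L)"
    using F[of n] G[of n] by simp
  finally show "norm (\<integral>r. \<bar>time_avg T b (h n) ?k r - ?k r\<bar> \<partial>?L) \<le>
      \<bar>c\<bar> * (\<integral>r. ?F n r \<partial>?L) + \<bar>d\<bar> * (\<integral>r. ?G n r \<partial>?L)" .
qed

text \<open>Outer regularity of Lebesgue measure reduces measurable sets to open ones, intersected
  with (0,T).\<close>

lemma avg_converges_indicator:
  assumes h: "\<And>n. h n > 0" "h \<longlonglongrightarrow> 0" and A: "A \<in> sets (lebesgue_on {0<..<T})"
  shows "avg_converges T b h (indicator A)"
proof (rule avg_converges_approx)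
  let ?L = "lebesgue_on {0<..<T}"
  interpret finite_measure ?L by (rule finite_measure_time)
  have A': "A \<in> sets lebesgue" "A \<subseteq> {0<..<T}"
    using A by (auto simp: sets_restrict_space_iff)
  show "integrable ?L (indicator A :: real \<Rightarrow> real)"
    using A by (intro integrable_real_indicator) (auto simp: less_top[symmetric] emeasure_finite)
  show "h n > 0" for n by (rule h)
  fix e :: real assume "e > 0"
  obtain V where V: "open V" "A \<subseteq> V" "V - A \<in> lmeasurable" "emeasure lebesgue (V - A) < ennreal e"
    using sets_lebesgue_outer_open[OF A'(1) \<open>e > 0\<close>] by blast
  let ?U = "V \<inter> {0<..<T}"
  have U: "open ?U" "?U \<subseteq> {0<..<T}" "A \<subseteq> ?U"
    using V A' by auto
  have UL: "?U \<in> sets ?L"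
    using U by (auto simp: sets_restrict_space_iff)
  have "(\<integral>t. \<bar>indicator A t - indicator ?U t :: real\<bar> \<partial>?L) = (\<integral>t. indicator (?U - A) t \<partial>?L)"
    using U by (intro Bochner_Integration.integral_cong) (auto simp: indicator_def)
  also have "\<dots> = measure ?L (?U - A)"
    using sets.sets_into_space[OF A] UL by (simp add: Int_absorb2 Diff_subset subset_iff Int_Diff)
  also have "\<dots> = measure lebesgue (?U - A)"
    using U by (intro measure_restrict_space) auto
  also have "\<dots> \<le> measure lebesgue (V - A)"
    using V A'(1) by (intro measure_mono_fmeasurable) auto
  also have "\<dots> < e"
    using V(3,4) \<open>e > 0\<close> by (simp add: emeasure_eq_measure2 ennreal_less_iff)
  finally have "(\<integral>t. \<bar>indicator A t - indicator ?U t :: real\<bar> \<partial>?L) < e" .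
  moreover have "integrable ?L (indicator ?U :: real \<Rightarrow> real)"
    using UL by (intro integrable_real_indicator) (auto simp: less_top[symmetric] emeasure_finite)
  moreover have "avg_converges T b h (indicator ?U)"
    by (rule avg_converges_indicator_open[OF h U(1,2)])
  ultimately show "\<exists>g. integrable ?L g \<and> avg_converges T b h g \<and> (\<integral>t. \<bar>indicator A t - g t\<bar> \<partial>?L) < e"
    by blast
qed

text \<open>The L^1 form of Lebesgue's differentiation theorem for one-sided windows, built up from
  indicators through the induction principle for integrable functions.\<close>

theorem avg_converges:
  assumes f: "integrable (lebesgue_on {0<..<T}) f" and h: "\<And>n. h n > 0" "h \<longlonglongrightarrow> 0"
  shows "avg_converges T b h f"
  using f
proof (induction rule: integrable_induct)
  case (base A c)
  interpret finite_measure "lebesgue_on {0<..<T}" by (rule finite_measure_time)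
  have "integrable (lebesgue_on {0<..<T}) (indicator A :: real \<Rightarrow> real)"
    using base by (intro integrable_real_indicator)
  from avg_converges_lin[OF this this h(1) avg_converges_indicator[OF h base(1)] avg_converges_indicator[OF h base(1)], of b c 0]
  show ?case by (simp add: mult.commute)
next
  case (add f g)
  from avg_converges_lin[OF add.hyps h(1) add.IH, of 1 1] show ?case by simp
next
  case (lim f s)
  let ?L = "lebesgue_on {0<..<T}"
  show ?case
  proof (rule avg_converges_approx[OF lim.hyps(4) h(1)])
    fix e :: real assume "e > 0"
    have "(\<lambda>i. \<integral>t. \<bar>f t - s i t\<bar> \<partial>?L) \<longlonglongrightarrow> (\<integral>t. 0 \<partial>?L)"
    \<comment> \<open>The induction principle bounds \<open>s i\<close> by twice the absolute value
      of f, hence the 3 for the difference.\<close>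
    proof (rule integral_dominated_convergence[where w="\<lambda>t. 3 * \<bar>f t\<bar>"])
      show "AE t in ?L. (\<lambda>i. \<bar>f t - s i t\<bar>) \<longlonglongrightarrow> 0"
      proof (rule AE_I2)
        fix t assume "t \<in> space ?L"
        from tendsto_rabs[OF tendsto_diff[OF tendsto_const lim.hyps(2)[OF this], of "f t"]]
        show "(\<lambda>i. \<bar>f t - s i t\<bar>) \<longlonglongrightarrow> 0" by simp
      qed
      show "AE t in ?L. norm \<bar>f t - s i t\<bar> \<le> 3 * \<bar>f t\<bar>" for i
      proof (rule AE_I2)
        fix t assume "t \<in> space ?L"
        from lim.hyps(3)[OF this, of i] show "norm \<bar>f t - s i t\<bar> \<le> 3 * \<bar>f t\<bar>"
          by (simp only: real_norm_def)
      qed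
    qed (use lim.hyps(1,4) in auto)
    then have "\<forall>\<^sub>F i in sequentially. (\<integral>t. \<bar>f t - s i t\<bar> \<partial>?L) < e"
      by (rule order_tendstoD) (use \<open>e > 0\<close> in simp)
    then obtain i where "(\<integral>t. \<bar>f t - s i t\<bar> \<partial>?L) < e"
      by (auto simp: eventually_sequentially)
    with lim.hyps(1) lim.IH show "\<exists>g. integrable ?L g \<and> avg_converges T b h g \<and> (\<integral>t. \<bar>f t - g t\<bar> \<partial>?L) < e"
      by blast
  qed
qed

section \<open>The dual space\<close>

lemma dual_spaceD:
  assumes "l \<in> dual_space X N"
  shows "\<And>u v r s. u \<in> X \<Longrightarrow> v \<in> X \<Longrightarrow> l (\<lambda>x. r * u x + s * v x) = r * l u + s * l v"
    and "\<exists>C. \<forall>v\<in>X. \<bar>l v\<bar> \<le> C * N v"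
  using assms unfolding dual_space_def by blast+

lemma dual_space_diff:
  assumes "l \<in> dual_space X N" "u \<in> X" "v \<in> X"
  shows "l (\<lambda>x. u x - v x) = l u - l v"
  using dual_spaceD(1)[OF assms, of 1 "-1"] by simp

context seminormed
begin

lemma dual_norm_bdd:
  assumes l: "l \<in> dual_space X N"
  shows "bdd_above ((\<lambda>v. \<bar>l v\<bar>) ` {v\<in>X. N v \<le> 1})"
proof -
  obtain C where C: "\<forall>v\<in>X. \<bar>l v\<bar> \<le> C * N v"
    using dual_spaceD(2)[OF l] by blast
  have "\<bar>l v\<bar> \<le> \<bar>C\<bar>" if "v \<in> X" "N v \<le> 1" for v
  proof -
    have "\<bar>l v\<bar> \<le> C * N v" using C that by blast
    also have "\<dots> \<le> \<bar>C\<bar> * N v" using nonneg[OF that(1)] by (intro mult_right_mono) auto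
    also have "\<dots> \<le> \<bar>C\<bar> * 1" using that by (intro mult_left_mono) auto
    finally show ?thesis by simp
  qed
  then show ?thesis by (intro bdd_aboveI[where M="\<bar>C\<bar>"]) auto
qed

lemma dual_norm_upper:
  assumes "l \<in> dual_space X N" "v \<in> X" "N v \<le> 1"
  shows "\<bar>l v\<bar> \<le> dual_norm X N l"
  unfolding dual_norm_def by (rule cSUP_upper[OF _ dual_norm_bdd[OF assms(1)]]) (use assms in auto)

lemma dual_norm_least:
  assumes "\<And>v. v \<in> X \<Longrightarrow> N v \<le> 1 \<Longrightarrow> \<bar>l v\<bar> \<le> c"
  shows "dual_norm X N l \<le> c"
  unfolding dual_norm_def
proof (rule cSUP_least)
  have "(\<lambda>x. 0) \<in> {v \<in> X. N v \<le> 1}"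
    using zero_mem norm_zero by simp
  then show "{v \<in> X. N v \<le> 1} \<noteq> {}" by blast
qed (use assms in auto)

lemma dual_norm_nonneg:
  assumes "l \<in> dual_space X N"
  shows "0 \<le> dual_norm X N l"
  using dual_norm_upper[OF assms zero_mem] norm_zero by simp

lemma dual_bound:
  assumes l: "l \<in> dual_space X N" and v: "v \<in> X"
  shows "\<bar>l v\<bar> \<le> dual_norm X N l * N v"
proof (cases "N v = 0")
  \<comment> \<open>Here v cannot be normalized. The constant from membership in the dual space
    gives \<open>l v = 0\<close> instead.\<close>
  case True
  then show ?thesis
    using dual_spaceD(2)[OF l] v by fastforce
next
  case False
  then have pos: "N v > 0" using nonneg[OF v] by simp
  let ?w = "\<lambda>x. 1 / N v * v x"
  have "N ?w = 1"
    using scale[OF v, of "1 / N v"] pos by simp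
  then have "\<bar>l ?w\<bar> \<le> dual_norm X N l"
    by (intro dual_norm_upper[OF l] scale_mem v) simp
  moreover have "l ?w = 1 / N v * l v"
    using dual_spaceD(1)[OF l v v, of "1 / N v" 0] by simp
  then have "l v = N v * l ?w"
    using pos by simp
  then have "\<bar>l v\<bar> = N v * \<bar>l ?w\<bar>"
    by (simp only: abs_mult abs_of_pos[OF pos])
  ultimately show ?thesis
    using mult_left_mono[of "\<bar>l ?w\<bar>" "dual_norm X N l" "N v"] pos by (simp add: mult.commute)
qed

text \<open>With the dual as an instance of the same locale, linearity and approximation in Bochner
  spaces hold for L^2(0,T;V') as well.\<close>

lemma dual_seminormed: "seminormed (dual_space X N) (dual_norm X N)"
proof
  show "(\<lambda>x. 0) \<in> dual_space X N"
    unfolding dual_space_def by (auto intro!: exI[of _ 0])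
next
  fix l m r s
  assume l: "l \<in> dual_space X N" and m: "m \<in> dual_space X N"
  obtain C where C: "\<forall>v\<in>X. \<bar>l v\<bar> \<le> C * N v"
    using dual_spaceD(2)[OF l] by blast
  obtain C' where C': "\<forall>v\<in>X. \<bar>m v\<bar> \<le> C' * N v"
    using dual_spaceD(2)[OF m] by blast
  have "\<bar>r * l v + s * m v\<bar> \<le> (\<bar>r\<bar> * C + \<bar>s\<bar> * C') * N v" if "v \<in> X" for v
  proof -
    have "\<bar>r * l v + s * m v\<bar> \<le> \<bar>r\<bar> * \<bar>l v\<bar> + \<bar>s\<bar> * \<bar>m v\<bar>"
      by (rule order_trans[OF abs_triangle_ineq]) (simp only: abs_mult order_refl)
    also have "\<dots> \<le> \<bar>r\<bar> * (C * N v) + \<bar>s\<bar> * (C' * N v)"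
      using C C' that by (intro add_mono mult_left_mono) auto
    finally show ?thesis by (simp add: algebra_simps)
  qed
  then have bound: "\<exists>C. \<forall>v\<in>X. \<bar>r * l v + s * m v\<bar> \<le> C * N v" by blast
  have "r * l (\<lambda>x. a * u x + b * v x) + s * m (\<lambda>x. a * u x + b * v x) =
      a * (r * l u + s * m u) + b * (r * l v + s * m v)" if "u \<in> X" "v \<in> X" for u v a b
    unfolding dual_spaceD(1)[OF l that] dual_spaceD(1)[OF m that] by (simp add: algebra_simps)
  with bound show "(\<lambda>x. r * l x + s * m x) \<in> dual_space X N"
    unfolding dual_space_def by blast
next
  fix l assume l: "l \<in> dual_space X N"
  show "0 \<le> dual_norm X N l" by (rule dual_norm_nonneg[OF l])
next
  fix l m assume l: "l \<in> dual_space X N" and m: "m \<in> dual_space X N"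
  show "dual_norm X N (\<lambda>x. l x + m x) \<le> dual_norm X N l + dual_norm X N m"
  proof (rule dual_norm_least)
    fix v assume v: "v \<in> X" "N v \<le> 1"
    show "\<bar>l v + m v\<bar> \<le> dual_norm X N l + dual_norm X N m"
      using dual_norm_upper[OF l v] dual_norm_upper[OF m v] by linarith
  qed
next
  fix l r assume l: "l \<in> dual_space X N"
  have "dual_norm X N (\<lambda>x. r * l x) = (SUP v\<in>{v\<in>X. N v \<le> 1}. \<bar>r\<bar> * \<bar>l v\<bar>)"
    unfolding dual_norm_def by (simp only: abs_mult)
  also have "\<dots> = \<bar>r\<bar> * dual_norm X N l"
  proof (rule antisym)
    have ne: "{v \<in> X. N v \<le> 1} \<noteq> {}"
      using zero_mem norm_zero by (metis (mono_tags, lifting) empty_iff mem_Collect_eq zero_le_one)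
    show "(SUP v\<in>{v\<in>X. N v \<le> 1}. \<bar>r\<bar> * \<bar>l v\<bar>) \<le> \<bar>r\<bar> * dual_norm X N l"
      using dual_norm_upper[OF l] by (intro cSUP_least[OF ne] mult_left_mono) auto
    show "\<bar>r\<bar> * dual_norm X N l \<le> (SUP v\<in>{v\<in>X. N v \<le> 1}. \<bar>r\<bar> * \<bar>l v\<bar>)"
    proof (cases "r = 0")
      case True
      have "0 = (SUP v\<in>{v\<in>X. N v \<le> 1}. (0::real))"
        using ne by (rule cSUP_const[symmetric])
      with True show ?thesis by simp
    next
      case False
      have bdd: "bdd_above ((\<lambda>v. \<bar>r\<bar> * \<bar>l v\<bar>) ` {v\<in>X. N v \<le> 1})"
        using dual_norm_upper[OF l]
        by (intro bdd_aboveI[where M="\<bar>r\<bar> * dual_norm X N l"]) (auto intro!: mult_left_mono)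
      have "dual_norm X N l \<le> (SUP v\<in>{v\<in>X. N v \<le> 1}. \<bar>r\<bar> * \<bar>l v\<bar>) / \<bar>r\<bar>"
      proof (rule dual_norm_least)
        fix v assume v: "v \<in> X" "N v \<le> 1"
        then have "\<bar>r\<bar> * \<bar>l v\<bar> \<le> (SUP v\<in>{v\<in>X. N v \<le> 1}. \<bar>r\<bar> * \<bar>l v\<bar>)"
          by (intro cSUP_upper[OF _ bdd]) auto
        then show "\<bar>l v\<bar> \<le> (SUP v\<in>{v\<in>X. N v \<le> 1}. \<bar>r\<bar> * \<bar>l v\<bar>) / \<bar>r\<bar>"
          using False by (simp add: pos_le_divide_eq mult.commute)
      qed
      then show ?thesis
        using False by (simp add: pos_le_divide_eq mult.commute)
    qed
  qed
  finally show "dual_norm X N (\<lambda>x. r * l x) = \<bar>r\<bar> * dual_norm X N l" .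
qed

lemma duality_integrable:
  assumes D: "D \<in> bochner_l2 T (dual_space X N) (dual_norm X N)" and w: "w \<in> bochner_l2 T X N"
  shows "integrable (lebesgue_on {0<..<T}) (\<lambda>t. D t (w t))"
  by (rule bochner_l2_pairing_integrable[OF dual_seminormed seminormed_axioms D w, where \<beta>="\<lambda>l v. l v"])
    (auto intro: dual_space_diff dual_bound)

lemma duality_const_integrable:
  assumes D: "D \<in> bochner_l2 T (dual_space X N) (dual_norm X N)" and v: "v \<in> X"
  shows "integrable (lebesgue_on {0<..<T}) (\<lambda>t. D t v)"
  by (rule duality_integrable[OF D bochner_l2_const[OF seminormed_axioms v]])

text \<open>The argument is frozen at the outer time r. If it takes finitely many values, then on
  each fibre the claim is the convergence of averages of the scalar function obtained from D and one
  fixed v.\<close>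

lemma averaged_pairing_limit_simple:
  assumes D: "D \<in> bochner_l2 T (dual_space X N) (dual_norm X N)"
    and s: "simple_function (lebesgue_on {0<..<T}) s" "\<And>t. t \<in> {0<..<T} \<Longrightarrow> s t \<in> X"
    and h: "\<And>n. h n > 0" "h \<longlonglongrightarrow> 0"
  shows "integrable (lebesgue_on {0<..<T}) (\<lambda>r. time_avg T b (h n) (\<lambda>t. D t (s r)) r)"
    and "(\<lambda>n. \<integral>r. time_avg T b (h n) (\<lambda>t. D t (s r)) r \<partial>lebesgue_on {0<..<T})
      \<longlonglongrightarrow> (\<integral>r. D r (s r) \<partial>lebesgue_on {0<..<T})"
proof -
  let ?L = "lebesgue_on {0<..<T}" and ?S = "s ` {0<..<T}"
  have fin: "finite ?S"
    using s(1) by (simp add: simple_function_def)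
  define E where "E v = s -` {v} \<inter> {0<..<T}" for v
  have E: "E v \<in> sets ?L" if "v \<in> ?S" for v
  proof -
    from that obtain r where "r \<in> {0<..<T}" "v = s r" by blast
    with s(1) show ?thesis by (auto simp: simple_function_def E_def)
  qed
  have SX: "v \<in> X" if "v \<in> ?S" for v
    using that s(2) by blast
  \<comment> \<open>F stays arbitrary because the same decomposition over fibres is used for the
    averages and for their limit.\<close>
  have sum: "F (s r) = (\<Sum>v\<in>?S. indicator (E v) r * F v)" if "r \<in> {0<..<T}" for F :: "_ \<Rightarrow> real" and r
  proof -
    have "(\<Sum>v\<in>?S. indicator (E v) r * F v) = (\<Sum>v\<in>?S. if v = s r then F v else 0)"
      using that by (intro sum.cong) (auto simp: E_def indicator_def)
    also have "\<dots> = F (s r)"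
      using fin that by simp
    finally show ?thesis by simp
  qed
  let ?f = "\<lambda>v t. D t v"
  have f: "integrable ?L (?f v)" if "v \<in> ?S" for v
    by (rule duality_const_integrable[OF D SX[OF that]])
  have a: "integrable ?L (\<lambda>r. indicator (E v) r * time_avg T b (h n) (?f v) r)" if "v \<in> ?S" for v n
    using integrable_mult_indicator[OF E[OF that] time_avg_integrable[OF f[OF that] h(1)]] by simp
  have a': "integrable ?L (\<lambda>r. indicator (E v) r * ?f v r)" if "v \<in> ?S" for v
    using integrable_mult_indicator[OF E[OF that] f[OF that]] by simp
  have eq: "time_avg T b (h n) (\<lambda>t. D t (s r)) r = (\<Sum>v\<in>?S. indicator (E v) r * time_avg T b (h n) (?f v) r)"
    if "r \<in> {0<..<T}" for r n
    by (rule sum[OF that])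
  have "integrable ?L (\<lambda>r. time_avg T b (h n) (\<lambda>t. D t (s r)) r) \<longleftrightarrow>
      integrable ?L (\<lambda>r. \<Sum>v\<in>?S. indicator (E v) r * time_avg T b (h n) (?f v) r)" for n
    by (rule Bochner_Integration.integrable_cong) (simp_all only: space_lebesgue_on eq)
  then show "integrable ?L (\<lambda>r. time_avg T b (h n) (\<lambda>t. D t (s r)) r)"
    using a by (simp only: Bochner_Integration.integrable_sum)
  have int: "(\<integral>r. time_avg T b (h n) (\<lambda>t. D t (s r)) r \<partial>?L) =
      (\<Sum>v\<in>?S. \<integral>r. indicator (E v) r * time_avg T b (h n) (?f v) r \<partial>?L)" for n
  proof -
    have "(\<integral>r. time_avg T b (h n) (\<lambda>t. D t (s r)) r \<partial>?L) =
        (\<integral>r. (\<Sum>v\<in>?S. indicator (E v) r * time_avg T b (h n) (?f v) r) \<partial>?L)"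
      by (rule Bochner_Integration.integral_cong) (simp_all only: space_lebesgue_on eq)
    also have "\<dots> = (\<Sum>v\<in>?S. \<integral>r. indicator (E v) r * time_avg T b (h n) (?f v) r \<partial>?L)"
      by (rule Bochner_Integration.integral_sum) (rule a)
    finally show ?thesis .
  qed
  have "(\<integral>r. D r (s r) \<partial>?L) = (\<integral>r. (\<Sum>v\<in>?S. indicator (E v) r * ?f v r) \<partial>?L)"
    by (rule Bochner_Integration.integral_cong) (auto intro: sum)
  also have "\<dots> = (\<Sum>v\<in>?S. \<integral>r. indicator (E v) r * ?f v r \<partial>?L)"
    by (rule Bochner_Integration.integral_sum) (rule a')
  finally have int': "(\<integral>r. D r (s r) \<partial>?L) = (\<Sum>v\<in>?S. \<integral>r. indicator (E v) r * ?f v r \<partial>?L)" .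
  show "(\<lambda>n. \<integral>r. time_avg T b (h n) (\<lambda>t. D t (s r)) r \<partial>?L) \<longlonglongrightarrow> (\<integral>r. D r (s r) \<partial>?L)"
    unfolding int int'
  proof (rule tendsto_sum)
    fix v assume v: "v \<in> ?S"
    have "norm ((\<integral>r. indicator (E v) r * time_avg T b (h n) (?f v) r \<partial>?L) - (\<integral>r. indicator (E v) r * ?f v r \<partial>?L))
        \<le> (\<integral>r. \<bar>time_avg T b (h n) (?f v) r - ?f v r\<bar> \<partial>?L)" for n
    proof -
      have "norm ((\<integral>r. indicator (E v) r * time_avg T b (h n) (?f v) r \<partial>?L) - (\<integral>r. indicator (E v) r * ?f v r \<partial>?L))
          = norm (\<integral>r. indicator (E v) r * time_avg T b (h n) (?f v) r - indicator (E v) r * ?f v r \<partial>?L)"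
        by (simp only: Bochner_Integration.integral_diff[OF a[OF v] a'[OF v]])
      also have "\<dots> \<le> (\<integral>r. norm (indicator (E v) r * time_avg T b (h n) (?f v) r - indicator (E v) r * ?f v r) \<partial>?L)"
        by (rule integral_norm_bound)
      also have "\<dots> \<le> (\<integral>r. \<bar>time_avg T b (h n) (?f v) r - ?f v r\<bar> \<partial>?L)"
        by (rule integral_mono[OF integrable_norm[OF Bochner_Integration.integrable_diff[OF a[OF v] a'[OF v]]]
              avg_diff_integrable[OF f[OF v] h(1)]]) (auto simp: indicator_def)
      finally show ?thesis .
    qed
    then have "(\<lambda>n. (\<integral>r. indicator (E v) r * time_avg T b (h n) (?f v) r \<partial>?L) - (\<integral>r. indicator (E v) r * ?f v r \<partial>?L)) \<longlonglongrightarrow> 0"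
      using avg_converges[OF f[OF v] h, of b] unfolding avg_converges_def by (rule LIMSEQ_null_le)
    then show "(\<lambda>n. \<integral>r. indicator (E v) r * time_avg T b (h n) (?f v) r \<partial>?L) \<longlonglongrightarrow>
        (\<integral>r. indicator (E v) r * ?f v r \<partial>?L)"
      by (rule LIM_zero_cancel)
  qed
qed

text \<open>Weighting the two squares by \<open>c\<close> and \<open>1 / c\<close> lets a small error in \<open>w\<close> compensate the possibly
  large norm of \<open>D\<close>.\<close>

lemma averaged_pairing_limit:
  assumes D: "D \<in> bochner_l2 T (dual_space X N) (dual_norm X N)" and w: "w \<in> bochner_l2 T X N"
    and h: "\<And>n. h n > 0" "h \<longlonglongrightarrow> 0"
    and meas: "\<And>n. (\<lambda>r. time_avg T b (h n) (\<lambda>t. D t (w r)) r) \<in> borel_measurable (lebesgue_on {0<..<T})"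
  shows "(\<lambda>n. \<integral>r. time_avg T b (h n) (\<lambda>t. D t (w r)) r \<partial>lebesgue_on {0<..<T})
      \<longlonglongrightarrow> (\<integral>r. D r (w r) \<partial>lebesgue_on {0<..<T})"
proof (rule LIMSEQ_I)
  let ?L = "lebesgue_on {0<..<T}" and ?d = "\<lambda>t. (dual_norm X N (D t))\<^sup>2"
  fix e :: real assume e: "e > 0"
  define K where "K = (\<integral>t. ?d t \<partial>?L)"
  \<comment> \<open>K + 1 keeps c positive even if D vanishes. The choice gives K/c \<le> e/3, so
    the dual norms contribute at most e/6 and the error in w less than e/6.\<close>
  define c where "c = (K + 1) * (3 / e)"
  have dint: "integrable ?L ?d"
    by (rule bochner_l2D(2)[OF D])
  have K: "K \<ge> 0"
    unfolding K_def by (intro integral_nonneg_AE) simp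
  have c: "c > 0" using K e by (simp add: c_def)
  have Kc: "K / c \<le> e / 3"
  proof -
    have "K / c = (K / (K + 1)) * (e / 3)" by (simp add: c_def)
    also have "\<dots> \<le> 1 * (e / 3)" using K e by (intro mult_right_mono) auto
    finally show ?thesis by simp
  qed
  obtain s where s: "simple_function ?L s" "s \<in> bochner_l2 T X N"
    "(\<integral>t. (N (\<lambda>y. s t y - w t y))\<^sup>2 \<partial>?L) < e / (3 * c)"
    by (rule bochner_l2_simple_approx[OF w, of "e / (3 * c)"]) (use e c in auto)
  let ?n = "\<lambda>r. (N (\<lambda>y. s r y - w r y))\<^sup>2"
  have nint: "integrable ?L ?n"
    by (rule bochner_l2D(2)[OF bochner_l2_diff[OF s(2) w]])
  have sX: "s r \<in> X" and wX: "w r \<in> X" if "r \<in> {0<..<T}" for r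
    by (rule bochner_l2D(1)[OF s(2) that], rule bochner_l2D(1)[OF w that])
  let ?A = "\<lambda>n r. time_avg T b (h n) (\<lambda>t. D t (w r)) r" and ?S = "\<lambda>n r. time_avg T b (h n) (\<lambda>t. D t (s r)) r"
  have young: "\<bar>D t (s r) - D t (w r)\<bar> \<le> 1 / (2 * c) * ?d t + c / 2 * ?n r"
    if "t \<in> {0<..<T}" "r \<in> {0<..<T}" for t r
  proof -
    let ?x = "dual_norm X N (D t)" and ?y = "N (\<lambda>y. s r y - w r y)"
    have Dt: "D t \<in> dual_space X N" by (rule bochner_l2D(1)[OF D that(1)])
    have "\<bar>D t (s r) - D t (w r)\<bar> = \<bar>D t (\<lambda>y. s r y - w r y)\<bar>"
      using dual_space_diff[OF Dt sX wX] that(2) by simp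
    also have "\<dots> \<le> ?x * ?y"
      by (intro dual_bound[OF Dt] diff_mem sX wX that)
    also have "\<dots> \<le> 1 / (2 * c) * ?x\<^sup>2 + c / 2 * ?y\<^sup>2"
    proof -
      \<comment> \<open>Young's inequality with parameter c.\<close>
      have "0 \<le> (?x - c * ?y)\<^sup>2 / (2 * c)" using c by simp
      also have "\<dots> = 1 / (2 * c) * ?x\<^sup>2 + c / 2 * ?y\<^sup>2 - ?x * ?y"
        using c by (simp add: field_simps power2_eq_square)
      finally show ?thesis by simp
    qed
    finally show ?thesis .
  qed
  have diff: "\<bar>?S n r - ?A n r\<bar> \<le> 1 / (2 * c) * time_avg T b (h n) ?d r + c / 2 * ?n r"
    if r: "r \<in> {0<..<T}" for n r
  proof -
    interpret finite_measure ?L by (rule finite_measure_time)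
    have fs: "integrable ?L (\<lambda>t. D t (s r))" and fw: "integrable ?L (\<lambda>t. D t (w r))"
      by (intro duality_const_integrable[OF D] sX wX r)+
    have one: "integrable ?L (\<lambda>t. 1::real)" by simp
    let ?g = "\<lambda>t. 1 * D t (s r) + -1 * D t (w r)"
    have g: "integrable ?L ?g" using fs fw by auto
    have k: "integrable ?L (\<lambda>t. 1 / (2 * c) * ?d t + c / 2 * ?n r * 1)" using dint by auto
    have "?S n r - ?A n r = time_avg T b (h n) ?g r"
      by (simp only: time_avg_lin[OF fs fw])
    then have "\<bar>?S n r - ?A n r\<bar> \<le> time_avg T b (h n) (\<lambda>t. \<bar>?g t\<bar>) r"
      using abs_time_avg_le[OF g h(1)[of n], of b r] by simp
    also have "\<dots> \<le> time_avg T b (h n) (\<lambda>t. 1 / (2 * c) * ?d t + c / 2 * ?n r * 1) r"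
    proof (rule time_avg_mono[OF _ k h(1)])
      show "integrable ?L (\<lambda>t. \<bar>?g t\<bar>)" using g by (rule integrable_abs)
      show "AE t in ?L. \<bar>?g t\<bar> \<le> 1 / (2 * c) * ?d t + c / 2 * ?n r * 1"
      proof (rule AE_I2)
        fix t assume "t \<in> space ?L"
        then show "\<bar>?g t\<bar> \<le> 1 / (2 * c) * ?d t + c / 2 * ?n r * 1"
          using young[OF _ r, of t] by simp
      qed
    qed
    also have "\<dots> = 1 / (2 * c) * time_avg T b (h n) ?d r + c / 2 * ?n r * time_avg T b (h n) (\<lambda>t. 1) r"
      by (rule time_avg_lin[OF dint one])
    also have "\<dots> \<le> 1 / (2 * c) * time_avg T b (h n) ?d r + c / 2 * ?n r * 1"
      using c by (intro add_left_mono mult_left_mono time_avg_const_le h) auto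
    finally show ?thesis by simp
  qed
  let ?E = "\<lambda>n r. 1 / (2 * c) * time_avg T b (h n) ?d r + c / 2 * ?n r"
  have Eint: "integrable ?L (?E n)" for n
    using time_avg_integrable[OF dint h(1)[of n], of b] nint by auto
  have Ele: "(\<integral>r. ?E n r \<partial>?L) < e / 3" for n
  proof -
    have "(\<integral>r. ?E n r \<partial>?L) = 1 / (2 * c) * (\<integral>r. time_avg T b (h n) ?d r \<partial>?L) + c / 2 * (\<integral>r. ?n r \<partial>?L)"
      using time_avg_integrable[OF dint h(1)[of n], of b] nint by simp
    also have "\<dots> \<le> 1 / (2 * c) * K + c / 2 * (\<integral>r. ?n r \<partial>?L)"
      unfolding K_def using c by (intro add_right_mono mult_left_mono time_avg_integral_le[OF dint h(1)]) auto
    also have "\<dots> < 1 / (2 * c) * K + c / 2 * (e / (3 * c))"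
      using s(3) c by (intro add_strict_left_mono mult_strict_left_mono) auto
    also have "\<dots> = (K / c) * (1 / 2) + e / 6"
      using c by (simp add: field_simps)
    also have "\<dots> \<le> (e / 3) * (1 / 2) + e / 6"
      using Kc by (intro add_right_mono mult_right_mono) auto
    also have "\<dots> = e / 3" by simp
    finally show ?thesis .
  qed
  have Sint: "integrable ?L (?S n)" for n
    by (rule averaged_pairing_limit_simple(1)[OF D s(1) sX h])
  \<comment> \<open>As r enters both the window and the argument \<open>w r\<close>, measurability
    is taken from \<open>meas\<close>; the simple case plus the error is an integrable
    bound.\<close>
  have Aint: "integrable ?L (?A n)" for n
  proof (rule integrable_of_abs_le[OF _ meas])
    show "integrable ?L (\<lambda>r. \<bar>?S n r\<bar> + ?E n r)"
      by (rule Bochner_Integration.integrable_add[OF integrable_abs[OF Sint] Eint])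
    show "AE r in ?L. \<bar>?A n r\<bar> \<le> \<bar>?S n r\<bar> + ?E n r"
    proof (rule AE_I2)
      fix r assume "r \<in> space ?L"
      then show "\<bar>?A n r\<bar> \<le> \<bar>?S n r\<bar> + ?E n r"
        using diff[of r n] by simp
    qed
  qed
  have step1: "\<bar>(\<integral>r. ?S n r \<partial>?L) - (\<integral>r. ?A n r \<partial>?L)\<bar> < e / 3" for n
  proof -
    have "\<bar>(\<integral>r. ?S n r \<partial>?L) - (\<integral>r. ?A n r \<partial>?L)\<bar> = \<bar>\<integral>r. ?S n r - ?A n r \<partial>?L\<bar>"
      by (simp only: Bochner_Integration.integral_diff[OF Sint Aint])
    also have "\<dots> \<le> (\<integral>r. \<bar>?S n r - ?A n r\<bar> \<partial>?L)"
      by (rule integral_abs_bound)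
    also have "\<dots> \<le> (\<integral>r. ?E n r \<partial>?L)"
      by (rule integral_mono[OF integrable_abs[OF Bochner_Integration.integrable_diff[OF Sint Aint]] Eint])
        (use diff in simp)
    also have "\<dots> < e / 3" by (rule Ele)
    finally show ?thesis .
  qed
  have step2: "\<bar>(\<integral>r. D r (s r) \<partial>?L) - (\<integral>r. D r (w r) \<partial>?L)\<bar> < e / 3"
  proof -
    have Ds: "integrable ?L (\<lambda>r. D r (s r))" and Dw: "integrable ?L (\<lambda>r. D r (w r))"
      by (rule duality_integrable[OF D s(2)], rule duality_integrable[OF D w])
    have "\<bar>(\<integral>r. D r (s r) \<partial>?L) - (\<integral>r. D r (w r) \<partial>?L)\<bar> = \<bar>\<integral>r. D r (s r) - D r (w r) \<partial>?L\<bar>"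
      by (simp only: Bochner_Integration.integral_diff[OF Ds Dw])
    also have "\<dots> \<le> (\<integral>r. \<bar>D r (s r) - D r (w r)\<bar> \<partial>?L)"
      by (rule integral_abs_bound)
    also have "\<dots> \<le> (\<integral>r. 1 / (2 * c) * ?d r + c / 2 * ?n r \<partial>?L)"
      by (rule integral_mono[OF integrable_abs[OF Bochner_Integration.integrable_diff[OF Ds Dw]]])
        (use young dint nint in auto)
    also have "\<dots> = 1 / (2 * c) * K + c / 2 * (\<integral>r. ?n r \<partial>?L)"
      unfolding K_def using dint nint by simp
    also have "\<dots> < 1 / (2 * c) * K + c / 2 * (e / (3 * c))"
      using s(3) c by (intro add_strict_left_mono mult_strict_left_mono) auto
    also have "\<dots> = (K / c) * (1 / 2) + e / 6"
      using c by (simp add: field_simps)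
    also have "\<dots> \<le> (e / 3) * (1 / 2) + e / 6"
      using Kc by (intro add_right_mono mult_right_mono) auto
    also have "\<dots> = e / 3" by simp
    finally show ?thesis .
  qed
  obtain n0 where n0: "\<And>n. n \<ge> n0 \<Longrightarrow> norm ((\<integral>r. ?S n r \<partial>?L) - (\<integral>r. D r (s r) \<partial>?L)) < e / 3"
    using LIMSEQ_D[OF averaged_pairing_limit_simple(2)[OF D s(1) sX h, of b], of "e / 3"] e by auto
  have "norm ((\<integral>r. ?A n r \<partial>?L) - (\<integral>r. D r (w r) \<partial>?L)) < e" if "n \<ge> n0" for n
    using n0[OF that] step1[of n] step2 by (simp only: real_norm_def)
  then show "\<exists>n0. \<forall>n\<ge>n0. norm ((\<integral>r. ?A n r \<partial>?L) - (\<integral>r. D r (w r) \<partial>?L)) < e"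
    by blast
qed

end

section \<open>Integration by parts in time\<close>

text \<open>Membership in C([0,T];L^2), written with the seminorm because the functions carry no
  topology of their own. It is the regularity that \<open>has_value_at\<close> demands of a
  representative.\<close>

definition l2_continuous :: "real \<Rightarrow> 'a measure \<Rightarrow> (real \<Rightarrow> 'a \<Rightarrow> real) \<Rightarrow> bool" where
  "l2_continuous T M c \<longleftrightarrow> (\<forall>t\<in>{0..T}. c t \<in> l2_space M) \<and>
     (\<forall>s\<in>{0..T}. ((\<lambda>t. l2_norm M (\<lambda>x. c t x - c s x)) \<longlongrightarrow> 0) (at s within {0..T}))"

lemma l2_continuous_compose:
  assumes c: "l2_continuous T M c" and \<alpha>: "continuous_on {0..T} \<alpha>" "\<alpha> \<in> {0..T} \<rightarrow> {0..T}"
    and s: "s \<in> {0..T}"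
  shows "((\<lambda>t. l2_norm M (\<lambda>x. c (\<alpha> t) x - c (\<alpha> s) x)) \<longlongrightarrow> 0) (at s within {0..T})"
proof -
  let ?g = "\<lambda>y. l2_norm M (\<lambda>x. c y x - c (\<alpha> s) x)"
  have \<alpha>s: "\<alpha> s \<in> {0..T}" using \<alpha>(2) s by blast
  have g0: "?g (\<alpha> s) = 0"
    using l2n.norm_zero[of M] by simp
  have "(?g \<longlongrightarrow> ?g (\<alpha> s)) (at (\<alpha> s) within {0..T})"
    unfolding g0 using c \<alpha>s by (simp add: l2_continuous_def)
  then have "continuous (at (\<alpha> s) within {0..T}) ?g"
    by (simp add: continuous_within)
  moreover have "\<forall>\<^sub>F t in at s within {0..T}. \<alpha> t \<in> {0..T}"
    unfolding eventually_at_filter by (rule always_eventually) (use \<alpha>(2) in blast)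
  moreover have "(\<alpha> \<longlongrightarrow> \<alpha> s) (at s within {0..T})"
    using \<alpha>(1) s by (simp add: continuous_on_def)
  ultimately have "((\<lambda>t. ?g (\<alpha> t)) \<longlongrightarrow> ?g (\<alpha> s)) (at s within {0..T})"
    by (rule continuous_within_tendsto_compose)
  then show ?thesis by (simp only: g0)
qed

lemma l2_inner_diff_le:
  assumes "a \<in> l2_space M" "b \<in> l2_space M" "a0 \<in> l2_space M" "b0 \<in> l2_space M"
  shows "\<bar>l2_inner M a b - l2_inner M a0 b0\<bar> \<le>
    l2_norm M (\<lambda>x. a x - a0 x) * (l2_norm M (\<lambda>x. b x - b0 x) + l2_norm M b0)
      + l2_norm M a0 * l2_norm M (\<lambda>x. b x - b0 x)"
proof -
  note m = assms
  have da: "(\<lambda>x. a x - a0 x) \<in> l2_space M" and db: "(\<lambda>x. b x - b0 x) \<in> l2_space M"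
    by (intro l2n.diff_mem m)+
  have "l2_inner M a b - l2_inner M a0 b0 =
      l2_inner M (\<lambda>x. a x - a0 x) (\<lambda>x. b x - b0 x) + l2_inner M (\<lambda>x. a x - a0 x) b0 + l2_inner M a0 (\<lambda>x. b x - b0 x)"
    using l2.lin_left[OF m(1,3) db, of 1 "-1"] l2.lin_left[OF m(1,3) m(4), of 1 "-1"]
      l2.lin_right[OF m(2,4) m(1), of 1 "-1"] l2.lin_right[OF m(2,4) m(3), of 1 "-1"] by simp
  moreover have "\<bar>l2_inner M (\<lambda>x. a x - a0 x) (\<lambda>x. b x - b0 x)\<bar> \<le> l2_norm M (\<lambda>x. a x - a0 x) * l2_norm M (\<lambda>x. b x - b0 x)"
    unfolding l2_norm_def by (rule l2.cauchy_schwarz[OF da db])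
  moreover have "\<bar>l2_inner M (\<lambda>x. a x - a0 x) b0\<bar> \<le> l2_norm M (\<lambda>x. a x - a0 x) * l2_norm M b0"
    unfolding l2_norm_def by (rule l2.cauchy_schwarz[OF da m(4)])
  moreover have "\<bar>l2_inner M a0 (\<lambda>x. b x - b0 x)\<bar> \<le> l2_norm M a0 * l2_norm M (\<lambda>x. b x - b0 x)"
    unfolding l2_norm_def by (rule l2.cauchy_schwarz[OF m(3) db])
  ultimately show ?thesis
    by (simp only: distrib_left)
qed

text \<open>The two factors may run through different times. The reparametrizations in use are
  shifts by h clamped to [0,T].\<close>

lemma l2_continuous_inner:
  assumes c: "l2_continuous T M c" and d: "l2_continuous T M d"
    and \<alpha>: "continuous_on {0..T} \<alpha>" "\<alpha> \<in> {0..T} \<rightarrow> {0..T}"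
    and \<beta>: "continuous_on {0..T} \<beta>" "\<beta> \<in> {0..T} \<rightarrow> {0..T}"
  shows "continuous_on {0..T} (\<lambda>t. l2_inner M (c (\<alpha> t)) (d (\<beta> t)))"
  unfolding continuous_on_def
proof
  fix s assume s: "s \<in> {0..T}"
  let ?F = "at s within {0..T}"
  let ?a = "\<lambda>t. l2_norm M (\<lambda>x. c (\<alpha> t) x - c (\<alpha> s) x)" and ?b = "\<lambda>t. l2_norm M (\<lambda>x. d (\<beta> t) x - d (\<beta> s) x)"
  have a: "(?a \<longlongrightarrow> 0) ?F" and b: "(?b \<longlongrightarrow> 0) ?F"
    by (rule l2_continuous_compose[OF c \<alpha> s], rule l2_continuous_compose[OF d \<beta> s])
  have mem: "c (\<alpha> t) \<in> l2_space M" "d (\<beta> t) \<in> l2_space M" if "t \<in> {0..T}" for t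
    using c d \<alpha>(2) \<beta>(2) that by (auto simp: l2_continuous_def Pi_iff)
  have "((\<lambda>t. ?a t * (?b t + l2_norm M (d (\<beta> s))) + l2_norm M (c (\<alpha> s)) * ?b t) \<longlongrightarrow>
      0 * (0 + l2_norm M (d (\<beta> s))) + l2_norm M (c (\<alpha> s)) * 0) ?F"
    by (intro tendsto_intros a b)
  then have lim: "((\<lambda>t. ?a t * (?b t + l2_norm M (d (\<beta> s))) + l2_norm M (c (\<alpha> s)) * ?b t) \<longlongrightarrow> 0) ?F"
    by simp
  have "\<forall>\<^sub>F t in ?F. t \<in> {0..T}"
    by (auto simp: eventually_at_filter)
  then have "\<forall>\<^sub>F t in ?F. norm (l2_inner M (c (\<alpha> t)) (d (\<beta> t)) - l2_inner M (c (\<alpha> s)) (d (\<beta> s))) \<le>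
      ?a t * (?b t + l2_norm M (d (\<beta> s))) + l2_norm M (c (\<alpha> s)) * ?b t"
    unfolding real_norm_def by eventually_elim (intro l2_inner_diff_le mem s)
  then have "((\<lambda>t. l2_inner M (c (\<alpha> t)) (d (\<beta> t)) - l2_inner M (c (\<alpha> s)) (d (\<beta> s))) \<longlongrightarrow> 0) ?F"
    by (rule Lim_null_comparison[OF _ lim])
  then show "((\<lambda>t. l2_inner M (c (\<alpha> t)) (d (\<beta> t))) \<longlongrightarrow> l2_inner M (c (\<alpha> s)) (d (\<beta> s))) ?F"
    by (rule LIM_zero_cancel)
qed

lemma l2_continuous_const: "v \<in> l2_space M \<Longrightarrow> l2_continuous T M (\<lambda>t. v)"
  using l2n.norm_zero[of M] by (simp add: l2_continuous_def)

text \<open>A constant sequence in the almost-everywhere limit lemma: completeness lets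
  measurability pass through null sets.\<close>

lemma measurable_of_AE_continuous:
  fixes f F :: "real \<Rightarrow> real"
  assumes "continuous_on {0..T} F" "AE r in lebesgue_on {0<..<T}. f r = F r"
  shows "f \<in> borel_measurable (lebesgue_on {0<..<T})"
proof (rule borel_measurable_time_AE_LIMSEQ)
  show "F \<in> borel_measurable (lebesgue_on {0<..<T})"
    by (rule borel_measurable_integrable[OF time_integral_continuous(1)[OF assms(1)]])
  show "AE r in lebesgue_on {0<..<T}. (\<lambda>k::nat. F r) \<longlonglongrightarrow> f r"
    using assms(2) by eventually_elim simp
qed

text \<open>Meant for F(r) = (u(r-h), p(r)) and G(r) = (u(r), p(r+h)) with clamped times: they are
  translates of each other, and the end pieces vanish since u starts and p ends at zero.\<close>

lemma integral_shift_cancel: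
  fixes F G :: "real \<Rightarrow> real"
  assumes F: "continuous_on {0..T} F" and G: "continuous_on {0..T} G" and h: "0 < h" "h < T"
    and F0: "\<And>r. r \<in> {0..h} \<Longrightarrow> F r = 0" and G0: "\<And>r. r \<in> {T - h..T} \<Longrightarrow> G r = 0"
    and shift: "\<And>r. r \<in> {0..T - h} \<Longrightarrow> G r = F (r + h)"
  shows "integral {0..T} F = integral {0..T} G"
proof -
  have "integral {0..T} F = integral {0..h} F + integral {h..T} F"
    using h F by (intro Henstock_Kurzweil_Integration.integral_combine[symmetric] integrable_continuous_real) auto
  also have "integral {0..h} F = 0"
    using F0 by (subst integral_cong[where g="\<lambda>_. 0"]) auto
  also have "integral {h..T} F = integral {0..T - h} (F \<circ> (+) h)"
    using integral_shift_Icc_real[of 0 "T - h" F h] by simp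
  also have "\<dots> = integral {0..T - h} G"
    using shift by (intro integral_cong) (simp add: add.commute)
  also have "0 + integral {0..T - h} G = integral {0..T - h} G + integral {T - h..T} G"
    using G0 by (subst (3) integral_cong[where g="\<lambda>_. 0"]) auto
  also have "\<dots> = integral {0..T} G"
    using h G by (intro Henstock_Kurzweil_Integration.integral_combine integrable_continuous_real) auto
  finally show ?thesis .
qed

text \<open>Both difference quotients of \<open>t \<mapsto> (u t, p (t + h))\<close> appear as averages of the two duality
  pairings; the boundary values make their integrals cancel for every \<open>h\<close>.\<close>

theorem (in seminormed) integration_by_parts_zero:
  assumes XL: "X \<subseteq> l2_space M" and T: "0 < T"
    and u: "u \<in> bochner_l2 T X N" and p: "p \<in> bochner_l2 T X N"
    and du: "du \<in> bochner_l2 T (dual_space X N) (dual_norm X N)"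
    and dp: "dp \<in> bochner_l2 T (dual_space X N) (dual_norm X N)"
    and cu: "l2_continuous T M cu" and cp: "l2_continuous T M cp"
    and ucu: "time_ae_eq T M u cu" and pcp: "time_ae_eq T M p cp"
    and weak_u: "\<And>v. v \<in> X \<Longrightarrow> weak_time_derivative T (\<lambda>t. l2_inner M (cu t) v) (\<lambda>t. du t v)"
    and weak_p: "\<And>v. v \<in> X \<Longrightarrow> weak_time_derivative T (\<lambda>t. l2_inner M (cp t) v) (\<lambda>t. dp t v)"
    and cu0: "AE x in M. cu 0 x = 0" and cpT: "AE x in M. cp T x = 0"
  shows "(\<integral>t. du t (p t) \<partial>lebesgue_on {0<..<T}) + (\<integral>t. dp t (u t) \<partial>lebesgue_on {0<..<T}) = 0"
proof -
  let ?L = "lebesgue_on {0<..<T}"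
  \<comment> \<open>Starting with n + 2 makes the window shorter than T for every n.\<close>
  define h where "h n = T / real (n + 2)" for n :: nat
  have h: "0 < h n" "h n < T" for n
  proof -
    show "0 < h n" using T by (simp add: h_def)
    have "T / real (n + 2) < T / 1"
      using T by (intro divide_strict_left_mono) auto
    then show "h n < T" by (simp add: h_def)
  qed
  have h0: "h \<longlonglongrightarrow> 0"
  proof -
    have "(\<lambda>n. T / real n) \<longlonglongrightarrow> 0"
      by (rule lim_const_over_n)
    from LIMSEQ_ignore_initial_segment[OF this, of 2] show ?thesis
      by (simp only: h_def[abs_def])
  qed
  have cuL: "cu t \<in> l2_space M" and cpL: "cp t \<in> l2_space M" if "t \<in> {0..T}" for t
    using cu cp that by (auto simp: l2_continuous_def)
  have uX: "u t \<in> X" and pX: "p t \<in> X" if "t \<in> {0<..<T}" for t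
    by (rule bochner_l2D(1)[OF u that], rule bochner_l2D(1)[OF p that])
  have cont: "continuous_on {0..T} (\<lambda>t. l2_inner M (c t) v)" if "l2_continuous T M c" "v \<in> X" for c v
    using l2_continuous_inner[OF that(1) l2_continuous_const, of v "\<lambda>t. t" "\<lambda>t. t"] XL that(2) by auto
  have FTC: "l2_inner M (c t) v - l2_inner M (c s) v = (\<integral>r. indicator {s<..<t} r * dc r v \<partial>?L)"
    if "l2_continuous T M c" "dc \<in> bochner_l2 T (dual_space X N) (dual_norm X N)"
      "weak_time_derivative T (\<lambda>t. l2_inner M (c t) v) (\<lambda>t. dc t v)" "v \<in> X"
      "0 \<le> s" "s < t" "t \<le> T" for c dc v s t
    by (rule weak_time_derivative_FTC[OF cont[OF that(1,4)] duality_const_integrable[OF that(2,4)] that(3) that(5-7)])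
  let ?G = "\<lambda>r. l2_inner M (cu r) (cp r)"
  \<comment> \<open>Clamping reproduces the truncation of the windows at 0 and T. At the clamped
    times the values of \<open>cu\<close> and \<open>cp\<close> are zero almost everywhere.\<close>
  let ?F = "\<lambda>n r. l2_inner M (cu (max 0 (r - h n))) (cp r)"
  let ?F' = "\<lambda>n r. l2_inner M (cu r) (cp (min T (r + h n)))"
  have contG: "continuous_on {0..T} ?G"
    by (rule l2_continuous_inner[OF cu cp]) auto
  have contF: "continuous_on {0..T} (?F n)" for n
    by (rule l2_continuous_inner[OF cu cp]) (use h[of n] in \<open>auto intro!: continuous_intros\<close>)
  have contF': "continuous_on {0..T} (?F' n)" for n
    by (rule l2_continuous_inner[OF cu cp]) (use h[of n] in \<open>auto intro!: continuous_intros\<close>)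
  let ?A = "\<lambda>n r. time_avg T True (h n) (\<lambda>t. du t (p r)) r"
  let ?B = "\<lambda>n r. time_avg T False (h n) (\<lambda>t. dp t (u r)) r"
  have A: "AE r in ?L. ?A n r = (?G r - ?F n r) / h n" for n
    using pcp[unfolded time_ae_eq_def] AE_space
  proof eventually_elim
    case (elim r)
    then have r: "r \<in> {0<..<T}" by simp
    have "?A n r = (\<integral>t. indicator {max 0 (r - h n)<..<r} t * du t (p r) / h n \<partial>?L)"
      unfolding time_avg_def
      by (rule Bochner_Integration.integral_cong) (auto simp: time_window_def indicator_def)
    also have "\<dots> = (\<integral>t. indicator {max 0 (r - h n)<..<r} t * du t (p r) \<partial>?L) / h n"
      by (rule integral_divide_zero)
    also have "(\<integral>t. indicator {max 0 (r - h n)<..<r} t * du t (p r) \<partial>?L) =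
        l2_inner M (cu r) (p r) - l2_inner M (cu (max 0 (r - h n))) (p r)"
      by (rule FTC[OF cu du weak_u[OF pX[OF r]] pX[OF r], symmetric]) (use r h[of n] in auto)
    finally have A_eq: "?A n r = (l2_inner M (cu r) (p r) - l2_inner M (cu (max 0 (r - h n))) (p r)) / h n" .
    \<comment> \<open>The test function has to be \<open>p r\<close>, which lies in X, whereas
      continuity in time is known for \<open>cp r\<close>; they are exchanged once the test has been
      made.\<close>
    have "l2_inner M c (p r) = l2_inner M c (cp r)" if "c \<in> l2_space M" for c
      using that XL pX[OF r] cpL[of r] r elim(1)
      by (intro l2_inner_cong_AE) (auto intro: l2_space_measurable)
    then have "l2_inner M (cu r) (p r) = ?G r" "l2_inner M (cu (max 0 (r - h n))) (p r) = ?F n r"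
      using cuL r h(1)[of n] by auto
    with A_eq show ?case by (simp only:)
  qed
  have B: "AE r in ?L. ?B n r = (?F' n r - ?G r) / h n" for n
    using ucu[unfolded time_ae_eq_def] AE_space
  proof eventually_elim
    case (elim r)
    then have r: "r \<in> {0<..<T}" by simp
    have "?B n r = (\<integral>t. indicator {r<..<min T (r + h n)} t * dp t (u r) / h n \<partial>?L)"
      unfolding time_avg_def
      by (rule Bochner_Integration.integral_cong) (auto simp: time_window_def indicator_def)
    also have "\<dots> = (\<integral>t. indicator {r<..<min T (r + h n)} t * dp t (u r) \<partial>?L) / h n"
      by (rule integral_divide_zero)
    also have "(\<integral>t. indicator {r<..<min T (r + h n)} t * dp t (u r) \<partial>?L) =
        l2_inner M (cp (min T (r + h n))) (u r) - l2_inner M (cp r) (u r)"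
      by (rule FTC[OF cp dp weak_p[OF uX[OF r]] uX[OF r], symmetric]) (use r h[of n] in auto)
    finally have B_eq: "?B n r = (l2_inner M (cp (min T (r + h n))) (u r) - l2_inner M (cp r) (u r)) / h n" .
    have "l2_inner M c (u r) = l2_inner M (cu r) c" if "c \<in> l2_space M" for c
    proof -
      have "l2_inner M c (u r) = l2_inner M c (cu r)"
        using that XL uX[OF r] cuL[of r] r elim(1)
        by (intro l2_inner_cong_AE) (auto intro: l2_space_measurable)
      then show ?thesis
        using l2.sym[OF that cuL] r by simp
    qed
    then have "l2_inner M (cp r) (u r) = ?G r" "l2_inner M (cp (min T (r + h n))) (u r) = ?F' n r"
      using cpL r h(1)[of n] by auto
    with B_eq show ?case by (simp only:)
  qed
  \<comment> \<open>The representation by continuous functions provides the measurability that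
    \<open>averaged_pairing_limit\<close> asks for.\<close>
  have mA: "?A n \<in> borel_measurable ?L" for n
    by (rule measurable_of_AE_continuous[OF _ A]) (intro continuous_intros contG contF, use h(1)[of n] in simp)
  have mB: "?B n \<in> borel_measurable ?L" for n
    by (rule measurable_of_AE_continuous[OF _ B]) (intro continuous_intros contG contF', use h(1)[of n] in simp)
  have sum0: "(\<integral>r. ?A n r \<partial>?L) + (\<integral>r. ?B n r \<partial>?L) = 0" for n
  proof -
    note iG = time_integral_continuous[OF contG] and iF = time_integral_continuous[OF contF[of n]]
      and iF' = time_integral_continuous[OF contF'[of n]]
    have "(\<integral>r. ?A n r \<partial>?L) = (\<integral>r. (?G r - ?F n r) / h n \<partial>?L)"
      using A[of n] mA[of n] iG(1) iF(1) by (intro integral_cong_AE) auto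
    moreover have "(\<integral>r. ?B n r \<partial>?L) = (\<integral>r. (?F' n r - ?G r) / h n \<partial>?L)"
      using B[of n] mB[of n] iG(1) iF'(1) by (intro integral_cong_AE) auto
    moreover have "(\<integral>r. ?F n r \<partial>?L) = (\<integral>r. ?F' n r \<partial>?L)"
      unfolding iF(2) iF'(2)
    proof (rule integral_shift_cancel[OF contF contF' h])
      fix r assume "r \<in> {0..h n}"
      then have "max 0 (r - h n) = 0" "r \<in> {0..T}" using h(2)[of n] by auto
      then have "?F n r = l2_inner M (\<lambda>x. 0) (cp r)"
        using cu0 cuL[of 0] cpL[of r] T by (simp only:) (intro l2_inner_cong_AE, auto intro: l2_space_measurable)
      then show "?F n r = 0" by (simp add: l2_inner_def)
    next
      fix r assume "r \<in> {T - h n..T}"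
      then have "min T (r + h n) = T" "r \<in> {0..T}" using h(2)[of n] by auto
      then have "?F' n r = l2_inner M (cu r) (\<lambda>x. 0)"
        using cpT cpL[of T] cuL[of r] T by (simp only:) (intro l2_inner_cong_AE, auto intro: l2_space_measurable)
      then show "?F' n r = 0" by (simp add: l2_inner_def)
    next
      fix r assume "r \<in> {0..T - h n}"
      then show "?F' n r = ?F n (r + h n)" by auto
    qed
    ultimately show ?thesis
      using iG(1) iF(1) iF'(1) by (simp add: diff_divide_distrib)
  qed
  have "(\<lambda>n. (\<integral>r. ?A n r \<partial>?L) + (\<integral>r. ?B n r \<partial>?L)) \<longlonglongrightarrow> (\<integral>t. du t (p t) \<partial>?L) + (\<integral>t. dp t (u t) \<partial>?L)"
    by (intro tendsto_add averaged_pairing_limit[OF du p h(1) h0 mA] averaged_pairing_limit[OF dp u h(1) h0 mB])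
  moreover have "(\<lambda>n. (\<integral>r. ?A n r \<partial>?L) + (\<integral>r. ?B n r \<partial>?L)) \<longlonglongrightarrow> 0"
    unfolding sum0 by (rule tendsto_const)
  ultimately show ?thesis
    by (rule LIMSEQ_unique)
qed

section \<open>Uniqueness of weak gradients\<close>

text \<open>Built from the squared distance rather than the norm, hence differentiable at the centre
  as well; squaring the positive part smooths the crossing of the sphere.\<close>

definition ball_bump :: "'a::euclidean_space \<Rightarrow> real \<Rightarrow> 'a \<Rightarrow> real" where
  "ball_bump a r x = (max 0 (r\<^sup>2 - (x - a) \<bullet> (x - a)))\<^sup>2"

definition ball_bump_grad :: "'a::euclidean_space \<Rightarrow> real \<Rightarrow> 'a \<Rightarrow> 'a" where
  "ball_bump_grad a r x = (2 * max 0 (r\<^sup>2 - (x - a) \<bullet> (x - a))) *\<^sub>R (- 2 *\<^sub>R (x - a))"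

lemma GDERIV_ball_bump: "GDERIV (ball_bump a r) x :> ball_bump_grad a r x"
proof -
  have "GDERIV (\<lambda>x. r\<^sup>2 - (x - a) \<bullet> (x - a)) x :> - 2 *\<^sub>R (x - a)"
    unfolding gderiv_def by (auto intro!: derivative_eq_intros simp: inner_commute algebra_simps)
  from GDERIV_DERIV_compose[OF this DERIV_max_0_power2] show ?thesis
    by (simp only: ball_bump_def[abs_def] ball_bump_grad_def)
qed

lemma continuous_on_ball_bump_grad: "continuous_on S (ball_bump_grad a r)"
  unfolding ball_bump_grad_def[abs_def] by (intro continuous_intros)

lemma ball_bump_pos_iff: 
  assumes "r > 0"
  shows "ball_bump a r x > 0 \<longleftrightarrow> x \<in> ball a r"
proof -
  have "(x - a) \<bullet> (x - a) < r\<^sup>2 \<longleftrightarrow> norm (x - a) < r"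
    using assms by (simp add: norm_lt_square)
  then show ?thesis
    by (auto simp: ball_bump_def max_def dist_norm norm_minus_commute not_le)
qed

lemma ball_bump_nonneg: "ball_bump a r x \<ge> 0"
  by (simp add: ball_bump_def)

lemma ball_bump_eq_0: "r > 0 \<Longrightarrow> x \<notin> ball a r \<Longrightarrow> ball_bump a r x = 0"
  using ball_bump_pos_iff[of r a x] ball_bump_nonneg[of a r x] by linarith

text \<open>Lindelof's theorem. The closed balls are kept inside U because they will be the compact
  supports of test functions.\<close>

lemma open_eq_Union_balls:
  fixes U :: "'a::euclidean_space set"
  assumes "open U" "U \<noteq> {}"
  obtains a :: "nat \<Rightarrow> 'a" and r where "\<And>k. r k > 0" "\<And>k. cball (a k) (r k) \<subseteq> U"
    "U = (\<Union>k. ball (a k) (r k))"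
proof -
  define \<F> where "\<F> = {ball a r | a r. r > 0 \<and> cball a r \<subseteq> U}"
  have "\<Union>\<F> = U"
  proof (rule antisym; rule subsetI)
    fix x assume "x \<in> U"
    then obtain r where "r > 0" "cball x r \<subseteq> U"
      using assms(1) open_contains_cball by blast
    then have "ball x r \<in> \<F>" "x \<in> ball x r" by (auto simp: \<F>_def)
    then show "x \<in> \<Union>\<F>" by blast
  next
    fix x assume "x \<in> \<Union>\<F>"
    then show "x \<in> U" by (auto simp: \<F>_def subset_iff)
  qed
  moreover obtain \<G> where \<G>: "\<G> \<subseteq> \<F>" "countable \<G>" "\<Union>\<G> = \<Union>\<F>"
    by (rule Lindelof[of \<F>]) (auto simp: \<F>_def)
  ultimately have ne: "\<G> \<noteq> {}" "\<Union>\<G> = U" using assms(2) by auto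
  have "\<forall>k. \<exists>p. from_nat_into \<G> k = ball (fst p) (snd p) \<and> snd p > 0 \<and> cball (fst p) (snd p) \<subseteq> U"
  proof
    fix k
    have "from_nat_into \<G> k \<in> \<F>"
      using from_nat_into[OF ne(1)] \<G>(1) by blast
    then show "\<exists>p. from_nat_into \<G> k = ball (fst p) (snd p) \<and> snd p > 0 \<and> cball (fst p) (snd p) \<subseteq> U"
      by (auto simp: \<F>_def)
  qed
  from choice[OF this] obtain p where p: "\<And>k. from_nat_into \<G> k = ball (fst (p k)) (snd (p k))"
    "\<And>k. snd (p k) > 0" "\<And>k. cball (fst (p k)) (snd (p k)) \<subseteq> U"
    by blast
  have "U = (\<Union>k. ball (fst (p k)) (snd (p k)))"
    using ne(2) range_from_nat_into[OF ne(1) \<G>(2)] by (simp only: p(1)[symmetric])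
  with p(2,3) show ?thesis
    by (intro that[of "\<lambda>k. snd (p k)" "\<lambda>k. fst (p k)"])
qed

text \<open>The sum of the first k + 1 bumps is positive exactly on the balls used so far.
  Multiplied by k + 1 and fed into the step, it saturates at 1 wherever some bump is
  positive.\<close>

lemma indicator_open_limit_of_test_functions:
  fixes U :: "'a::euclidean_space set"
  assumes "open U"
  obtains \<phi> :: "nat \<Rightarrow> 'a \<Rightarrow> real" and d\<phi> K where
    "\<And>k x. GDERIV (\<phi> k) x :> d\<phi> k x" "\<And>k. continuous_on UNIV (d\<phi> k)" "\<And>k. compact (K k)"
    "\<And>k. K k \<subseteq> U" "\<And>k x. x \<notin> K k \<Longrightarrow> \<phi> k x = 0" "\<And>k x. 0 \<le> \<phi> k x" "\<And>k x. \<phi> k x \<le> 1"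
    "\<And>x. (\<lambda>k. \<phi> k x) \<longlonglongrightarrow> indicator U x"
proof (cases "U = {}")
  case True
  show ?thesis
    by (rule that[of "\<lambda>k x. 0" "\<lambda>k x. 0" "\<lambda>k. {}"]) (auto simp: True GDERIV_const)
next
  case False
  obtain a :: "nat \<Rightarrow> 'a" and r where ar: "\<And>k. r k > 0" "\<And>k. cball (a k) (r k) \<subseteq> U"
    "U = (\<Union>k. ball (a k) (r k))"
    by (rule open_eq_Union_balls[OF assms False]) (rule that)
  define m where "m k x = (\<Sum>j\<le>k. ball_bump (a j) (r j) x)" for k x
  define dm where "dm k x = (\<Sum>j\<le>k. ball_bump_grad (a j) (r j) x)" for k x
  have D: "GDERIV (m k) x :> dm k x" for k x
  proof (induction k)
    case 0
    then show ?case by (simp add: m_def[abs_def] dm_def GDERIV_ball_bump)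
  next
    case (Suc k)
    have "m (Suc k) = (\<lambda>x. m k x + ball_bump (a (Suc k)) (r (Suc k)) x)"
      "dm (Suc k) x = dm k x + ball_bump_grad (a (Suc k)) (r (Suc k)) x"
      by (simp_all add: m_def dm_def fun_eq_iff)
    then show ?case
      using GDERIV_add[OF Suc GDERIV_ball_bump] by simp
  qed
  have cm: "continuous_on UNIV (m k)" for k
    using D unfolding gderiv_def by (meson continuous_at_imp_continuous_on has_derivative_continuous)
  have cdm: "continuous_on UNIV (dm k)" for k
    unfolding dm_def[abs_def] by (intro continuous_intros continuous_on_ball_bump_grad)
  have mnn: "m k x \<ge> 0" for k x
    unfolding m_def by (intro sum_nonneg ball_bump_nonneg)
  let ?n = "\<lambda>k. real (Suc k)"
  show ?thesis
  proof (rule that[of "\<lambda>k x. smooth_step (?n k * m k x)"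
        "\<lambda>k x. (smooth_step_deriv (?n k * m k x) * ?n k) *\<^sub>R dm k x" "\<lambda>k. \<Union>j\<le>k. cball (a j) (r j)"])
    show "GDERIV (\<lambda>x. smooth_step (?n k * m k x)) x :> (smooth_step_deriv (?n k * m k x) * ?n k) *\<^sub>R dm k x" for k x
    proof -
      have "((\<lambda>y. smooth_step (?n k * y)) has_real_derivative smooth_step_deriv (?n k * m k x) * ?n k) (at (m k x))"
        by (rule DERIV_chain2[OF DERIV_smooth_step]) (auto intro!: derivative_eq_intros)
      from GDERIV_DERIV_compose[OF D this] show ?thesis .
    qed
    show "continuous_on UNIV (\<lambda>x. (smooth_step_deriv (?n k * m k x) * ?n k) *\<^sub>R dm k x)" for k
      by (intro continuous_intros continuous_on_compose2[OF continuous_on_smooth_step_deriv[of UNIV]] cm cdm) auto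
    show "compact (\<Union>j\<le>k. cball (a j) (r j))" for k
      by (intro compact_UN) auto
    show "(\<Union>j\<le>k. cball (a j) (r j)) \<subseteq> U" for k
      using ar(2) by blast
    show "smooth_step (?n k * m k x) = 0" if "x \<notin> (\<Union>j\<le>k. cball (a j) (r j))" for k x
    proof -
      have "m k x = 0"
        unfolding m_def using that ball_subset_cball by (intro sum.neutral ballI ball_bump_eq_0 ar) blast
      then show ?thesis by (simp add: smooth_step_simps)
    qed
    show "0 \<le> smooth_step (?n k * m k x)" "smooth_step (?n k * m k x) \<le> 1" for k x
      by (rule smooth_step_bounds)+
    show "(\<lambda>k. smooth_step (?n k * m k x)) \<longlonglongrightarrow> indicator U x" for x
    proof (cases "x \<in> U")
      case True
      then obtain j where "x \<in> ball (a j) (r j)" using ar(3) by blast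
      then have pos: "ball_bump (a j) (r j) x > 0"
        using ball_bump_pos_iff[OF ar(1)] by blast
      \<comment> \<open>Two things are awaited: the ball containing x has to enter the sum, and the
        factor k + 1 has to lift its bump above 1.\<close>
      obtain K :: nat where K: "1 / real (Suc K) < ball_bump (a j) (r j) x"
        using pos by (metis nat_approx_posE)
      have "smooth_step (?n k * m k x) = 1" if "k \<ge> max j K" for k
      proof (rule smooth_step_simps)
        have "1 / ?n k \<le> 1 / real (Suc K)"
          using that by (simp add: field_simps)
        also have "\<dots> < ball_bump (a j) (r j) x" by (rule K)
        also have "\<dots> \<le> m k x"
          unfolding m_def using that by (intro member_le_sum ball_bump_nonneg) auto
        finally show "1 \<le> ?n k * m k x"
          by (simp add: field_simps)
      qed
      then have "\<forall>\<^sub>F k in sequentially. smooth_step (?n k * m k x) = 1"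
        unfolding eventually_sequentially by blast
      then show ?thesis
        using True by (simp add: tendsto_eventually)
    next
      case False
      then have "m k x = 0" for k
        unfolding m_def using ar(3) by (intro sum.neutral ballI ball_bump_eq_0 ar) auto
      then show ?thesis
        using False by (simp add: smooth_step_simps)
    qed
  qed
qed

text \<open>Dominated convergence gives zero integral over open sets, then over countable
  intersections of open sets, and every measurable set is one of these up to a null set. No
  mollifier is involved.\<close>

lemma fundamental_lemma_variations:
  fixes H :: "'a::euclidean_space \<Rightarrow> real"
  assumes \<Omega>: "open \<Omega>" "bounded \<Omega>" and H: "integrable (lebesgue_on \<Omega>) H"
    and test: "\<And>\<phi> d\<phi> K. (\<And>x. GDERIV \<phi> x :> d\<phi> x) \<Longrightarrow> continuous_on UNIV d\<phi> \<Longrightarrow> compact K \<Longrightarrow>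
      K \<subseteq> \<Omega> \<Longrightarrow> (\<And>x. x \<notin> K \<Longrightarrow> \<phi> x = 0) \<Longrightarrow> (\<integral>x. H x * \<phi> x \<partial>lebesgue_on \<Omega>) = 0"
  shows "AE x in lebesgue_on \<Omega>. H x = 0"
proof -
  let ?L = "lebesgue_on \<Omega>"
  interpret finite_measure ?L
    using \<Omega> by (intro finite_measure_lebesgue_on bounded_set_imp_lmeasurable) auto
  have \<Omega>L: "\<Omega> \<in> sets lebesgue" using \<Omega> by simp
  note [measurable] = borel_measurable_integrable[OF H]
  have ind: "(\<lambda>x. indicator S x :: real) \<in> borel_measurable ?L" if "S \<in> sets lebesgue" for S
  proof -
    have "(\<lambda>x. indicator S x :: real) \<in> borel_measurable lebesgue"
      using that by (rule borel_measurable_indicator)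
    then show ?thesis by (rule measurable_restrict_space1)
  qed
  have opn: "(\<integral>x. indicator U x * H x \<partial>?L) = 0" if U: "open U" for U
  proof -
    have "open (U \<inter> \<Omega>)" using U \<Omega> by auto
    then obtain \<phi> d\<phi> K where \<phi>: "\<And>k x. GDERIV (\<phi> k) x :> d\<phi> k x" "\<And>k. continuous_on UNIV (d\<phi> k)"
      "\<And>k. compact (K k)" "\<And>k. K k \<subseteq> U \<inter> \<Omega>" "\<And>k x. x \<notin> K k \<Longrightarrow> \<phi> k x = 0"
      "\<And>k x. 0 \<le> \<phi> k x" "\<And>k x. \<phi> k x \<le> 1" "\<And>x. (\<lambda>k. \<phi> k x) \<longlonglongrightarrow> indicator (U \<inter> \<Omega>) x"
      by (rule indicator_open_limit_of_test_functions) (rule that)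
    have zero: "(\<integral>x. H x * \<phi> k x \<partial>?L) = 0" for k
      by (rule test[OF \<phi>(1-3)]) (use \<phi>(4,5) in auto)
    have "(\<lambda>k. \<integral>x. H x * \<phi> k x \<partial>?L) \<longlonglongrightarrow> (\<integral>x. indicator U x * H x \<partial>?L)"
    proof (rule integral_dominated_convergence[where w="\<lambda>x. \<bar>H x\<bar>"])
      have "continuous_on UNIV (\<phi> k)" for k
        using \<phi>(1) unfolding gderiv_def by (meson continuous_at_imp_continuous_on has_derivative_continuous)
      then have "\<phi> k \<in> borel_measurable ?L" for k
        by (intro continuous_imp_measurable_on_sets_lebesgue[OF _ \<Omega>L]) (rule continuous_on_subset, auto)
      then show "(\<lambda>x. H x * \<phi> k x) \<in> borel_measurable ?L" for k
        by simp
      show "(\<lambda>x. indicator U x * H x) \<in> borel_measurable ?L"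
        by (intro borel_measurable_times ind) (use U in auto)
      show "integrable ?L (\<lambda>x. \<bar>H x\<bar>)" using H by simp
      show "AE x in ?L. (\<lambda>k. H x * \<phi> k x) \<longlonglongrightarrow> indicator U x * H x"
      proof (rule AE_I2)
        fix x assume "x \<in> space ?L"
        then have "indicator U x = (indicator (U \<inter> \<Omega>) x :: real)"
          by (simp add: indicator_def)
        then show "(\<lambda>k. H x * \<phi> k x) \<longlonglongrightarrow> indicator U x * H x"
          using tendsto_mult[OF tendsto_const \<phi>(8), of "H x" x] by (simp add: mult.commute)
      qed
      show "AE x in ?L. norm (H x * \<phi> k x) \<le> \<bar>H x\<bar>" for k
        using \<phi>(6,7) by (intro AE_I2) (simp add: abs_mult mult_left_le)
    qed
    then show ?thesis
      unfolding zero by (simp add: LIMSEQ_const_iff)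
  qed
  have "set_lebesgue_integral ?L A H = 0" if A: "A \<in> sets ?L" for A
  proof -
    from A have AL: "A \<in> sets lebesgue" "A \<subseteq> \<Omega>"
      using \<Omega>L by (auto simp: sets_restrict_space_iff)
    obtain C Z where C: "gdelta C" "Z \<in> null_sets lebesgue" "A \<union> Z = C" "disjnt A Z"
      using lebesgue_set_almost_gdelta[OF AL(1)] by blast
    from C(1) obtain V :: "nat \<Rightarrow> 'a set" where V: "\<And>n. open (V n)" "C = (\<Inter>n. V n)"
      by (auto elim: gdelta.cases)
    \<comment> \<open>Finite intersections turn the open sets into a decreasing sequence with
      intersection C.\<close>
    let ?W = "\<lambda>n. \<Inter>j\<le>n. V j"
    have W: "open (?W n)" for n
      using V(1) by (intro open_INT) auto
    have CL: "C \<in> sets lebesgue"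
      using C(2,3) AL(1) by blast
    have "(\<lambda>n. \<integral>x. indicator (?W n) x * H x \<partial>?L) \<longlonglongrightarrow> (\<integral>x. indicator C x * H x \<partial>?L)"
    proof (rule integral_dominated_convergence[where w="\<lambda>x. \<bar>H x\<bar>"])
      show "(\<lambda>x. indicator C x * H x) \<in> borel_measurable ?L"
        by (intro borel_measurable_times ind CL) simp
      show "(\<lambda>x. indicator (?W n) x * H x) \<in> borel_measurable ?L" for n
        by (intro borel_measurable_times ind) (use W[of n] in auto)
      show "integrable ?L (\<lambda>x. \<bar>H x\<bar>)" using H by simp
      show "AE x in ?L. norm (indicator (?W n) x * H x) \<le> \<bar>H x\<bar>" for n
        by (intro AE_I2) (simp add: indicator_def)
      show "AE x in ?L. (\<lambda>n. indicator (?W n) x * H x) \<longlonglongrightarrow> indicator C x * H x"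
      proof (intro AE_I2 tendsto_mult tendsto_const)
        fix x
        have dec: "decseq ?W" by (auto simp: decseq_def)
        have "indicator C x = (indicator (\<Inter>n. ?W n) x :: real)"
          by (auto simp: V(2) indicator_def)
        then show "(\<lambda>n. indicator (?W n) x :: real) \<longlonglongrightarrow> indicator C x"
          by (simp only: LIMSEQ_indicator_decseq[OF dec])
      qed
    qed
    then have "(\<integral>x. indicator C x * H x \<partial>?L) = 0"
      using opn[OF W] by (simp add: LIMSEQ_const_iff)
    moreover have "(\<integral>x. indicator A x * H x \<partial>?L) = (\<integral>x. indicator C x * H x \<partial>?L)"
    proof (rule integral_cong_AE)
      show "(\<lambda>x. indicator A x * H x) \<in> borel_measurable ?L"
        by (intro borel_measurable_times ind AL) simp
      show "(\<lambda>x. indicator C x * H x) \<in> borel_measurable ?L"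
        by (intro borel_measurable_times ind CL) simp
      have "AE x in lebesgue. x \<notin> Z" using C(2) by (rule AE_not_in)
      then have "AE x in ?L. x \<notin> Z"
        using \<Omega>L by (subst AE_restrict_space_iff) auto
      then show "AE x in ?L. indicator A x * H x = indicator C x * H x"
        by eventually_elim (use C(3) in \<open>auto simp: indicator_def\<close>)
    qed
    ultimately show ?thesis
      by (simp add: set_lebesgue_integral_def)
  qed
  then show ?thesis
    by (rule density_zero[OF H])
qed

section \<open>Weak gradients and the Sobolev space of order one\<close>

lemma l2_space_of_continuous:
  fixes \<psi> :: "'a::euclidean_space \<Rightarrow> real"
  assumes \<Omega>: "open \<Omega>" "bounded \<Omega>" and \<psi>: "continuous_on UNIV \<psi>"
  shows "\<psi> \<in> l2_space (lebesgue_on \<Omega>)"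
proof -
  have \<Omega>L: "\<Omega> \<in> lmeasurable"
    using \<Omega> by (simp add: bounded_set_imp_lmeasurable)
  interpret finite_measure "lebesgue_on \<Omega>"
    using \<Omega>L by (rule finite_measure_lebesgue_on)
  have m: "\<psi> \<in> borel_measurable (lebesgue_on \<Omega>)"
    by (rule continuous_imp_measurable_on_sets_lebesgue) (use \<psi> \<Omega> in \<open>auto intro: continuous_on_subset\<close>)
  have "compact (\<psi> ` closure \<Omega>)"
    using \<Omega>(2) by (intro compact_continuous_image continuous_on_subset[OF \<psi>]) auto
  then obtain B where B: "\<And>x. x \<in> closure \<Omega> \<Longrightarrow> norm (\<psi> x) \<le> B"
    by (meson bounded_iff compact_imp_bounded imageI)
  have "integrable (lebesgue_on \<Omega>) (\<lambda>x. (\<psi> x)\<^sup>2)"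
  proof (rule integrable_const_bound[where B="B\<^sup>2"])
    show "AE x in lebesgue_on \<Omega>. norm ((\<psi> x)\<^sup>2) \<le> B\<^sup>2"
    proof (rule AE_I2)
      fix x assume "x \<in> space (lebesgue_on \<Omega>)"
      then have "norm (\<psi> x) \<le> B" using B closure_subset by fastforce
      from power_mono[OF this, of 2] show "norm ((\<psi> x)\<^sup>2) \<le> B\<^sup>2" by simp
    qed
  qed (use m in simp)
  with m show ?thesis by (simp add: l2_space_def)
qed

lemma l2_space_integrable:
  assumes "finite_measure M" "f \<in> l2_space M"
  shows "integrable M f"
proof -
  interpret finite_measure M by fact
  have "(\<lambda>x. 1) \<in> l2_space M" by (simp add: l2_space_def)
  from l2_space_prod_integrable[OF assms(2) this] show ?thesis by simp
qed

lemma GDERIV_continuous_on: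
  "(\<And>x. GDERIV \<phi> x :> d\<phi> x) \<Longrightarrow> continuous_on UNIV \<phi>"
  unfolding gderiv_def by (meson continuous_at_imp_continuous_on has_derivative_continuous)

lemma has_weak_gradientD:
  assumes "has_weak_gradient \<Omega> f G"
  shows "(\<lambda>x. G x $ i) \<in> l2_space (lebesgue_on \<Omega>)"
    and "(\<And>x. GDERIV \<phi> x :> d\<phi> x) \<Longrightarrow> continuous_on UNIV d\<phi> \<Longrightarrow> compact K \<Longrightarrow> K \<subseteq> \<Omega> \<Longrightarrow>
      (\<And>x. x \<notin> K \<Longrightarrow> \<phi> x = 0) \<Longrightarrow>
      (\<integral>x. f x * d\<phi> x $ i \<partial>lebesgue_on \<Omega>) = - (\<integral>x. G x $ i * \<phi> x \<partial>lebesgue_on \<Omega>)"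
  using assms unfolding has_weak_gradient_def by blast+

context
  fixes \<Omega> :: "(real ^ 'n) set"
  assumes \<Omega>: "open \<Omega>" "bounded \<Omega>"
begin

interpretation finite_measure "lebesgue_on \<Omega>"
  using \<Omega> by (intro finite_measure_lebesgue_on bounded_set_imp_lmeasurable) auto

text \<open>\<open>weak_gradient\<close> is an arbitrary choice, so its linearity almost everywhere,
  and with it the bilinearity of the Dirichlet form, rests on this.\<close>

lemma has_weak_gradient_unique:
  assumes G: "has_weak_gradient \<Omega> f G" and G': "has_weak_gradient \<Omega> f G'"
  shows "AE x in lebesgue_on \<Omega>. G x = G' x"
proof -
  have "AE x in lebesgue_on \<Omega>. G x $ i - G' x $ i = 0" for i
  proof (rule fundamental_lemma_variations[OF \<Omega>])
    note l2 = has_weak_gradientD(1)[OF G, of i] has_weak_gradientD(1)[OF G', of i]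
    show "integrable (lebesgue_on \<Omega>) (\<lambda>x. G x $ i - G' x $ i)"
      by (intro Bochner_Integration.integrable_diff l2_space_integrable l2 finite_measure_axioms)
    fix \<phi> d\<phi> K
    assume test: "\<And>x. GDERIV \<phi> x :> d\<phi> x" "continuous_on UNIV d\<phi>" "compact K" "K \<subseteq> \<Omega>"
      "\<And>x. x \<notin> K \<Longrightarrow> \<phi> x = 0"
    have \<phi>: "\<phi> \<in> l2_space (lebesgue_on \<Omega>)"
      by (rule l2_space_of_continuous[OF \<Omega> GDERIV_continuous_on[OF test(1)]])
    have "(\<integral>x. (G x $ i - G' x $ i) * \<phi> x \<partial>lebesgue_on \<Omega>) =
        (\<integral>x. G x $ i * \<phi> x \<partial>lebesgue_on \<Omega>) - (\<integral>x. G' x $ i * \<phi> x \<partial>lebesgue_on \<Omega>)"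
      using l2_space_prod_integrable[OF l2(1) \<phi>] l2_space_prod_integrable[OF l2(2) \<phi>]
      by (simp add: left_diff_distrib)
    then show "(\<integral>x. (G x $ i - G' x $ i) * \<phi> x \<partial>lebesgue_on \<Omega>) = 0"
      using has_weak_gradientD(2)[OF G test, of i] has_weak_gradientD(2)[OF G' test, of i] by simp
  qed
  then have "AE x in lebesgue_on \<Omega>. \<forall>i\<in>UNIV. G x $ i - G' x $ i = 0"
    by (intro AE_finite_allI) auto
  then show ?thesis
    by eventually_elim (simp add: vec_eq_iff)
qed

lemma has_weak_gradient_lin:
  assumes f: "f \<in> l2_space (lebesgue_on \<Omega>)" and G: "has_weak_gradient \<Omega> f G"
    and f': "f' \<in> l2_space (lebesgue_on \<Omega>)" and G': "has_weak_gradient \<Omega> f' G'"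
  shows "has_weak_gradient \<Omega> (\<lambda>x. r * f x + s * f' x) (\<lambda>x. r *\<^sub>R G x + s *\<^sub>R G' x)"
  unfolding has_weak_gradient_def
proof (intro conjI allI impI; (elim conjE)?)
  show "(\<lambda>x. (r *\<^sub>R G x + s *\<^sub>R G' x) $ i) \<in> l2_space (lebesgue_on \<Omega>)" for i
    using l2_space_lin[OF has_weak_gradientD(1)[OF G, of i] has_weak_gradientD(1)[OF G', of i], of r s] by simp
  fix \<phi> d\<phi> K i
  assume t: "\<forall>x. GDERIV \<phi> x :> d\<phi> x" "continuous_on UNIV d\<phi>" "compact K" "K \<subseteq> \<Omega>" "\<forall>x. x \<notin> K \<longrightarrow> \<phi> x = 0"
  then have test: "\<And>x. GDERIV \<phi> x :> d\<phi> x" "continuous_on UNIV d\<phi>" "compact K" "K \<subseteq> \<Omega>" "\<And>x. x \<notin> K \<Longrightarrow> \<phi> x = 0"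
    by blast+
  have \<phi>: "\<phi> \<in> l2_space (lebesgue_on \<Omega>)"
    by (rule l2_space_of_continuous[OF \<Omega> GDERIV_continuous_on[OF test(1)]])
  have d\<phi>: "(\<lambda>x. d\<phi> x $ i) \<in> l2_space (lebesgue_on \<Omega>)"
    by (intro l2_space_of_continuous[OF \<Omega>] continuous_intros test)
  have 1: "(\<integral>x. (r * f x + s * f' x) * d\<phi> x $ i \<partial>lebesgue_on \<Omega>) =
      r * (\<integral>x. f x * d\<phi> x $ i \<partial>lebesgue_on \<Omega>) + s * (\<integral>x. f' x * d\<phi> x $ i \<partial>lebesgue_on \<Omega>)"
    using l2.lin_left[OF f f' d\<phi>, of r s] by (simp only: l2_inner_def)
  have 2: "(\<integral>x. (r * G x $ i + s * G' x $ i) * \<phi> x \<partial>lebesgue_on \<Omega>) =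
      r * (\<integral>x. G x $ i * \<phi> x \<partial>lebesgue_on \<Omega>) + s * (\<integral>x. G' x $ i * \<phi> x \<partial>lebesgue_on \<Omega>)"
    using l2.lin_left[OF has_weak_gradientD(1)[OF G, of i] has_weak_gradientD(1)[OF G', of i] \<phi>, of r s]
    by (simp only: l2_inner_def)
  have 3: "(\<integral>x. f x * d\<phi> x $ i \<partial>lebesgue_on \<Omega>) = - (\<integral>x. G x $ i * \<phi> x \<partial>lebesgue_on \<Omega>)"
    by (rule has_weak_gradientD(2)[OF G test])
  have 4: "(\<integral>x. f' x * d\<phi> x $ i \<partial>lebesgue_on \<Omega>) = - (\<integral>x. G' x $ i * \<phi> x \<partial>lebesgue_on \<Omega>)"
    by (rule has_weak_gradientD(2)[OF G' test])
  show "(\<integral>x. (r * f x + s * f' x) * d\<phi> x $ i \<partial>lebesgue_on \<Omega>) =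
      - (\<integral>x. (r *\<^sub>R G x + s *\<^sub>R G' x) $ i * \<phi> x \<partial>lebesgue_on \<Omega>)"
    by (simp only: vector_add_component vector_scaleR_component real_scaleR_def 1 2 3 4)
qed

lemma weak_gradient_spec: "f \<in> h1_space \<Omega> \<Longrightarrow> has_weak_gradient \<Omega> f (weak_gradient \<Omega> f)"
  unfolding h1_space_def weak_gradient_def using someI_ex[of "has_weak_gradient \<Omega> f"] by blast

lemma h1_space_l2: "f \<in> h1_space \<Omega> \<Longrightarrow> f \<in> l2_space (lebesgue_on \<Omega>)"
  by (simp add: h1_space_def)

lemma h1_space_lin:
  assumes "u \<in> h1_space \<Omega>" "v \<in> h1_space \<Omega>"
  shows "(\<lambda>x. r * u x + s * v x) \<in> h1_space \<Omega>"
  using has_weak_gradient_lin[OF h1_space_l2[OF assms(1)] weak_gradient_spec[OF assms(1)]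
      h1_space_l2[OF assms(2)] weak_gradient_spec[OF assms(2)]]
    l2_space_lin[OF assms[THEN h1_space_l2]]
  unfolding h1_space_def by blast

lemma weak_gradient_lin:
  assumes "u \<in> h1_space \<Omega>" "v \<in> h1_space \<Omega>"
  shows "AE x in lebesgue_on \<Omega>. weak_gradient \<Omega> (\<lambda>x. r * u x + s * v x) x =
    r *\<^sub>R weak_gradient \<Omega> u x + s *\<^sub>R weak_gradient \<Omega> v x"
  by (rule has_weak_gradient_unique[OF weak_gradient_spec[OF h1_space_lin[OF assms]]
      has_weak_gradient_lin[OF h1_space_l2[OF assms(1)] weak_gradient_spec[OF assms(1)]
      h1_space_l2[OF assms(2)] weak_gradient_spec[OF assms(2)]]])

lemma dirichlet_form_integrable:
  assumes "u \<in> h1_space \<Omega>" "v \<in> h1_space \<Omega>"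
  shows "integrable (lebesgue_on \<Omega>) (\<lambda>x. weak_gradient \<Omega> u x \<bullet> weak_gradient \<Omega> v x)"
proof -
  have "integrable (lebesgue_on \<Omega>) (\<lambda>x. \<Sum>i\<in>UNIV. weak_gradient \<Omega> u x $ i * weak_gradient \<Omega> v x $ i)"
    by (intro Bochner_Integration.integrable_sum l2_space_prod_integrable
        has_weak_gradientD(1)[OF weak_gradient_spec] assms)
  then show ?thesis by (simp add: inner_vec_def)
qed

lemma dirichlet_form_lin_left:
  assumes "u \<in> h1_space \<Omega>" "v \<in> h1_space \<Omega>" "w \<in> h1_space \<Omega>"
  shows "dirichlet_form \<Omega> (\<lambda>x. r * u x + s * v x) w = r * dirichlet_form \<Omega> u w + s * dirichlet_form \<Omega> v w"
proof -
  note i = dirichlet_form_integrable[OF assms(1,3)] dirichlet_form_integrable[OF assms(2,3)]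
    dirichlet_form_integrable[OF h1_space_lin[OF assms(1,2)] assms(3), of r s]
  have "dirichlet_form \<Omega> (\<lambda>x. r * u x + s * v x) w =
      (\<integral>x. r * (weak_gradient \<Omega> u x \<bullet> weak_gradient \<Omega> w x) + s * (weak_gradient \<Omega> v x \<bullet> weak_gradient \<Omega> w x) \<partial>lebesgue_on \<Omega>)"
    unfolding dirichlet_form_def
  proof (rule integral_cong_AE)
    show "AE x in lebesgue_on \<Omega>. weak_gradient \<Omega> (\<lambda>x. r * u x + s * v x) x \<bullet> weak_gradient \<Omega> w x =
        r * (weak_gradient \<Omega> u x \<bullet> weak_gradient \<Omega> w x) + s * (weak_gradient \<Omega> v x \<bullet> weak_gradient \<Omega> w x)"
      using weak_gradient_lin[OF assms(1,2), of r s] by eventually_elim (simp add: inner_add_left)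
  qed (use i in auto)
  then show ?thesis
    using i by (simp add: dirichlet_form_def)
qed

lemma h1_semi_inner: "semi_inner (h1_space \<Omega>) (\<lambda>u v. l2_inner (lebesgue_on \<Omega>) u v + dirichlet_form \<Omega> u v)"
proof
  fix u v w :: "real ^ 'n \<Rightarrow> real" and r s :: real
  have "has_weak_gradient \<Omega> (\<lambda>x. 0) (\<lambda>x. 0)"
    by (simp add: has_weak_gradient_def l2_space_def)
  then show "(\<lambda>x. 0) \<in> h1_space \<Omega>"
    using l2.zero_in by (auto simp: h1_space_def)
  show "0 \<le> l2_inner (lebesgue_on \<Omega>) v v + dirichlet_form \<Omega> v v"
    by (simp add: l2_inner_def dirichlet_form_def)
  assume u: "u \<in> h1_space \<Omega>" and v: "v \<in> h1_space \<Omega>"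
  show "(\<lambda>x. r * u x + s * v x) \<in> h1_space \<Omega>" by (rule h1_space_lin[OF u v])
  show "l2_inner (lebesgue_on \<Omega>) u v + dirichlet_form \<Omega> u v = l2_inner (lebesgue_on \<Omega>) v u + dirichlet_form \<Omega> v u"
    by (simp add: l2_inner_def dirichlet_form_def mult.commute inner_commute)
  assume w: "w \<in> h1_space \<Omega>"
  show "l2_inner (lebesgue_on \<Omega>) (\<lambda>x. r * u x + s * v x) w + dirichlet_form \<Omega> (\<lambda>x. r * u x + s * v x) w =
      r * (l2_inner (lebesgue_on \<Omega>) u w + dirichlet_form \<Omega> u w) + s * (l2_inner (lebesgue_on \<Omega>) v w + dirichlet_form \<Omega> v w)"
    unfolding l2.lin_left[OF u[THEN h1_space_l2] v[THEN h1_space_l2] w[THEN h1_space_l2]]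
      dirichlet_form_lin_left[OF u v w] by (simp add: algebra_simps)
qed

lemma h1_norm_eq: "h1_norm \<Omega> = (\<lambda>v. sqrt (l2_inner (lebesgue_on \<Omega>) v v + dirichlet_form \<Omega> v v))"
  by (simp add: h1_norm_def fun_eq_iff)

lemma h1_seminormed: "seminormed (h1_space \<Omega>) (h1_norm \<Omega>)"
proof -
  interpret semi_inner "h1_space \<Omega>" "\<lambda>u v. l2_inner (lebesgue_on \<Omega>) u v + dirichlet_form \<Omega> u v"
    by (rule h1_semi_inner)
  show ?thesis unfolding h1_norm_eq by (rule seminormed_axioms)
qed

lemma l2_norm_le_h1_norm: "l2_norm (lebesgue_on \<Omega>) v \<le> h1_norm \<Omega> v"
  by (simp add: l2_norm_def h1_norm_def dirichlet_form_def)

end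

section \<open>The inner product of square-integrable functions of time\<close>

lemma L2_L2_inner_integrable:
  assumes "f \<in> L2_L2 T M" "g \<in> L2_L2 T M"
  shows "integrable (lebesgue_on {0<..<T}) (\<lambda>t. l2_inner M (f t) (g t))"
proof (rule bochner_l2_pairing_integrable[OF l2n.seminormed_axioms l2n.seminormed_axioms assms])
  fix a a' b b' :: "'a \<Rightarrow> real"
  assume a: "a \<in> l2_space M" and b: "b \<in> l2_space M"
  show "\<bar>l2_inner M a b\<bar> \<le> l2_norm M a * l2_norm M b"
    unfolding l2_norm_def by (rule l2.cauchy_schwarz[OF a b])
  show "l2_inner M (\<lambda>y. a y - a' y) b = l2_inner M a b - l2_inner M a' b" if "a' \<in> l2_space M"
    using l2.lin_left[OF a that b, of 1 "-1"] by simp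
  show "l2_inner M a (\<lambda>y. b y - b' y) = l2_inner M a b - l2_inner M a b'" if "b' \<in> l2_space M"
    using l2.lin_right[OF b that a, of 1 "-1"] by simp
qed

lemma L2_L2_inner_lin_left:
  assumes f: "f \<in> L2_L2 T M" and g: "g \<in> L2_L2 T M" and k: "k \<in> L2_L2 T M"
  shows "L2_L2_inner T M (\<lambda>t x. r * f t x + s * g t x) k = r * L2_L2_inner T M f k + s * L2_L2_inner T M g k"
proof -
  let ?L = "lebesgue_on {0<..<T}"
  have "(\<integral>t. l2_inner M (\<lambda>x. r * f t x + s * g t x) (k t) \<partial>?L) =
      (\<integral>t. r * l2_inner M (f t) (k t) + s * l2_inner M (g t) (k t) \<partial>?L)"
    by (rule Bochner_Integration.integral_cong[OF refl])
      (simp add: l2.lin_left[OF bochner_l2D(1)[OF f] bochner_l2D(1)[OF g] bochner_l2D(1)[OF k]])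
  then show ?thesis
    using L2_L2_inner_integrable[OF f k] L2_L2_inner_integrable[OF g k] by (simp add: L2_L2_inner_def)
qed

lemma L2_L2_inner_sym: "L2_L2_inner T M f g = L2_L2_inner T M g f"
  by (simp add: L2_L2_inner_def l2_inner_def mult.commute)

lemma L2_L2_inner_pos: "0 \<le> L2_L2_inner T M f f"
  by (simp add: L2_L2_inner_def l2_inner_def)

lemma L2_L2_zero: "(\<lambda>t x. 0) \<in> L2_L2 T M"
  by (rule bochner_l2_const[OF l2n.seminormed_axioms l2n.zero_mem])

text \<open>Uncurrying makes the time-dependent functions an instance of the general inner product spaces.\<close>

interpretation LL: semi_inner "{F. curry F \<in> L2_L2 T M}" "\<lambda>F G. L2_L2_inner T M (curry F) (curry G)" for T M
proof
  fix u v w :: "real \<times> 'a \<Rightarrow> real" and r s :: real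
  show "(\<lambda>x. 0) \<in> {F. curry F \<in> L2_L2 T M}"
    using L2_L2_zero by (simp add: curry_def)
  show "0 \<le> L2_L2_inner T M (curry v) (curry v)" by (rule L2_L2_inner_pos)
  show "L2_L2_inner T M (curry u) (curry v) = L2_L2_inner T M (curry v) (curry u)" by (rule L2_L2_inner_sym)
  assume u: "u \<in> {F. curry F \<in> L2_L2 T M}" and v: "v \<in> {F. curry F \<in> L2_L2 T M}"
  have eq: "curry (\<lambda>x. r * u x + s * v x) = (\<lambda>t x. r * curry u t x + s * curry v t x)"
    by (simp add: curry_def)
  show "(\<lambda>x. r * u x + s * v x) \<in> {F. curry F \<in> L2_L2 T M}"
    using u v by (auto simp only: eq mem_Collect_eq intro!: l2n.bochner_l2_lin)
  assume w: "w \<in> {F. curry F \<in> L2_L2 T M}"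
  show "L2_L2_inner T M (curry (\<lambda>x. r * u x + s * v x)) (curry w) =
      r * L2_L2_inner T M (curry u) (curry w) + s * L2_L2_inner T M (curry v) (curry w)"
    unfolding eq by (rule L2_L2_inner_lin_left) (use u v w in \<open>simp_all only: mem_Collect_eq\<close>)
qed

lemma L2_L2_cauchy_schwarz:
  assumes "f \<in> L2_L2 T M" "g \<in> L2_L2 T M"
  shows "\<bar>L2_L2_inner T M f g\<bar> \<le> L2_L2_norm T M f * L2_L2_norm T M g"
  using LL.cauchy_schwarz[of "case_prod f" T M "case_prod g"] assms by (simp add: L2_L2_norm_def)

lemma L2_L2_norm_sq: "(L2_L2_norm T M f)\<^sup>2 = L2_L2_inner T M f f"
  by (simp add: L2_L2_norm_def L2_L2_inner_pos)

lemma L2_L2_quad: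
  assumes "f \<in> L2_L2 T M" "g \<in> L2_L2 T M"
  shows "L2_L2_inner T M (\<lambda>t x. r * f t x + s * g t x) (\<lambda>t x. r * f t x + s * g t x) =
    r\<^sup>2 * L2_L2_inner T M f f + 2 * r * s * L2_L2_inner T M f g + s\<^sup>2 * L2_L2_inner T M g g"
  using LL.quad[of "case_prod f" T M "case_prod g" r s] assms by (simp add: curry_def)

lemma L2_L2_norm_sq_eq_integral: "(L2_L2_norm T M f)\<^sup>2 = (\<integral>t. (l2_norm M (f t))\<^sup>2 \<partial>lebesgue_on {0<..<T})"
  by (simp add: L2_L2_norm_sq L2_L2_inner_def l2_norm_def l2.pos l2_inner_def)

lemma L2_L2_inner_cong:
  assumes f: "f \<in> L2_L2 T M" and f': "f' \<in> L2_L2 T M" and g: "g \<in> L2_L2 T M" and g': "g' \<in> L2_L2 T M"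
    and eq: "time_ae_eq T M f f'" "time_ae_eq T M g g'"
  shows "L2_L2_inner T M f g = L2_L2_inner T M f' g'"
  unfolding L2_L2_inner_def
proof (rule integral_cong_AE)
  show "AE t in lebesgue_on {0<..<T}. l2_inner M (f t) (g t) = l2_inner M (f' t) (g' t)"
    using eq(1)[unfolded time_ae_eq_def] eq(2)[unfolded time_ae_eq_def] AE_space
  proof eventually_elim
    case (elim t)
    then have t: "t \<in> {0<..<T}" by simp
    show ?case
      by (intro l2_inner_cong_AE l2_space_measurable bochner_l2D(1)[OF f t] bochner_l2D(1)[OF f' t]
          bochner_l2D(1)[OF g t] bochner_l2D(1)[OF g' t] elim)
  qed
qed (intro borel_measurable_integrable L2_L2_inner_integrable assms)+

lemma time_ae_eq_refl: "time_ae_eq T M f f"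
  by (simp add: time_ae_eq_def)

text \<open>Translates between vanishing seminorm and equality of representatives; uniqueness of the
  minimizer and the optimality condition are both phrased by the latter.\<close>

lemma L2_L2_norm_0_iff:
  assumes f: "f \<in> L2_L2 T M"
  shows "L2_L2_inner T M f f = 0 \<longleftrightarrow> time_ae_eq T M f (\<lambda>t x. 0)"
proof
  assume "L2_L2_inner T M f f = 0"
  moreover have "L2_L2_inner T M f f = (\<integral>t. (l2_norm M (f t))\<^sup>2 \<partial>lebesgue_on {0<..<T})"
    using L2_L2_norm_sq_eq_integral[of T M f] by (simp add: L2_L2_norm_sq)
  ultimately have "AE t in lebesgue_on {0<..<T}. (l2_norm M (f t))\<^sup>2 = 0"
    using integral_nonneg_eq_0_iff_AE[OF bochner_l2D(2)[OF f]] by simp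
  then show "time_ae_eq T M f (\<lambda>t x. 0)"
    unfolding time_ae_eq_def using AE_space
    by eventually_elim (use bochner_l2D(1)[OF f] l2_norm_eq_0D in auto)
next
  assume "time_ae_eq T M f (\<lambda>t x. 0)"
  then have "L2_L2_inner T M f f = L2_L2_inner T M (\<lambda>t x. 0) (\<lambda>t x. 0)"
    by (intro L2_L2_inner_cong f L2_L2_zero)
  then show "L2_L2_inner T M f f = 0"
    by (simp add: L2_L2_inner_def l2_inner_def)
qed

section \<open>Minimization of uniformly convex functionals\<close>

lemma is_arg_min_iff: "is_arg_min J P q \<longleftrightarrow> P q \<and> (\<forall>y. P y \<longrightarrow> J q \<le> (J y :: real))"
  by (auto simp: is_arg_min_def not_less)

text \<open>Weak lower semicontinuity is not needed: by convexity, \<open>J\<close> lies above its tangents, and this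
  bounds the limit of a minimizing sequence.\<close>

lemma uniformly_convex_minimum_exists:
  assumes c: "0 < c" and nonneg: "\<And>q. q \<in> L2_L2 T M \<Longrightarrow> 0 \<le> J q"
    and G: "\<And>q. q \<in> L2_L2 T M \<Longrightarrow> G q \<in> L2_L2 T M"
    and convex: "\<And>q q'. q \<in> L2_L2 T M \<Longrightarrow> q' \<in> L2_L2 T M \<Longrightarrow>
      J q' \<ge> J q + L2_L2_inner T M (G q) (\<lambda>t x. q' t x - q t x) + c * (L2_L2_norm T M (\<lambda>t x. q' t x - q t x))\<^sup>2"
  shows "\<exists>q. is_arg_min J (\<lambda>q. q \<in> L2_L2 T M) q"
proof -
  define I where "I = (INF q\<in>L2_L2 T M. J q)"
  have bdd: "bdd_below (J ` L2_L2 T M)"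
    using nonneg by (auto intro!: bdd_belowI[where m=0])
  have Ile: "I \<le> J q" if "q \<in> L2_L2 T M" for q
    unfolding I_def by (rule cINF_lower[OF bdd that])
  have "\<exists>q\<in>L2_L2 T M. J q < I + 1 / real (Suc n)" for n
  proof -
    have "I < I + 1 / real (Suc n)" by simp
    moreover have "L2_L2 T M \<noteq> {}" using L2_L2_zero by blast
    ultimately show ?thesis
      unfolding I_def using cINF_less_iff[OF _ bdd] by blast
  qed
  then obtain q where q: "\<And>n. q n \<in> L2_L2 T M" "\<And>n. J (q n) < I + 1 / real (Suc n)"
    by metis
  \<comment> \<open>Adding the tangent inequalities at the midpoint cancels the linear terms, since
    f and g lie opposite each other. This is the parallelogram argument for minimizing
    sequences.\<close>
  have mid: "c / 2 * (L2_L2_norm T M (\<lambda>t x. f t x - g t x))\<^sup>2 \<le> J f + J g - 2 * I"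
    if f: "f \<in> L2_L2 T M" and g: "g \<in> L2_L2 T M" for f g
  proof -
    let ?m = "\<lambda>t x. 1/2 * f t x + 1/2 * g t x" and ?d = "\<lambda>t x. f t x - g t x"
    have m: "?m \<in> L2_L2 T M" by (rule l2n.bochner_l2_lin[OF f g])
    have d: "?d \<in> L2_L2 T M" by (rule l2n.bochner_l2_diff[OF f g])
    \<comment> \<open>The zero terms bring multiples of the difference into the two-term form of the
      linearity lemmas.\<close>
    have fm: "(\<lambda>t x. f t x - ?m t x) = (\<lambda>t x. 1/2 * ?d t x + 0 * ?d t x)"
      and gm: "(\<lambda>t x. g t x - ?m t x) = (\<lambda>t x. -1/2 * ?d t x + 0 * ?d t x)"
      by (auto simp: fun_eq_iff field_simps)
    let ?b = "L2_L2_inner T M (G ?m) ?d" and ?n = "L2_L2_inner T M ?d ?d"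
    have lin: "L2_L2_inner T M (G ?m) (\<lambda>t x. r * ?d t x + 0 * ?d t x) = r * ?b" for r
      using L2_L2_inner_lin_left[OF d d G[OF m], of r 0] by (simp add: L2_L2_inner_sym)
    have quad: "(L2_L2_norm T M (\<lambda>t x. r * ?d t x + 0 * ?d t x))\<^sup>2 = r\<^sup>2 * ?n" for r
      using L2_L2_quad[OF d d, of r 0] by (simp add: L2_L2_norm_sq)
    have "J f \<ge> J ?m + 1/2 * ?b + c * ((1/2)\<^sup>2 * ?n)"
      using convex[OF m f] by (simp only: fm lin quad)
    moreover have "J g \<ge> J ?m + (-1/2) * ?b + c * ((-1/2)\<^sup>2 * ?n)"
      using convex[OF m g] by (simp only: gm lin quad)
    moreover have "J ?m \<ge> I" by (rule Ile[OF m])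
    ultimately show ?thesis
      unfolding L2_L2_norm_sq by (simp add: power2_eq_square)
  qed
  have "\<exists>K. \<forall>m\<ge>K. \<forall>n\<ge>K. (\<integral>t. (l2_norm M (\<lambda>y. q m t y - q n t y))\<^sup>2 \<partial>lebesgue_on {0<..<T}) < e"
    if e: "e > 0" for e
  proof -
    \<comment> \<open>Two values within c e / 4 of the infimum make the right-hand side of
      \<open>mid\<close> less than c e / 2.\<close>
    obtain K :: nat where K: "1 / real (Suc K) < c * e / 4"
      by (rule nat_approx_posE[of "c * e / 4"]) (use c e in auto)
    have "(L2_L2_norm T M (\<lambda>t y. q m t y - q n t y))\<^sup>2 < e" if "m \<ge> K" "n \<ge> K" for m n
    proof -
      have "1 / real (Suc m) \<le> 1 / real (Suc K)" "1 / real (Suc n) \<le> 1 / real (Suc K)"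
        using that by (simp_all add: field_simps)
      then have "J (q m) < I + c * e / 4" "J (q n) < I + c * e / 4"
        using q(2)[of m] q(2)[of n] K by linarith+
      then have "c / 2 * (L2_L2_norm T M (\<lambda>t y. q m t y - q n t y))\<^sup>2 < c / 2 * e"
        using mid[OF q(1) q(1), of m n] by simp
      then show ?thesis using c by simp
    qed
    then show ?thesis
      unfolding L2_L2_norm_sq_eq_integral by blast
  qed
  then obtain \<sigma> l where \<sigma>: "strict_mono \<sigma>" and l: "l \<in> L2_L2 T M"
    and lim: "(\<lambda>k. \<integral>t. (l2_norm M (\<lambda>y. q (\<sigma> k) t y - l t y))\<^sup>2 \<partial>lebesgue_on {0<..<T}) \<longlonglongrightarrow> 0"
    by (rule l2n.bochner_l2_Cauchy_limit[OF l2_space_complete q(1)])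
  let ?d = "\<lambda>k. L2_L2_norm T M (\<lambda>t x. q (\<sigma> k) t x - l t x)"
  have "?d \<longlonglongrightarrow> 0"
  proof -
    have "(\<lambda>k. sqrt ((?d k)\<^sup>2)) \<longlonglongrightarrow> sqrt 0"
      using lim unfolding L2_L2_norm_sq_eq_integral by (rule tendsto_real_sqrt)
    then show ?thesis by (simp add: L2_L2_norm_def L2_L2_inner_pos)
  qed
  moreover have "(\<lambda>k. 1 / real (Suc k)) \<longlonglongrightarrow> 0"
    by (rule LIMSEQ_Suc[OF lim_1_over_n])
  then have "(\<lambda>k. 1 / real (Suc (\<sigma> k))) \<longlonglongrightarrow> 0"
    using LIMSEQ_subseq_LIMSEQ[OF _ \<sigma>] by (fastforce simp: comp_def)
  ultimately have "(\<lambda>k. I + 1 / real (Suc (\<sigma> k)) + L2_L2_norm T M (G l) * ?d k) \<longlonglongrightarrow> I + 0 + L2_L2_norm T M (G l) * 0"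
    by (intro tendsto_intros)
  \<comment> \<open>The gradient at l is fixed, so by Cauchy-Schwarz the linear term is at most a
    constant times the distance to l.\<close>
  moreover have "J l \<le> I + 1 / real (Suc (\<sigma> k)) + L2_L2_norm T M (G l) * ?d k" for k
  proof -
    have d: "(\<lambda>t x. q (\<sigma> k) t x - l t x) \<in> L2_L2 T M" by (rule l2n.bochner_l2_diff[OF q(1) l])
    have "0 \<le> c * (?d k)\<^sup>2" using c by simp
    then show ?thesis
      using convex[OF l q(1), of "\<sigma> k"] L2_L2_cauchy_schwarz[OF G[OF l] d] q(2)[of "\<sigma> k"] by linarith
  qed
  ultimately have "J l \<le> I"
    using LIMSEQ_le_const[of _ "I + 0 + L2_L2_norm T M (G l) * 0" "J l"] by simp
  then have "is_arg_min J (\<lambda>q. q \<in> L2_L2 T M) l"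
    unfolding is_arg_min_iff using Ile l order_trans by blast
  then show ?thesis by blast
qed

text \<open>In the direction -G the derivative is the negative squared norm of G, while right
  difference quotients at a minimum are nonnegative.\<close>

lemma gateaux_gradient_at_minimum:
  assumes grad: "has_gateaux_gradient T M J q Gq" and q: "q \<in> L2_L2 T M"
    and min: "is_arg_min J (\<lambda>q. q \<in> L2_L2 T M) q"
  shows "time_ae_eq T M Gq (\<lambda>t x. 0)"
proof -
  have G: "Gq \<in> L2_L2 T M" using grad by (simp add: has_gateaux_gradient_def)
  let ?h = "\<lambda>t x. -1 * Gq t x + 0 * Gq t x"
  have h: "?h \<in> L2_L2 T M" by (rule l2n.bochner_l2_lin[OF G G])
  have "((\<lambda>s. (J (\<lambda>t x. q t x + s * ?h t x) - J q) / s) \<longlongrightarrow> L2_L2_inner T M Gq ?h) (at 0)"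
    by (rule bspec[OF conjunct2[OF grad[unfolded has_gateaux_gradient_def]] h])
  then have lim: "((\<lambda>s. (J (\<lambda>t x. q t x + s * ?h t x) - J q) / s) \<longlongrightarrow> L2_L2_inner T M Gq ?h) (at_right 0)"
    by (rule tendsto_mono[OF at_le, rotated]) simp
  have "0 \<le> (J (\<lambda>t x. q t x + s * ?h t x) - J q) / s" if "s > 0" for s
  proof -
    have "(\<lambda>t x. 1 * q t x + s * ?h t x) \<in> L2_L2 T M" by (rule l2n.bochner_l2_lin[OF q h])
    then have "J q \<le> J (\<lambda>t x. q t x + s * ?h t x)"
      using min by (simp add: is_arg_min_iff)
    with that show ?thesis by simp
  qed
  then have "\<forall>\<^sub>F s in at_right 0. 0 \<le> (J (\<lambda>t x. q t x + s * ?h t x) - J q) / s"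
    by (auto simp: eventually_at_right_less eventually_at_filter)
  with lim have "0 \<le> L2_L2_inner T M Gq ?h"
    by (rule tendsto_lowerbound) simp
  also have "L2_L2_inner T M Gq ?h = - L2_L2_inner T M Gq Gq"
    using L2_L2_inner_lin_left[OF G G G, of "-1" 0] by (simp add: L2_L2_inner_sym)
  finally show ?thesis
    using L2_L2_norm_0_iff[OF G] L2_L2_inner_pos[of T M Gq] by simp
qed

section \<open>Traces and the Robin form\<close>

lemma AE_restrict_space_subset:
  assumes "AE x in restrict_space M A. P x" "B \<subseteq> A" "A \<in> sets M" "B \<in> sets M"
  shows "AE x in restrict_space M B. P x"
proof -
  have "AE x in M. x \<in> A \<longrightarrow> P x"
    using assms(1,3) by (simp add: AE_restrict_space_iff)
  then have "AE x in M. x \<in> B \<longrightarrow> P x"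
    by eventually_elim (use assms(2) in blast)
  then show ?thesis
    using assms(4) by (simp add: AE_restrict_space_iff)
qed

text \<open>\<open>trace_operator\<close> controls traces on the whole frontier; the equations use
  them on each boundary part separately.\<close>

lemma l2_space_restrict_subset:
  assumes f: "f \<in> l2_space (restrict_space M A)" and AB: "B \<subseteq> A" "A \<in> sets M" "B \<in> sets M"
  shows "f \<in> l2_space (restrict_space M B)"
    and "l2_norm (restrict_space M B) f \<le> l2_norm (restrict_space M A) f"
proof -
  have A: "A \<inter> space M \<in> sets M" and B: "B \<inter> space M \<in> sets M"
    using AB by auto
  have "restrict_space (restrict_space M A) B = restrict_space M B"
    using restrict_restrict_space[OF A B] AB(1) by (simp add: Int_absorb1)
  then have m: "f \<in> borel_measurable (restrict_space M B)"
    using measurable_restrict_space1[OF l2_space_measurable[OF f], of B] by simp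
  have iA: "set_integrable M A (\<lambda>x. (f x)\<^sup>2)"
    using f A by (simp add: l2_space_def integrable_restrict_space set_integrable_def)
  have iB: "set_integrable M B (\<lambda>x. (f x)\<^sup>2)"
    by (rule set_integrable_subset[OF iA AB(3,1)])
  then show fB: "f \<in> l2_space (restrict_space M B)"
    using m B by (simp add: l2_space_def integrable_restrict_space set_integrable_def)
  have "(\<integral>x. (f x)\<^sup>2 \<partial>restrict_space M B) \<le> (\<integral>x. (f x)\<^sup>2 \<partial>restrict_space M A)"
    unfolding integral_restrict_space[OF A] integral_restrict_space[OF B]
    by (rule integral_mono[OF iB[unfolded set_integrable_def] iA[unfolded set_integrable_def]])
      (use AB(1) in \<open>auto simp: indicator_def\<close>)
  then have "(l2_norm (restrict_space M B) f)\<^sup>2 \<le> (l2_norm (restrict_space M A) f)\<^sup>2"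
    by (simp add: l2_norm_sq)
  then show "l2_norm (restrict_space M B) f \<le> l2_norm (restrict_space M A) f"
    by (rule power2_le_imp_le) (rule l2n.nonneg[OF f])
qed

lemma sets_surface_measure: "sets surface_measure = sets borel"
  by (simp add: surface_measure_def sets.sigma_sets_eq[of borel, simplified])

text \<open>One boundary part at a time: the control problem takes two instances of this locale with
  the same domain and trace.\<close>

locale trace_domain =
  fixes \<Omega> \<Gamma> :: "(real ^ 'n) set" and tr :: "(real ^ 'n \<Rightarrow> real) \<Rightarrow> (real ^ 'n \<Rightarrow> real)"
  assumes \<Omega>: "open \<Omega>" "bounded \<Omega>" and \<Gamma>: "\<Gamma> \<subseteq> frontier \<Omega>" "\<Gamma> \<in> sets borel"
    and trace: "trace_operator \<Omega> tr"
begin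

lemma frontier_sets: "frontier \<Omega> \<in> sets surface_measure" and \<Gamma>_sets: "\<Gamma> \<in> sets surface_measure"
  using \<Gamma>(2) by (simp_all add: sets_surface_measure)

lemma trace_l2: "v \<in> h1_space \<Omega> \<Longrightarrow> tr v \<in> l2_space (surface_on \<Gamma>)"
  using trace l2_space_restrict_subset(1)[OF _ \<Gamma>(1) frontier_sets \<Gamma>_sets]
  unfolding trace_operator_def by blast

lemma trace_lin:
  assumes "u \<in> h1_space \<Omega>" "v \<in> h1_space \<Omega>"
  shows "AE x in surface_on \<Gamma>. tr (\<lambda>y. r * u y + s * v y) x = r * tr u x + s * tr v x"
proof (rule AE_restrict_space_subset[OF _ \<Gamma>(1) frontier_sets \<Gamma>_sets])
  show "AE x in surface_on (frontier \<Omega>). tr (\<lambda>y. r * u y + s * v y) x = r * tr u x + s * tr v x"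
    using trace assms unfolding trace_operator_def by blast
qed

lemma trace_bounded: "\<exists>C. \<forall>v\<in>h1_space \<Omega>. l2_norm (surface_on \<Gamma>) (tr v) \<le> C * h1_norm \<Omega> v"
proof -
  obtain C where C: "\<forall>v\<in>h1_space \<Omega>. l2_norm (surface_on (frontier \<Omega>)) (tr v) \<le> C * h1_norm \<Omega> v"
    using trace unfolding trace_operator_def by blast
  have "l2_norm (surface_on \<Gamma>) (tr v) \<le> C * h1_norm \<Omega> v" if v: "v \<in> h1_space \<Omega>" for v
  proof -
    have "tr v \<in> l2_space (surface_on (frontier \<Omega>))"
      using trace v unfolding trace_operator_def by blast
    from l2_space_restrict_subset(2)[OF this \<Gamma>(1) frontier_sets \<Gamma>_sets] C v show ?thesis
      by (meson order_trans)
  qed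
  then show ?thesis by blast
qed

lemma trace_inner_lin_left:
  assumes u: "u \<in> h1_space \<Omega>" and v: "v \<in> h1_space \<Omega>" and f: "f \<in> l2_space (surface_on \<Gamma>)"
  shows "l2_inner (surface_on \<Gamma>) (tr (\<lambda>x. r * u x + s * v x)) f =
    r * l2_inner (surface_on \<Gamma>) (tr u) f + s * l2_inner (surface_on \<Gamma>) (tr v) f"
proof -
  have "l2_inner (surface_on \<Gamma>) (tr (\<lambda>x. r * u x + s * v x)) f =
      l2_inner (surface_on \<Gamma>) (\<lambda>x. r * tr u x + s * tr v x) f"
    by (intro l2_inner_cong_AE trace_lin u v AE_I2 refl l2_space_measurable trace_l2 h1_space_lin[OF \<Omega>] f
        l2_space_lin)
  also have "\<dots> = r * l2_inner (surface_on \<Gamma>) (tr u) f + s * l2_inner (surface_on \<Gamma>) (tr v) f"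
    by (rule l2.lin_left[OF trace_l2[OF u] trace_l2[OF v] f])
  finally show ?thesis .
qed

lemma robin_form_lin_left:
  assumes u: "u \<in> h1_space \<Omega>" and v: "v \<in> h1_space \<Omega>" and w: "w \<in> h1_space \<Omega>"
  shows "robin_form \<Omega> \<Gamma> tr \<alpha> (\<lambda>x. r * u x + s * v x) w = r * robin_form \<Omega> \<Gamma> tr \<alpha> u w + s * robin_form \<Omega> \<Gamma> tr \<alpha> v w"
  unfolding robin_form_def dirichlet_form_lin_left[OF \<Omega> u v w] trace_inner_lin_left[OF u v trace_l2[OF w]]
  by (simp add: algebra_simps)

lemma robin_form_sym: "robin_form \<Omega> \<Gamma> tr \<alpha> u v = robin_form \<Omega> \<Gamma> tr \<alpha> v u"
  by (simp add: robin_form_def dirichlet_form_def l2_inner_def inner_commute mult.commute)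

text \<open>Places the trace of the adjoint state in the control space. The trace of a difference
  agrees with the difference of traces almost everywhere, which is enough for the norm
  estimate.\<close>

lemma trace_bochner:
  assumes p: "p \<in> L2_H1 T \<Omega>"
  shows "(\<lambda>t. tr (p t)) \<in> L2_L2 T (surface_on \<Gamma>)"
proof -
  obtain C where C: "\<forall>v\<in>h1_space \<Omega>. l2_norm (surface_on \<Gamma>) (tr v) \<le> C * h1_norm \<Omega> v"
    using trace_bounded by blast
  show ?thesis
  proof (rule bochner_l2_map[OF h1_seminormed[OF \<Omega>] l2n.seminormed_axioms p])
    show "tr v \<in> l2_space (surface_on \<Gamma>)" if "v \<in> h1_space \<Omega>" for v by (rule trace_l2[OF that])
    show "l2_norm (surface_on \<Gamma>) (tr v) \<le> C * h1_norm \<Omega> v" if "v \<in> h1_space \<Omega>" for v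
      using C that by blast
    fix u v assume u: "u \<in> h1_space \<Omega>" and v: "v \<in> h1_space \<Omega>"
    have d: "(\<lambda>x. u x - v x) \<in> h1_space \<Omega>"
      using h1_space_lin[OF \<Omega> u v, of 1 "-1"] by simp
    have "AE x in surface_on \<Gamma>. tr u x - tr v x = tr (\<lambda>x. u x - v x) x"
      using trace_lin[OF u v, of 1 "-1"] by (simp add: eq_commute)
    then have "l2_norm (surface_on \<Gamma>) (\<lambda>x. tr u x - tr v x) = l2_norm (surface_on \<Gamma>) (tr (\<lambda>x. u x - v x))"
      unfolding l2_norm_def
      by (intro arg_cong[where f=sqrt] l2_inner_cong_AE l2_space_measurable l2n.diff_mem trace_l2 u v d)
    then show "l2_norm (surface_on \<Gamma>) (\<lambda>y. tr u y - tr v y) \<le> C * h1_norm \<Omega> (\<lambda>y. u y - v y)"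
      using C d by auto
  qed
qed

end

lemma L2_H1_imp_L2_L2:
  assumes \<Omega>: "open \<Omega>" "bounded \<Omega>" and u: "u \<in> L2_H1 T \<Omega>"
  shows "u \<in> L2_L2 T (lebesgue_on \<Omega>)"
  by (rule bochner_l2_map[OF h1_seminormed[OF \<Omega>] l2n.seminormed_axioms u, where C=1 and \<Phi>="\<lambda>v. v"])
    (auto intro: h1_space_l2[OF \<Omega>] simp: l2_norm_le_h1_norm[OF \<Omega>])

section \<open>Linear combinations of weak solutions\<close>

lemma integrable_mult_continuous:
  fixes g \<phi> :: "real \<Rightarrow> real"
  assumes g: "integrable (lebesgue_on {0<..<T}) g" and \<phi>: "continuous_on UNIV \<phi>"
  shows "integrable (lebesgue_on {0<..<T}) (\<lambda>t. g t * \<phi> t)"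
proof -
  have "compact (\<phi> ` {0..T})"
    by (intro compact_continuous_image continuous_on_subset[OF \<phi>]) auto
  then obtain B where B: "\<And>t. t \<in> {0..T} \<Longrightarrow> norm (\<phi> t) \<le> B"
    by (meson bounded_iff compact_imp_bounded imageI)
  have m: "\<phi> \<in> borel_measurable (lebesgue_on {0<..<T})"
    by (rule borel_measurable_integrable[OF time_integral_continuous(1)[OF continuous_on_subset[OF \<phi>]]]) simp
  show ?thesis
  proof (rule integrable_of_abs_le)
    show "integrable (lebesgue_on {0<..<T}) (\<lambda>t. \<bar>g t\<bar> * B)"
      using g by auto
    show "(\<lambda>t. g t * \<phi> t) \<in> borel_measurable (lebesgue_on {0<..<T})"
      by (intro borel_measurable_times m borel_measurable_integrable[OF g])
    show "AE t in lebesgue_on {0<..<T}. \<bar>g t * \<phi> t\<bar> \<le> \<bar>g t\<bar> * B"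
    proof (rule AE_I2)
      fix t assume "t \<in> space (lebesgue_on {0<..<T})"
      then have "\<bar>\<phi> t\<bar> \<le> B" using B[of t] by simp
      then show "\<bar>g t * \<phi> t\<bar> \<le> \<bar>g t\<bar> * B"
        unfolding abs_mult by (rule mult_left_mono) simp
    qed
  qed
qed

lemma weak_time_derivative_lin:
  assumes i: "integrable (lebesgue_on {0<..<T}) f" "integrable (lebesgue_on {0<..<T}) f'"
    "integrable (lebesgue_on {0<..<T}) g" "integrable (lebesgue_on {0<..<T}) g'"
    and w: "weak_time_derivative T f g" and w': "weak_time_derivative T f' g'"
  shows "weak_time_derivative T (\<lambda>t. a * f t + c * f' t) (\<lambda>t. a * g t + c * g' t)"
  unfolding weak_time_derivative_def
proof (intro allI impI; elim conjE)
  fix \<phi> d\<phi> :: "real \<Rightarrow> real" and K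
  assume D: "\<forall>t. (\<phi> has_real_derivative d\<phi> t) (at t)" and cd: "continuous_on UNIV d\<phi>"
    and K: "compact K" "K \<subseteq> {0<..<T}" "\<forall>t. t \<notin> K \<longrightarrow> \<phi> t = 0"
  let ?L = "lebesgue_on {0<..<T}"
  have c: "continuous_on UNIV \<phi>"
    using D by (meson DERIV_continuous_on has_field_derivative_at_within)
  have e: "(\<integral>t. g t * \<phi> t \<partial>?L) = - (\<integral>t. f t * d\<phi> t \<partial>?L)"
    "(\<integral>t. g' t * \<phi> t \<partial>?L) = - (\<integral>t. f' t * d\<phi> t \<partial>?L)"
  proof -
    have test: "(\<forall>t. (\<phi> has_real_derivative d\<phi> t) (at t)) \<and> continuous_on UNIV d\<phi> \<and>
        compact K \<and> K \<subseteq> {0<..<T} \<and> (\<forall>t. t \<notin> K \<longrightarrow> \<phi> t = 0)"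
      by (intro conjI D cd K)
    show "(\<integral>t. g t * \<phi> t \<partial>?L) = - (\<integral>t. f t * d\<phi> t \<partial>?L)"
      by (rule w[unfolded weak_time_derivative_def, THEN spec, THEN spec, THEN spec, THEN mp, OF test])
    show "(\<integral>t. g' t * \<phi> t \<partial>?L) = - (\<integral>t. f' t * d\<phi> t \<partial>?L)"
      by (rule w'[unfolded weak_time_derivative_def, THEN spec, THEN spec, THEN spec, THEN mp, OF test])
  qed
  have lin: "(\<integral>t. (a * h t + c * h' t) * \<psi> t \<partial>?L) = a * (\<integral>t. h t * \<psi> t \<partial>?L) + c * (\<integral>t. h' t * \<psi> t \<partial>?L)"
    if "integrable ?L h" "integrable ?L h'" "continuous_on UNIV \<psi>" for h h' \<psi> :: "real \<Rightarrow> real"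
  proof -
    have "(\<lambda>t. (a * h t + c * h' t) * \<psi> t) = (\<lambda>t. a * (h t * \<psi> t) + c * (h' t * \<psi> t))"
      by (simp add: algebra_simps)
    then show ?thesis
      using integrable_mult_continuous[OF that(1,3)] integrable_mult_continuous[OF that(2,3)] by simp
  qed
  show "(\<integral>t. (a * g t + c * g' t) * \<phi> t \<partial>?L) = - (\<integral>t. (a * f t + c * f' t) * d\<phi> t \<partial>?L)"
    unfolding lin[OF i(1,2) cd] lin[OF i(3,4) c] e by simp
qed

lemma has_time_derivative_iff:
  "has_time_derivative T \<Omega> u du \<longleftrightarrow>
    (\<forall>v\<in>h1_space \<Omega>. weak_time_derivative T (\<lambda>t. l2_inner (lebesgue_on \<Omega>) (u t) v) (\<lambda>t. du t v))"
  unfolding has_time_derivative_def weak_time_derivative_def by blast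

lemma has_value_at_iff:
  "has_value_at T \<Omega> u \<tau> w \<longleftrightarrow> (\<exists>c. l2_continuous T (lebesgue_on \<Omega>) c \<and>
     time_ae_eq T (lebesgue_on \<Omega>) u c \<and> (AE x in lebesgue_on \<Omega>. c \<tau> x = w x))"
  unfolding has_value_at_def l2_continuous_def by blast

lemma l2_continuous_lin:
  assumes c: "l2_continuous T M c" and d: "l2_continuous T M d"
  shows "l2_continuous T M (\<lambda>t x. a * c t x + b * d t x)"
  unfolding l2_continuous_def
proof (intro conjI ballI)
  have cL: "c t \<in> l2_space M" and dL: "d t \<in> l2_space M" if "t \<in> {0..T}" for t
    using c d that by (auto simp: l2_continuous_def)
  show "(\<lambda>x. a * c t x + b * d t x) \<in> l2_space M" if "t \<in> {0..T}" for t
    by (intro l2_space_lin cL dL that)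
  fix s assume s: "s \<in> {0..T}"
  let ?F = "at s within {0..T}"
  let ?g = "\<lambda>t. \<bar>a\<bar> * l2_norm M (\<lambda>x. c t x - c s x) + \<bar>b\<bar> * l2_norm M (\<lambda>x. d t x - d s x)"
  have "(?g \<longlongrightarrow> \<bar>a\<bar> * 0 + \<bar>b\<bar> * 0) ?F"
    using c d s by (intro tendsto_intros) (auto simp: l2_continuous_def)
  then have lim: "(?g \<longlongrightarrow> 0) ?F" by simp
  have "\<forall>\<^sub>F t in ?F. t \<in> {0..T}"
    by (auto simp: eventually_at_filter)
  then have "\<forall>\<^sub>F t in ?F. norm (l2_norm M (\<lambda>x. (a * c t x + b * d t x) - (a * c s x + b * d s x))) \<le> ?g t"
  proof eventually_elim
    case (elim t)
    have eq: "(\<lambda>x. (a * c t x + b * d t x) - (a * c s x + b * d s x)) =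
        (\<lambda>x. a * (c t x - c s x) + b * (d t x - d s x))"
      by (simp add: algebra_simps)
    have m: "(\<lambda>x. c t x - c s x) \<in> l2_space M" "(\<lambda>x. d t x - d s x) \<in> l2_space M"
      by (intro l2n.diff_mem cL dL elim s)+
    show ?case
      unfolding eq real_norm_def abs_of_nonneg[OF l2n.nonneg[OF l2_space_lin[OF m]]]
      by (rule l2n.norm_lin_le[OF m])
  qed
  then show "((\<lambda>t. l2_norm M (\<lambda>x. (a * c t x + b * d t x) - (a * c s x + b * d s x))) \<longlongrightarrow> 0) ?F"
    by (rule Lim_null_comparison[OF _ lim])
qed

lemma time_ae_eq_lin:
  assumes "time_ae_eq T M f f'" "time_ae_eq T M g g'"
  shows "time_ae_eq T M (\<lambda>t x. a * f t x + b * g t x) (\<lambda>t x. a * f' t x + b * g' t x)"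
  using assms(1)[unfolded time_ae_eq_def] assms(2)[unfolded time_ae_eq_def] unfolding time_ae_eq_def
proof eventually_elim
  case (elim t)
  then show ?case by eventually_elim simp
qed

lemma has_value_at_lin:
  assumes "has_value_at T \<Omega> u \<tau> w" "has_value_at T \<Omega> u' \<tau> w'"
  shows "has_value_at T \<Omega> (\<lambda>t x. a * u t x + b * u' t x) \<tau> (\<lambda>x. a * w x + b * w' x)"
proof -
  obtain c where c: "l2_continuous T (lebesgue_on \<Omega>) c" "time_ae_eq T (lebesgue_on \<Omega>) u c"
    "AE x in lebesgue_on \<Omega>. c \<tau> x = w x"
    using assms(1) unfolding has_value_at_iff by blast
  obtain d where d: "l2_continuous T (lebesgue_on \<Omega>) d" "time_ae_eq T (lebesgue_on \<Omega>) u' d"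
    "AE x in lebesgue_on \<Omega>. d \<tau> x = w' x"
    using assms(2) unfolding has_value_at_iff by blast
  have "AE x in lebesgue_on \<Omega>. a * c \<tau> x + b * d \<tau> x = a * w x + b * w' x"
    using c(3) d(3) by eventually_elim simp
  with l2_continuous_lin[OF c(1) d(1)] time_ae_eq_lin[OF c(2) d(2)] show ?thesis
    unfolding has_value_at_iff by blast
qed

lemma time_ae_eq_trans:
  assumes "time_ae_eq T M f g" "time_ae_eq T M g h"
  shows "time_ae_eq T M f h"
  using assms[unfolded time_ae_eq_def] unfolding time_ae_eq_def
proof eventually_elim
  case (elim t)
  then show ?case by eventually_elim simp
qed

lemma time_ae_eq_sym: "time_ae_eq T M f g \<Longrightarrow> time_ae_eq T M g f"
  unfolding time_ae_eq_def by (simp only: eq_commute)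

lemma unique_solution_eq:
  assumes "unique_solution T \<Omega> P" "P u" "P w"
  shows "time_ae_eq T (lebesgue_on \<Omega>) u w"
  using assms unfolding unique_solution_def by (meson time_ae_eq_trans time_ae_eq_sym)

section \<open>The boundary control problem\<close>

text \<open>Existence and uniqueness enter as assumptions for each admissible control; the adjoint
  problem is driven by the state that \<open>SOME\<close> selects for that control.\<close>

locale boundary_control =
  G1: trace_domain \<Omega> \<Gamma>1 tr + G2: trace_domain \<Omega> \<Gamma>2 tr
  for \<Omega> \<Gamma>1 \<Gamma>2 :: "(real ^ 'n) set" and tr +
  fixes T M \<alpha> :: real and g z :: "real \<Rightarrow> real ^ 'n \<Rightarrow> real" and b v\<^sub>b :: "real ^ 'n \<Rightarrow> real"
  assumes T: "0 < T" and M: "0 < M"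
    and z: "z \<in> L2_L2 T (lebesgue_on \<Omega>)"
    and state_solvable: "\<And>q. q \<in> L2_L2 T (surface_on \<Gamma>2) \<Longrightarrow>
      unique_solution T \<Omega> (is_state \<Omega> \<Gamma>1 \<Gamma>2 tr T \<alpha> g b v\<^sub>b q)"
    and adjoint_solvable: "\<And>q. q \<in> L2_L2 T (surface_on \<Gamma>2) \<Longrightarrow>
      unique_solution T \<Omega> (is_adjoint_state \<Omega> \<Gamma>1 tr T \<alpha> z (state \<Omega> \<Gamma>1 \<Gamma>2 tr T \<alpha> g b v\<^sub>b q))"
begin

abbreviation "X \<equiv> h1_space \<Omega>"
abbreviation "LO \<equiv> lebesgue_on \<Omega>"
abbreviation "Q \<equiv> L2_L2 T (surface_on \<Gamma>2)"
abbreviation "time \<equiv> lebesgue_on {0<..<T}"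
abbreviation "S \<equiv> state \<Omega> \<Gamma>1 \<Gamma>2 tr T \<alpha> g b v\<^sub>b"
abbreviation "A \<equiv> adjoint_state \<Omega> \<Gamma>1 \<Gamma>2 tr T \<alpha> g b v\<^sub>b z"
abbreviation "sol \<equiv> is_state \<Omega> \<Gamma>1 \<Gamma>2 tr T \<alpha> g b v\<^sub>b"
abbreviation "J \<equiv> cost \<Omega> \<Gamma>1 \<Gamma>2 tr T \<alpha> g b v\<^sub>b z M"
abbreviation "robin \<equiv> robin_form \<Omega> \<Gamma>1 tr \<alpha>"

text \<open>Affine rather than linear in q because of the fixed data g and b.\<close>

definition load :: "(real \<Rightarrow> real ^ 'n \<Rightarrow> real) \<Rightarrow> real \<Rightarrow> (real ^ 'n \<Rightarrow> real) \<Rightarrow> real" where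
  "load q t v = l2_inner LO (g t) v - l2_inner (surface_on \<Gamma>2) (q t) (tr v) + \<alpha> * l2_inner (surface_on \<Gamma>1) b (tr v)"

section \<open>Affine dependence of the state on the control\<close>

sublocale H1: seminormed X "h1_norm \<Omega>"
  by (rule h1_seminormed[OF G1.\<Omega>])

lemma X_l2: "v \<in> X \<Longrightarrow> v \<in> l2_space LO"
  by (rule h1_space_l2[OF G1.\<Omega>])

text \<open>The coefficients are left free for two uses: with sum one they give affine dependence on
  the control, and 1 with -1 gives the equation of the difference of two states, with initial value
  zero.\<close>

lemma sol_lin:
  assumes u: "sol q u" and u': "sol q' u'"
  shows "(\<lambda>t x. a * u t x + c * u' t x) \<in> L2_H1 T \<Omega>"
    and "has_value_at T \<Omega> (\<lambda>t x. a * u t x + c * u' t x) 0 (\<lambda>x. a * v\<^sub>b x + c * v\<^sub>b x)"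
    and "\<exists>dw\<in>L2_H1_dual T \<Omega>. has_time_derivative T \<Omega> (\<lambda>t x. a * u t x + c * u' t x) dw \<and>
      (AE t in time. \<forall>v\<in>X. dw t v + robin (\<lambda>x. a * u t x + c * u' t x) v = a * load q t v + c * load q' t v)"
proof -
  let ?w = "\<lambda>t x. a * u t x + c * u' t x"
  have uB: "u \<in> L2_H1 T \<Omega>" and u'B: "u' \<in> L2_H1 T \<Omega>"
    using u u' by (simp_all add: is_state_def)
  show "?w \<in> L2_H1 T \<Omega>" by (rule H1.bochner_l2_lin[OF uB u'B])
  show "has_value_at T \<Omega> ?w 0 (\<lambda>x. a * v\<^sub>b x + c * v\<^sub>b x)"
    using u u' by (intro has_value_at_lin) (simp_all add: is_state_def)
  obtain du where du: "du \<in> L2_H1_dual T \<Omega>" "has_time_derivative T \<Omega> u du"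
    "AE t in time. \<forall>v\<in>X. du t v + robin (u t) v = load q t v"
    using u unfolding is_state_def load_def by blast
  obtain du' where du': "du' \<in> L2_H1_dual T \<Omega>" "has_time_derivative T \<Omega> u' du'"
    "AE t in time. \<forall>v\<in>X. du' t v + robin (u' t) v = load q' t v"
    using u' unfolding is_state_def load_def by blast
  let ?dw = "\<lambda>t v. a * du t v + c * du' t v"
  have "?dw \<in> L2_H1_dual T \<Omega>"
    by (rule seminormed.bochner_l2_lin[OF H1.dual_seminormed du(1) du'(1)])
  moreover have "has_time_derivative T \<Omega> ?w ?dw"
    unfolding has_time_derivative_iff
  proof
    fix v assume v: "v \<in> X"
    have const: "(\<lambda>t. v) \<in> L2_L2 T LO"
      by (rule bochner_l2_const[OF l2n.seminormed_axioms X_l2[OF v]])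
    note iu = L2_L2_inner_integrable[OF L2_H1_imp_L2_L2[OF G1.\<Omega> uB] const]
      and iu' = L2_L2_inner_integrable[OF L2_H1_imp_L2_L2[OF G1.\<Omega> u'B] const]
    let ?f = "\<lambda>t. a * l2_inner LO (u t) v + c * l2_inner LO (u' t) v"
    have "weak_time_derivative T ?f (\<lambda>t. ?dw t v)"
      using du(2) du'(2) v unfolding has_time_derivative_iff
      by (intro weak_time_derivative_lin iu iu' H1.duality_const_integrable[OF du(1) v]
          H1.duality_const_integrable[OF du'(1) v]) auto
    moreover have eq: "l2_inner LO (?w t) v = ?f t" if "t \<in> {0<..<T}" for t
      by (rule l2.lin_left[OF X_l2[OF bochner_l2D(1)[OF uB that]] X_l2[OF bochner_l2D(1)[OF u'B that]] X_l2[OF v]])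
    \<comment> \<open>Linearity of the inner product is available for t in (0,T) only, so it is
      applied under the integral and not to the functions.\<close>
    have "(\<integral>t. l2_inner LO (?w t) v * d\<phi> t \<partial>time) = (\<integral>t. ?f t * d\<phi> t \<partial>time)" for d\<phi>
      by (rule Bochner_Integration.integral_cong) (simp_all add: eq)
    ultimately show "weak_time_derivative T (\<lambda>t. l2_inner LO (?w t) v) (\<lambda>t. ?dw t v)"
      unfolding weak_time_derivative_def by (simp only:)
  qed
  moreover have "AE t in time. \<forall>v\<in>X. ?dw t v + robin (?w t) v = a * load q t v + c * load q' t v"
    using du(3) du'(3) AE_space
  proof eventually_elim
    case (elim t)
    then have t: "t \<in> {0<..<T}" by simp
    show ?case
    proof
      fix v assume v: "v \<in> X"
      have "?dw t v + robin (?w t) v = a * (du t v + robin (u t) v) + c * (du' t v + robin (u' t) v)"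
        unfolding G1.robin_form_lin_left[OF bochner_l2D(1)[OF uB t] bochner_l2D(1)[OF u'B t] v]
        by (simp add: algebra_simps)
      also have "\<dots> = a * load q t v + c * load q' t v"
        using elim(1,2) v by simp
      finally show "?dw t v + robin (?w t) v = a * load q t v + c * load q' t v" .
    qed
  qed
  ultimately show "\<exists>dw\<in>L2_H1_dual T \<Omega>. has_time_derivative T \<Omega> ?w dw \<and>
      (AE t in time. \<forall>v\<in>X. dw t v + robin (?w t) v = a * load q t v + c * load q' t v)"
    by blast
qed

lemma load_lin:
  assumes q: "q \<in> Q" and q': "q' \<in> Q" and t: "t \<in> {0<..<T}" and v: "v \<in> X"
  shows "l2_inner (surface_on \<Gamma>2) (\<lambda>x. a * q t x + c * q' t x) (tr v) =
    a * l2_inner (surface_on \<Gamma>2) (q t) (tr v) + c * l2_inner (surface_on \<Gamma>2) (q' t) (tr v)"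
  by (rule l2.lin_left[OF bochner_l2D(1)[OF q t] bochner_l2D(1)[OF q' t] G2.trace_l2[OF v]])

text \<open>Coefficients with sum one reproduce the terms with g and b and the initial value
  \<open>v\<^sub>b\<close>.\<close>

lemma sol_affine:
  assumes q: "q \<in> Q" and q': "q' \<in> Q" and u: "sol q u" and u': "sol q' u'" and ac: "a + c = 1"
  shows "sol (\<lambda>t x. a * q t x + c * q' t x) (\<lambda>t x. a * u t x + c * u' t x)"
proof -
  let ?w = "\<lambda>t x. a * u t x + c * u' t x" and ?q = "\<lambda>t x. a * q t x + c * q' t x"
  obtain dw where dw: "dw \<in> L2_H1_dual T \<Omega>" "has_time_derivative T \<Omega> ?w dw"
    "AE t in time. \<forall>v\<in>X. dw t v + robin (?w t) v = a * load q t v + c * load q' t v"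
    using sol_lin(3)[OF u u'] by blast
  have one: "a * x + c * x = x" for x
    using ac by (metis distrib_right mult_1)
  have "AE t in time. \<forall>v\<in>X. dw t v + robin (?w t) v = load ?q t v"
    using dw(3) AE_space
  proof eventually_elim
    case (elim t)
    then have t: "t \<in> {0<..<T}" by simp
    show ?case
    proof
      fix v assume v: "v \<in> X"
      have "load ?q t v = (a * l2_inner LO (g t) v + c * l2_inner LO (g t) v)
          - l2_inner (surface_on \<Gamma>2) (?q t) (tr v)
          + \<alpha> * (a * l2_inner (surface_on \<Gamma>1) b (tr v) + c * l2_inner (surface_on \<Gamma>1) b (tr v))"
        by (simp only: load_def one)
      also have "\<dots> = a * load q t v + c * load q' t v"
        unfolding load_lin[OF q q' t v] load_def by (simp add: algebra_simps)
      finally show "dw t v + robin (?w t) v = load ?q t v"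
        using elim(1) v by simp
    qed
  qed
  moreover have "has_value_at T \<Omega> ?w 0 v\<^sub>b"
    using sol_lin(2)[OF u u', of a c] by (simp only: one)
  ultimately show ?thesis
    unfolding is_state_def load_def using sol_lin(1)[OF u u'] dw(1,2) by blast
qed

section \<open>Chosen solutions and the adjoint identity\<close>

lemma state_sol: "q \<in> Q \<Longrightarrow> sol q (S q)"
  using state_solvable[of q] someI_ex[of "sol q"] unfolding unique_solution_def state_def by blast

lemma adjoint_sol: "q \<in> Q \<Longrightarrow> is_adjoint_state \<Omega> \<Gamma>1 tr T \<alpha> z (S q) (A q)"
  using adjoint_solvable[of q] someI_ex[of "is_adjoint_state \<Omega> \<Gamma>1 tr T \<alpha> z (S q)"]
  unfolding unique_solution_def adjoint_state_def by blast

lemma state_H1: "q \<in> Q \<Longrightarrow> S q \<in> L2_H1 T \<Omega>"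
  using state_sol[of q] by (simp add: is_state_def)

lemma state_L2: "q \<in> Q \<Longrightarrow> S q \<in> L2_L2 T LO"
  by (rule L2_H1_imp_L2_L2[OF G1.\<Omega> state_H1])

lemma adjoint_H1: "q \<in> Q \<Longrightarrow> A q \<in> L2_H1 T \<Omega>"
  using adjoint_sol[of q] by (simp add: is_adjoint_state_def)

text \<open>The fundamental theorem asks for a continuous function. The weak identity sees u only
  through integrals, so it survives the passage to the representative in C([0,T];L^2).\<close>

lemma weak_time_derivative_continuous_rep:
  assumes u: "u \<in> L2_H1 T \<Omega>" and d: "has_time_derivative T \<Omega> u du"
    and c: "l2_continuous T LO c" and eq: "time_ae_eq T LO u c" and v: "v \<in> X"
  shows "weak_time_derivative T (\<lambda>t. l2_inner LO (c t) v) (\<lambda>t. du t v)"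
proof -
  have ae: "AE t in time. l2_inner LO (u t) v = l2_inner LO (c t) v"
    using eq[unfolded time_ae_eq_def] AE_space
  proof eventually_elim
    case (elim t)
    then have t: "t \<in> {0<..<T}" by simp
    have ct: "c t \<in> l2_space LO" using c t by (simp add: l2_continuous_def)
    show ?case
      by (rule l2_inner_cong_AE[OF l2_space_measurable[OF X_l2[OF bochner_l2D(1)[OF u t]]]
            l2_space_measurable[OF ct] l2_space_measurable[OF X_l2[OF v]]
            l2_space_measurable[OF X_l2[OF v]] elim(1)]) simp
  qed
  have const: "(\<lambda>t. v) \<in> L2_L2 T LO"
    by (rule bochner_l2_const[OF l2n.seminormed_axioms X_l2[OF v]])
  have mu: "integrable time (\<lambda>t. l2_inner LO (u t) v)"
    by (rule L2_L2_inner_integrable[OF L2_H1_imp_L2_L2[OF G1.\<Omega> u] const])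
  have "continuous_on {0..T} (\<lambda>t. l2_inner LO (c t) v)"
    using l2_continuous_inner[OF c l2_continuous_const[OF X_l2[OF v]], of "\<lambda>t. t" "\<lambda>t. t"] by simp
  then have mc: "integrable time (\<lambda>t. l2_inner LO (c t) v)"
    by (rule time_integral_continuous(1))
  have "(\<integral>t. l2_inner LO (u t) v * d\<phi> t \<partial>time) = (\<integral>t. l2_inner LO (c t) v * d\<phi> t \<partial>time)"
    if "continuous_on UNIV d\<phi>" for d\<phi>
    using ae by (intro integral_cong_AE borel_measurable_integrable integrable_mult_continuous mu mc that) auto
  moreover have "weak_time_derivative T (\<lambda>t. l2_inner LO (u t) v) (\<lambda>t. du t v)"
    using d v by (simp add: has_time_derivative_iff)
  ultimately show ?thesis
    unfolding weak_time_derivative_def by simp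
qed

text \<open>The zero values of the state difference at 0 and of the adjoint state at T remove the
  time derivatives, and the symmetry of the Robin form removes the elliptic part. Only the
  difference of the controls on \<Gamma>2 survives.\<close>

lemma adjoint_identity:
  assumes q: "q \<in> Q" and q': "q' \<in> Q"
  shows "L2_L2_inner T LO (\<lambda>t x. S q t x - z t x) (\<lambda>t x. S q' t x - S q t x) =
    - L2_L2_inner T (surface_on \<Gamma>2) (\<lambda>t. tr (A q t)) (\<lambda>t x. q' t x - q t x)"
proof -
  let ?w = "\<lambda>t x. S q' t x - S q t x" and ?p = "A q" and ?d = "\<lambda>t x. q' t x - q t x"
  let ?e = "\<lambda>t x. S q t x - z t x"
  note sol_diff = sol_lin[OF state_sol[OF q'] state_sol[OF q], of 1 "-1", simplified]
  have wB: "?w \<in> L2_H1 T \<Omega>" by (rule sol_diff(1))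
  have pB: "?p \<in> L2_H1 T \<Omega>" by (rule adjoint_H1[OF q])
  have dQ: "?d \<in> Q" by (rule l2n.bochner_l2_diff[OF q' q])
  have eL: "?e \<in> L2_L2 T LO" by (rule l2n.bochner_l2_diff[OF state_L2[OF q] z])
  obtain dw where dw: "dw \<in> L2_H1_dual T \<Omega>" "has_time_derivative T \<Omega> ?w dw"
    "AE t in time. \<forall>v\<in>X. dw t v + robin (?w t) v = load q' t v - load q t v"
    using sol_diff(3) by blast
  obtain cw where cw: "l2_continuous T LO cw" "time_ae_eq T LO ?w cw" "AE x in LO. cw 0 x = 0"
    using sol_diff(2) unfolding has_value_at_iff by blast
  obtain dp where dp: "dp \<in> L2_H1_dual T \<Omega>" "has_time_derivative T \<Omega> ?p dp"
    "AE t in time. \<forall>v\<in>X. - dp t v + robin (?p t) v = l2_inner LO (?e t) v"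
    using adjoint_sol[OF q] unfolding is_adjoint_state_def by blast
  have "has_value_at T \<Omega> ?p T (\<lambda>x. 0)"
    using adjoint_sol[OF q] by (simp add: is_adjoint_state_def)
  then obtain cp where cp: "l2_continuous T LO cp" "time_ae_eq T LO ?p cp" "AE x in LO. cp T x = 0"
    unfolding has_value_at_iff by blast
  have parts: "(\<integral>t. dw t (?p t) \<partial>time) + (\<integral>t. dp t (?w t) \<partial>time) = 0"
    using H1.integration_by_parts_zero[OF _ T wB pB dw(1) dp(1) cw(1) cp(1) cw(2) cp(2)
        weak_time_derivative_continuous_rep[OF wB dw(2) cw(1,2)]
        weak_time_derivative_continuous_rep[OF pB dp(2) cp(1,2)] cw(3) cp(3)] X_l2 by blast
  have trp: "(\<lambda>t. tr (?p t)) \<in> Q" by (rule G2.trace_bochner[OF pB])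
  \<comment> \<open>In both equations the exceptional null set of times is independent of v, so test
    functions depending on t may be inserted.\<close>
  have point: "AE t in time. l2_inner LO (?e t) (?w t) =
      - (dw t (?p t) + dp t (?w t)) - l2_inner (surface_on \<Gamma>2) (tr (?p t)) (?d t)"
    using dw(3) dp(3) AE_space
  proof eventually_elim
    case (elim t)
    then have t: "t \<in> {0<..<T}" by simp
    have wX: "?w t \<in> X" and pX: "?p t \<in> X"
      by (rule bochner_l2D(1)[OF wB t], rule bochner_l2D(1)[OF pB t])
    have "dw t (?p t) + robin (?w t) (?p t) = load q' t (?p t) - load q t (?p t)"
      by (rule bspec[OF elim(1) pX])
    moreover have "load q' t (?p t) - load q t (?p t) = - l2_inner (surface_on \<Gamma>2) (?d t) (tr (?p t))"
      using load_lin[OF q' q t pX, of 1 "-1"] by (simp add: load_def)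
    moreover have "l2_inner (surface_on \<Gamma>2) (?d t) (tr (?p t)) = l2_inner (surface_on \<Gamma>2) (tr (?p t)) (?d t)"
      by (simp add: l2_inner_def mult.commute)
    moreover have "- dp t (?w t) + robin (?p t) (?w t) = l2_inner LO (?e t) (?w t)"
      by (rule bspec[OF elim(2) wX])
    moreover have "robin (?p t) (?w t) = robin (?w t) (?p t)"
      by (rule G1.robin_form_sym)
    ultimately show ?case by linarith
  qed
  note ip = H1.duality_integrable[OF dw(1) pB] and iw = H1.duality_integrable[OF dp(1) wB]
    and iq = L2_L2_inner_integrable[OF trp dQ]
    and ie = L2_L2_inner_integrable[OF eL L2_H1_imp_L2_L2[OF G1.\<Omega> wB]]
  have "L2_L2_inner T LO ?e ?w =
      (\<integral>t. - (dw t (?p t) + dp t (?w t)) - l2_inner (surface_on \<Gamma>2) (tr (?p t)) (?d t) \<partial>time)"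
    unfolding L2_L2_inner_def
    by (rule integral_cong_AE[OF borel_measurable_integrable[OF ie] borel_measurable_integrable point])
      (intro Bochner_Integration.integrable_diff Bochner_Integration.integrable_minus
        Bochner_Integration.integrable_add ip iw iq)
  also have "\<dots> = - ((\<integral>t. dw t (?p t) \<partial>time) + (\<integral>t. dp t (?w t) \<partial>time)) -
      L2_L2_inner T (surface_on \<Gamma>2) (\<lambda>t. tr (?p t)) ?d"
    using ip iw iq by (simp add: L2_L2_inner_def)
  finally show ?thesis
    by (simp only: parts)
qed

section \<open>The gradient of the cost\<close>

abbreviation "grad q \<equiv> (\<lambda>t x. M * q t x - tr (A q t) x)"

lemma grad_mem: "q \<in> Q \<Longrightarrow> grad q \<in> Q"
  using l2n.bochner_l2_lin[of q T "surface_on \<Gamma>2" "\<lambda>t. tr (A q t)" M "-1"] G2.trace_bochner[OF adjoint_H1]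
  by simp

lemma cost_expansion:
  assumes q: "q \<in> Q" and q': "q' \<in> Q"
  shows "J q' = J q + L2_L2_inner T (surface_on \<Gamma>2) (grad q) (\<lambda>t x. q' t x - q t x)
    + 1/2 * (L2_L2_norm T LO (\<lambda>t x. S q' t x - S q t x))\<^sup>2
    + M/2 * (L2_L2_norm T (surface_on \<Gamma>2) (\<lambda>t x. q' t x - q t x))\<^sup>2"
proof -
  let ?e = "\<lambda>t x. S q t x - z t x" and ?w = "\<lambda>t x. S q' t x - S q t x" and ?d = "\<lambda>t x. q' t x - q t x"
  have e: "?e \<in> L2_L2 T LO" and w: "?w \<in> L2_L2 T LO" and d: "?d \<in> Q"
    by (intro l2n.bochner_l2_diff state_L2 q q' z)+
  have "(\<lambda>t x. S q' t x - z t x) = (\<lambda>t x. 1 * ?e t x + 1 * ?w t x)"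
    by simp
  then have E: "(L2_L2_norm T LO (\<lambda>t x. S q' t x - z t x))\<^sup>2 =
      (L2_L2_norm T LO ?e)\<^sup>2 + 2 * L2_L2_inner T LO ?e ?w + (L2_L2_norm T LO ?w)\<^sup>2"
    using L2_L2_quad[OF e w, of 1 1] by (simp add: L2_L2_norm_sq)
  have "q' = (\<lambda>t x. 1 * q t x + 1 * ?d t x)"
    by simp
  then have D: "(L2_L2_norm T (surface_on \<Gamma>2) q')\<^sup>2 =
      (L2_L2_norm T (surface_on \<Gamma>2) q)\<^sup>2 + 2 * L2_L2_inner T (surface_on \<Gamma>2) q ?d + (L2_L2_norm T (surface_on \<Gamma>2) ?d)\<^sup>2"
    using L2_L2_quad[OF q d, of 1 1] by (simp add: L2_L2_norm_sq)
  have "L2_L2_inner T (surface_on \<Gamma>2) (grad q) ?d =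
      M * L2_L2_inner T (surface_on \<Gamma>2) q ?d - L2_L2_inner T (surface_on \<Gamma>2) (\<lambda>t. tr (A q t)) ?d"
    using L2_L2_inner_lin_left[OF q G2.trace_bochner[OF adjoint_H1[OF q]] d, of M "-1"] by simp
  \<comment> \<open>The linear term coming from the states is traded for the boundary term with the
    adjoint state, which is linear in the change of control.\<close>
  with adjoint_identity[OF q q'] have "L2_L2_inner T (surface_on \<Gamma>2) (grad q) ?d =
      M * L2_L2_inner T (surface_on \<Gamma>2) q ?d + L2_L2_inner T LO ?e ?w"
    by simp
  then show ?thesis
    unfolding cost_def E D by (simp add: algebra_simps)
qed

text \<open>q + s h equals (1 - s) q + s (q + h), a combination with sum one. Uniqueness then
  identifies the chosen state, up to null sets, for every real s.\<close>

lemma state_affine: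
  assumes q: "q \<in> Q" and h: "h \<in> Q"
  shows "time_ae_eq T LO (S (\<lambda>t x. q t x + s * h t x))
    (\<lambda>t x. S q t x + s * (S (\<lambda>t x. q t x + h t x) t x - S q t x))"
proof -
  let ?qh = "\<lambda>t x. q t x + h t x" and ?qs = "\<lambda>t x. q t x + s * h t x"
  have qh: "?qh \<in> Q" using l2n.bochner_l2_lin[OF q h, of 1 1] by simp
  have qs: "?qs \<in> Q" using l2n.bochner_l2_lin[OF q h, of 1 s] by simp
  have "sol (\<lambda>t x. (1 - s) * q t x + s * ?qh t x) (\<lambda>t x. (1 - s) * S q t x + s * S ?qh t x)"
    by (rule sol_affine[OF q qh state_sol[OF q] state_sol[OF qh]]) simp
  moreover have "(\<lambda>t x. (1 - s) * q t x + s * ?qh t x) = ?qs"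
    by (simp add: fun_eq_iff algebra_simps)
  moreover have "(\<lambda>t x. (1 - s) * S q t x + s * S ?qh t x) = (\<lambda>t x. S q t x + s * (S ?qh t x - S q t x))"
    by (simp add: fun_eq_iff algebra_simps)
  ultimately have "sol ?qs (\<lambda>t x. S q t x + s * (S ?qh t x - S q t x))"
    by (simp only:)
  then show ?thesis
    by (rule unique_solution_eq[where P="sol ?qs", OF state_solvable[OF qs] state_sol[OF qs]])
qed

lemma cost_gateaux:
  assumes q: "q \<in> Q"
  shows "has_gateaux_gradient T (surface_on \<Gamma>2) J q (grad q)"
  unfolding has_gateaux_gradient_def
proof (intro conjI ballI grad_mem q)
  fix h assume h: "h \<in> Q"
  let ?w = "\<lambda>t x. S (\<lambda>t x. q t x + h t x) t x - S q t x"
  let ?b = "L2_L2_inner T (surface_on \<Gamma>2) (grad q) h"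
  define k where "k = 1/2 * (L2_L2_norm T LO ?w)\<^sup>2 + M/2 * (L2_L2_norm T (surface_on \<Gamma>2) h)\<^sup>2"
  have qh: "(\<lambda>t x. q t x + h t x) \<in> Q" using l2n.bochner_l2_lin[OF q h, of 1 1] by simp
  have w: "?w \<in> L2_L2 T LO" by (intro l2n.bochner_l2_diff state_L2 q qh)
  \<comment> \<open>Along a line the cost is an exact quadratic polynomial in s: the state
    difference is s times that for s = 1.\<close>
  have J: "J (\<lambda>t x. q t x + s * h t x) - J q = s * ?b + s\<^sup>2 * k" for s
  proof -
    let ?qs = "\<lambda>t x. q t x + s * h t x"
    have qs: "?qs \<in> Q" using l2n.bochner_l2_lin[OF q h, of 1 s] by simp
    have ws: "(\<lambda>t x. S ?qs t x - S q t x) \<in> L2_L2 T LO"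
      by (intro l2n.bochner_l2_diff state_L2 q qs)
    have sw: "(\<lambda>t x. s * ?w t x + 0 * ?w t x) \<in> L2_L2 T LO"
      by (rule l2n.bochner_l2_lin[OF w w])
    have "time_ae_eq T LO (\<lambda>t x. S ?qs t x - S q t x) (\<lambda>t x. s * ?w t x + 0 * ?w t x)"
      using time_ae_eq_lin[OF state_affine[OF q h, of s] time_ae_eq_refl[of T LO "S q"], of 1 "-1"] by simp
    then have "L2_L2_inner T LO (\<lambda>t x. S ?qs t x - S q t x) (\<lambda>t x. S ?qs t x - S q t x) =
        L2_L2_inner T LO (\<lambda>t x. s * ?w t x + 0 * ?w t x) (\<lambda>t x. s * ?w t x + 0 * ?w t x)"
      by (intro L2_L2_inner_cong ws sw)
    then have W: "(L2_L2_norm T LO (\<lambda>t x. S ?qs t x - S q t x))\<^sup>2 = s\<^sup>2 * (L2_L2_norm T LO ?w)\<^sup>2"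
      using L2_L2_quad[OF w w, of s 0] by (simp add: L2_L2_norm_sq)
    have d: "(\<lambda>t x. ?qs t x - q t x) = (\<lambda>t x. s * h t x + 0 * h t x)"
      by simp
    have B: "L2_L2_inner T (surface_on \<Gamma>2) (grad q) (\<lambda>t x. ?qs t x - q t x) = s * ?b"
      using L2_L2_inner_lin_left[OF h h grad_mem[OF q], of s 0] unfolding d by (simp add: L2_L2_inner_sym)
    have D: "(L2_L2_norm T (surface_on \<Gamma>2) (\<lambda>t x. ?qs t x - q t x))\<^sup>2 = s\<^sup>2 * (L2_L2_norm T (surface_on \<Gamma>2) h)\<^sup>2"
      unfolding d using L2_L2_quad[OF h h, of s 0] by (simp add: L2_L2_norm_sq)
    show ?thesis
      unfolding cost_expansion[OF q qs] W B D k_def by (simp add: algebra_simps)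
  qed
  have "((\<lambda>s. ?b + s * k) \<longlongrightarrow> ?b + 0 * k) (at 0)"
    by (intro tendsto_intros)
  then have "((\<lambda>s. ?b + s * k) \<longlongrightarrow> ?b) (at 0)" by simp
  moreover have "\<forall>\<^sub>F s in at 0. ?b + s * k = (J (\<lambda>t x. q t x + s * h t x) - J q) / s"
    by (rule eventually_at_filter[THEN iffD2], rule always_eventually) (simp add: J field_simps power2_eq_square)
  ultimately show "((\<lambda>s. (J (\<lambda>t x. q t x + s * h t x) - J q) / s) \<longlongrightarrow> ?b) (at 0)"
    by (rule Lim_transform_eventually)
qed

section \<open>Minimality and the optimality condition\<close>

lemma cost_convex:
  assumes "q \<in> Q" "q' \<in> Q"
  shows "J q' \<ge> J q + L2_L2_inner T (surface_on \<Gamma>2) (grad q) (\<lambda>t x. q' t x - q t x)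
    + M/2 * (L2_L2_norm T (surface_on \<Gamma>2) (\<lambda>t x. q' t x - q t x))\<^sup>2"
  using cost_expansion[OF assms] by simp

lemma cost_nonneg: "0 \<le> J q"
  using M by (simp add: cost_def)

text \<open>Quadratic growth around a critical control, used both for sufficiency of the optimality
  condition and for uniqueness of the minimizer.\<close>

lemma cost_ge_of_critical:
  assumes q: "q \<in> Q" and q': "q' \<in> Q" and crit: "time_ae_eq T (surface_on \<Gamma>2) (grad q) (\<lambda>t x. 0)"
  shows "J q + M/2 * (L2_L2_norm T (surface_on \<Gamma>2) (\<lambda>t x. q' t x - q t x))\<^sup>2 \<le> J q'"
proof -
  have d: "(\<lambda>t x. q' t x - q t x) \<in> Q" by (rule l2n.bochner_l2_diff[OF q' q])
  have "L2_L2_inner T (surface_on \<Gamma>2) (grad q) (\<lambda>t x. q' t x - q t x) =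
      L2_L2_inner T (surface_on \<Gamma>2) (\<lambda>t x. 0) (\<lambda>t x. q' t x - q t x)"
    by (intro L2_L2_inner_cong grad_mem q L2_L2_zero d crit time_ae_eq_refl)
  also have "\<dots> = 0" by (simp add: L2_L2_inner_def l2_inner_def)
  finally show ?thesis using cost_convex[OF q q'] by simp
qed

text \<open>Necessity uses the Gateaux derivative in the direction of the negative gradient,
  sufficiency the growth around critical points.\<close>

lemma optimality_condition:
  assumes q: "q \<in> Q"
  shows "is_arg_min J (\<lambda>q. q \<in> Q) q \<longleftrightarrow> time_ae_eq T (surface_on \<Gamma>2) (grad q) (\<lambda>t x. 0)"
proof
  assume "is_arg_min J (\<lambda>q. q \<in> Q) q"
  then show "time_ae_eq T (surface_on \<Gamma>2) (grad q) (\<lambda>t x. 0)"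
    by (rule gateaux_gradient_at_minimum[OF cost_gateaux[OF q] q])
next
  assume crit: "time_ae_eq T (surface_on \<Gamma>2) (grad q) (\<lambda>t x. 0)"
  show "is_arg_min J (\<lambda>q. q \<in> Q) q"
    unfolding is_arg_min_iff
  proof (intro conjI allI impI q)
    fix q' assume "q' \<in> Q"
    moreover have "0 \<le> M/2 * (L2_L2_norm T (surface_on \<Gamma>2) (\<lambda>t x. q' t x - q t x))\<^sup>2"
      using M by simp
    ultimately show "J q \<le> J q'"
      using cost_ge_of_critical[OF q _ crit] by fastforce
  qed
qed

lemma minimum_exists_unique:
  "\<exists>q0. is_arg_min J (\<lambda>q. q \<in> Q) q0 \<and>
    (\<forall>q. is_arg_min J (\<lambda>q. q \<in> Q) q \<longrightarrow> time_ae_eq T (surface_on \<Gamma>2) q q0)"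
proof -
  have "\<exists>q. is_arg_min J (\<lambda>q. q \<in> Q) q"
    by (rule uniformly_convex_minimum_exists[OF _ cost_nonneg grad_mem cost_convex]) (use M in simp)
  then obtain q0 where min0: "is_arg_min J (\<lambda>q. q \<in> Q) q0" by blast
  then have q0: "q0 \<in> Q" by (simp add: is_arg_min_iff)
  then have crit: "time_ae_eq T (surface_on \<Gamma>2) (grad q0) (\<lambda>t x. 0)"
    using min0 optimality_condition by blast
  have "time_ae_eq T (surface_on \<Gamma>2) q q0" if min: "is_arg_min J (\<lambda>q. q \<in> Q) q" for q
  proof -
    have q: "q \<in> Q" and le: "J q \<le> J q0"
      using min q0 by (auto simp: is_arg_min_iff)
    let ?d = "\<lambda>t x. q t x - q0 t x"
    have d: "?d \<in> Q" by (rule l2n.bochner_l2_diff[OF q q0])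
    \<comment> \<open>Growth around q0, evaluated at another minimizer, leaves no room for a
      positive distance.\<close>
    have "M/2 * (L2_L2_norm T (surface_on \<Gamma>2) ?d)\<^sup>2 \<le> 0"
      using cost_ge_of_critical[OF q0 q crit] le by simp
    then have "(L2_L2_norm T (surface_on \<Gamma>2) ?d)\<^sup>2 \<le> 0"
      using M by (simp add: mult_le_0_iff)
    then have "L2_L2_inner T (surface_on \<Gamma>2) ?d ?d = 0"
      unfolding L2_L2_norm_sq using L2_L2_inner_pos[of T "surface_on \<Gamma>2" ?d] by simp
    then show ?thesis
      using L2_L2_norm_0_iff[OF d] by (simp add: time_ae_eq_def)
  qed
  with min0 show ?thesis by blast
qed

end

text \<open>Uniqueness is expressed by equality almost everywhere because controls are
  representatives. The optimality condition appears as an equivalence for every control, so it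
  characterizes the minimizer instead of merely holding at it.\<close>

theorem lemma2p3:
  fixes \<Omega> \<Gamma>1 \<Gamma>2 :: "(real ^ 'n) set"
    and tr :: "(real ^ 'n \<Rightarrow> real) \<Rightarrow> (real ^ 'n \<Rightarrow> real)"
    and T M \<alpha> :: real
    and g z\<^sub>d :: "real \<Rightarrow> real ^ 'n \<Rightarrow> real"
    and b v\<^sub>b :: "real ^ 'n \<Rightarrow> real"
  assumes domain: "regular_domain \<Omega>"
    and boundary: "frontier \<Omega> = \<Gamma>1 \<union> \<Gamma>2" "\<Gamma>1 \<inter> \<Gamma>2 = {}" "\<Gamma>1 \<in> sets borel" "\<Gamma>2 \<in> sets borel"
    and positive_measure: "0 < emeasure surface_measure \<Gamma>1" "0 < emeasure surface_measure \<Gamma>2"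
    and trace: "trace_operator \<Omega> tr"
    and constants: "0 < T" "0 < M" "0 < \<alpha>"
    and data: "g \<in> L2_L2 T (lebesgue_on \<Omega>)" "z\<^sub>d \<in> L2_L2 T (lebesgue_on \<Omega>)"
      "b \<in> h_half_space \<Gamma>1"
      "v\<^sub>b \<in> h1_space \<Omega>" "AE x in surface_on \<Gamma>1. tr v\<^sub>b x = b x"
    and state_solvable: "\<And>q. q \<in> L2_L2 T (surface_on \<Gamma>2) \<Longrightarrow>
      unique_solution T \<Omega> (is_state \<Omega> \<Gamma>1 \<Gamma>2 tr T \<alpha> g b v\<^sub>b q)"
    and adjoint_solvable: "\<And>q. q \<in> L2_L2 T (surface_on \<Gamma>2) \<Longrightarrow>
      unique_solution T \<Omega> (is_adjoint_state \<Omega> \<Gamma>1 tr T \<alpha> z\<^sub>d (state \<Omega> \<Gamma>1 \<Gamma>2 tr T \<alpha> g b v\<^sub>b q))"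
  shows "(\<exists>q\<^sub>0. is_arg_min (cost \<Omega> \<Gamma>1 \<Gamma>2 tr T \<alpha> g b v\<^sub>b z\<^sub>d M)
                 (\<lambda>q. q \<in> L2_L2 T (surface_on \<Gamma>2)) q\<^sub>0 \<and>
            (\<forall>q. is_arg_min (cost \<Omega> \<Gamma>1 \<Gamma>2 tr T \<alpha> g b v\<^sub>b z\<^sub>d M)
                   (\<lambda>q. q \<in> L2_L2 T (surface_on \<Gamma>2)) q \<longrightarrow>
                 time_ae_eq T (surface_on \<Gamma>2) q q\<^sub>0)) \<and>
         (\<forall>q\<in>L2_L2 T (surface_on \<Gamma>2).
            has_gateaux_gradient T (surface_on \<Gamma>2) (cost \<Omega> \<Gamma>1 \<Gamma>2 tr T \<alpha> g b v\<^sub>b z\<^sub>d M) q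
              (\<lambda>t x. M * q t x - tr (adjoint_state \<Omega> \<Gamma>1 \<Gamma>2 tr T \<alpha> g b v\<^sub>b z\<^sub>d q t) x)) \<and>
         (\<forall>q\<in>L2_L2 T (surface_on \<Gamma>2).
            is_arg_min (cost \<Omega> \<Gamma>1 \<Gamma>2 tr T \<alpha> g b v\<^sub>b z\<^sub>d M)
              (\<lambda>q. q \<in> L2_L2 T (surface_on \<Gamma>2)) q \<longleftrightarrow>
            time_ae_eq T (surface_on \<Gamma>2)
              (\<lambda>t x. M * q t x - tr (adjoint_state \<Omega> \<Gamma>1 \<Gamma>2 tr T \<alpha> g b v\<^sub>b z\<^sub>d q t) x) (\<lambda>t x. 0))"
proof -
  have \<Omega>: "open \<Omega>" "bounded \<Omega>"
    using domain by (simp_all add: regular_domain_def)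
  interpret boundary_control \<Omega> \<Gamma>1 \<Gamma>2 tr T M \<alpha> g z\<^sub>d b v\<^sub>b
    by unfold_locales (use \<Omega> boundary trace constants data state_solvable adjoint_solvable in auto)
  show ?thesis
    using minimum_exists_unique cost_gateaux optimality_condition by blast
qed

end
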